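(* Let $(X_t)_{t\ge 0}$ be a Lévy process in $\mathbf{R}^d$ as in the context, satisfying (A1), (A2), (A3), and let $V$ be a potential satisfying (A4) with some $r_0>0$. Let $\varphi$ be a positive solution of $H\varphi=0$. Then the following hold. (1) If $\lim_{|x|\to\infty}\frac{\Psi(1/|x|)}{V^*(x)}=0$ and $\int_{|x|>2r_0}\frac{\nu(x)}{V^*(x)}dx<\infty$, then there exist $C>0$ and $R\ge2r_0$ such that $$\varphi(x)\ge C\,\frac{\nu(x)}{V^*(x)},\qquad|x|>R.$$ (2) If $\lim_{|x|\to\infty}\frac{\Psi(1/|x|)}{V^*(x)}=0$ and $\int_{|x|>2r_0}\frac{\nu(x)}{V^*(x)}dx=\infty$, then there exist $\eta^*,C>0$ and $R\ge2r_0$ such that $$\varphi(x)\ge C\,\frac{\nu(x)}{V^*(x)}\exp\left(\eta^*\int_{2r_0\le|y|\le|x|}\frac{\nu(y)}{V^*(y)}\,dy\right),\qquad|x|>R.$$ (3) If $\liminf_{|x|\to\infty}\frac{\Psi(1/|x|)}{V^*(x)}>0$ and $\int_{|x|>2r_0}\frac{\nu(x)}{\Psi(1/|x|)}dx<\infty$, then there exist $C>0$ and $R\ge2r_0$ such that $$\varphi(x)\ge C\,\frac{\nu(x)}{\Psi(1/|x|)},\qquad|x|>R.$$ (4) If $\liminf_{|x|\to\infty}\frac{\Psi(1/|x|)}{V^*(x)}>0$ and $\int_{|x|>2r_0}\frac{\nu(x)}{\Psi(1/|x|)}dx=\infty$, then there exist $\eta^*,C>0$ and $R\ge2r_0$ such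 that $$\varphi(x)\ge C\,\frac{\nu(x)}{\Psi(1/|x|)}\exp\left(\eta^*\int_{2r_0\le|y|\le|x|}\frac{\nu(y)}{\Psi(1/|y|)}\,dy\right),\qquad|x|>R.$$
   Context: **Notation.** $B(x,r)$ is the open ball, $a\wedge b=\min$, $a\vee b=\max$; $1/0=+\infty$. **Process.** $d\ge1$. $(X_t)_{t\ge0}$ is a càdlàg Lévy process in $\mathbf{R}^d$, with $\mathbf{P}^x,\mathbf{E}^x$ referring to the start $X_0=x$, and $\mathbf{E}^0[e^{i\xi\cdot X_t}]=e^{-t\psi(\xi)}$, where $$\psi(\xi)=A\xi\cdot\xi+\int_{\mathbf{R}^d\setminus\{0\}}(1-\cos(\xi\cdot z))\,\nu(z)\,dz,$$ $A$ is a symmetric non-negative definite $d\times d$ matrix, and $\nu:\mathbf{R}^d\setminus\{0\}\to(0,\infty)$ is a Borel function with $\nu(z)=\nu(-z)$, $\int(1\wedge|z|^2)\nu(z)dz<\infty$ and $\int\nu(z)dz=\infty$. Then $X_t$ has transition densities: $\mathbf{P}^0(X_t\in E)=\int_E p(t,x)dx$. $L$ is the generator of the process ($\widehat{Lf}=-\psi\widehat f$). Put $\Psi(r)=\sup_{|\xi|\le r}\psi(\xi)$. For open $D$, $\tau_D=\inf\{t\ge0:X_t\notin D\}$; for bounded open $D$, $G_D(x,y)=\int_0^\infty p_D(t,x,y)dt$ with $p_D(t,x,y)=p(t,y-x)-\mathbf{E}^x[p(t-\tau_D,y-X_{\tau_D});\tau_D<t]$. **(A1)** There are a non-increasing $g:(0,\infty)\to(0,\infty)$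 and constants $C_5\ge1$, $C_6>0$ with $C_5^{-1}g(|x|)\le\nu(x)\le C_5g(|x|)$ for $x\neq0$, and $g(|x|)\le C_6\,g(2|x|)$ for $|x|\ge1$. **(A2)** There is $t_b>0$ with $\sup_xp(t_b,x)=p(t_b,0)<\infty$. **(A3)** There is $C_7$ with $\sup_{x,y:\,|x-y|\ge s/8}G_{B(0,s)}(x,y)\le \dfrac{C_7}{s^d\,\Psi(1/s)}$ for all $s\ge1$. **Potentials.** A Borel $V:\mathbf{R}^d\to\mathbf{R}$ belongs to $\mathcal{K}^X$ if $\lim_{t\downarrow0}\sup_x\mathbf{E}^x[\int_0^t|V(X_s)|ds]=0$, and to $\mathcal{K}^X_{loc}$ if $V1_K\in\mathcal{K}^X$ for each compact $K$. $V$ is an $X$-Kato class potential if $V_-\in\mathcal{K}^X$ and $V_+\in\mathcal{K}^X_{loc}$. **(A4)** (with $r_0>0$) $V$ is an $X$-Kato class potential, $V(x)\to0$ as $|x|\to\infty$, and $V(x)\ge0$ for $|x|\ge r_0$. For such $V$: $V^*(x)=\sup_{|y|\ge\frac{|x|}2}V(y)$, $|x|\ge2r_0$. **Solutions.** $T_tf(x)=\mathbf{E}^x[e^{-\int_0^tV(X_s)ds}f(X_t)]$ is the Feynman–Kac semigroup, with generator $-H$, $H=-L+V$. A solution of $H\varphi=0$ is a function $\varphi\in L^p(\mathbf{R}^d)$ for some $p\ge1$, $\varphi\not\equiv0$, with $T_t\varphi=\varphi$ for all $t\ge0$. Every such $\varphi$ is (has a version which is) bounded and continuous. *)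

theory Defs
  imports "HOL-Probability.Probability"
begin

section \<open>The process\<close>

definition cadlag :: "(real \<Rightarrow> 'a::topological_space) \<Rightarrow> bool" where
  "cadlag f \<longleftrightarrow> (\<forall>t\<ge>0. (f \<longlongrightarrow> f t) (at_right t)) \<and> (\<forall>t>0. \<exists>l. (f \<longlongrightarrow> l) (at_left t))"

text \<open>The process is given by its law \<open>P\<^sup>0\<close>. The law \<open>P\<^sup>x\<close> is that of \<open>x + X\<close>, so in everything
  below \<open>x + X t \<omega>\<close> stands for \<open>X\<^sub>t\<close> under \<open>P\<^sup>x\<close>.\<close>

locale levy_process = prob_space M
  for M :: "'w measure" +
  fixes X :: "real \<Rightarrow> 'w \<Rightarrow> real ^ 'n"
  assumes measurable_X: "\<And>t. t \<ge> 0 \<Longrightarrow> X t \<in> borel_measurable M"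
    and start_0: "AE \<omega> in M. X 0 \<omega> = 0"
    and cadlag_paths: "\<And>\<omega>. \<omega> \<in> space M \<Longrightarrow> cadlag (\<lambda>t. X t \<omega>)"
    and independent_increments:
      "\<And>(u :: nat \<Rightarrow> real) n. 0 \<le> u 0 \<Longrightarrow> mono u \<Longrightarrow>
         indep_vars (\<lambda>_. borel) (\<lambda>i \<omega>. X (u (Suc i)) \<omega> - X (u i) \<omega>) {..<n}"
    and stationary_increments:
      "\<And>s t. 0 \<le> s \<Longrightarrow> 0 \<le> t \<Longrightarrow>
         distr M borel (\<lambda>\<omega>. X (s + t) \<omega> - X s \<omega>) = distr M borel (X t)"

text \<open>The value of a density \<open>\<nu>\<close> at the origin is never used.\<close>

definition levy_exponent :: "real ^ 'n ^ 'n \<Rightarrow> (real ^ 'n \<Rightarrow> real) \<Rightarrow> real ^ 'n \<Rightarrow> real" where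
  "levy_exponent A \<nu> \<xi> =
     (A *v \<xi>) \<bullet> \<xi> + (LINT z:(- {0})|lborel. (1 - cos (\<xi> \<bullet> z)) * \<nu> z)"

definition exponent_sup :: "real ^ 'n ^ 'n \<Rightarrow> (real ^ 'n \<Rightarrow> real) \<Rightarrow> real \<Rightarrow> real" where
  "exponent_sup A \<nu> r = (SUP \<xi>\<in>cball 0 r. levy_exponent A \<nu> \<xi>)"

locale symmetric_levy_process = levy_process M X
  for M :: "'w measure" and X :: "real \<Rightarrow> 'w \<Rightarrow> real ^ 'n" +
  fixes A :: "real ^ 'n ^ 'n" and \<nu> :: "real ^ 'n \<Rightarrow> real"
  assumes A_symmetric: "transpose A = A"
    and A_nonneg: "\<And>\<xi>. 0 \<le> (A *v \<xi>) \<bullet> \<xi>"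
    and nu_measurable: "\<nu> \<in> borel_measurable (restrict_space borel (- {0}))"
    and nu_pos: "\<And>z. z \<noteq> 0 \<Longrightarrow> 0 < \<nu> z"
    and nu_symmetric: "\<And>z. z \<noteq> 0 \<Longrightarrow> \<nu> (- z) = \<nu> z"
    and nu_levy: "(\<integral>\<^sup>+z\<in>- {0}. ennreal (min 1 ((norm z)\<^sup>2) * \<nu> z) \<partial>lborel) < \<infinity>"
    and nu_infinite: "(\<integral>\<^sup>+z\<in>- {0}. ennreal (\<nu> z) \<partial>lborel) = \<infinity>"
    and characteristic_function:
      "\<And>t \<xi>. 0 \<le> t \<Longrightarrow>
         (LINT \<omega>|M. exp (\<i> * complex_of_real (\<xi> \<bullet> X t \<omega>)))
           = complex_of_real (exp (- t * levy_exponent A \<nu> \<xi>))"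


section \<open>Transition densities and Green functions\<close>

text \<open>Densities take values in \<open>[0,\<infinity>]\<close>, since \<open>p t 0\<close> may be infinite for small \<open>t\<close>. Joint
  measurability is what makes the integrals over time below meaningful.\<close>

definition transition_density ::
    "'w measure \<Rightarrow> (real \<Rightarrow> 'w \<Rightarrow> real ^ 'n) \<Rightarrow> (real \<Rightarrow> real ^ 'n \<Rightarrow> ennreal) \<Rightarrow> bool" where
  "transition_density M X p \<longleftrightarrow>
     (\<lambda>(t, x). p t x) \<in> borel_measurable (restrict_space (borel \<Otimes>\<^sub>M borel) ({0<..} \<times> UNIV)) \<and>
     (\<forall>t>0. distributed M lborel (X t) (p t))"

text \<open>The first exit time from \<open>D\<close> under \<open>P\<^sup>x\<close>; it is \<open>\<infinity>\<close> if the path never leaves \<open>D\<close>.\<close>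

definition exit_time ::
    "(real \<Rightarrow> 'w \<Rightarrow> real ^ 'n) \<Rightarrow> (real ^ 'n) set \<Rightarrow> real ^ 'n \<Rightarrow> 'w \<Rightarrow> ennreal" where
  "exit_time X D x \<omega> = (INF t\<in>{t. 0 \<le> t \<and> x + X t \<omega> \<notin> D}. ennreal t)"

text \<open>The expectation is taken over the completion of \<open>M\<close>, because exit times of cadlag processes
  need not be measurable on the uncompleted space.\<close>

definition killed_density ::
    "'w measure \<Rightarrow> (real \<Rightarrow> 'w \<Rightarrow> real ^ 'n) \<Rightarrow> (real \<Rightarrow> real ^ 'n \<Rightarrow> ennreal) \<Rightarrow>
     (real ^ 'n) set \<Rightarrow> real \<Rightarrow> real ^ 'n \<Rightarrow> real ^ 'n \<Rightarrow> ennreal" where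
  "killed_density M X p D t x y =
     p t (y - x) -
     (\<integral>\<^sup>+\<omega>\<in>{\<omega>. exit_time X D x \<omega> < ennreal t}.
        (let \<tau> = enn2real (exit_time X D x \<omega>) in p (t - \<tau>) (y - (x + X \<tau> \<omega>))) \<partial>completion M)"

definition green_function ::
    "'w measure \<Rightarrow> (real \<Rightarrow> 'w \<Rightarrow> real ^ 'n) \<Rightarrow> (real \<Rightarrow> real ^ 'n \<Rightarrow> ennreal) \<Rightarrow>
     (real ^ 'n) set \<Rightarrow> real ^ 'n \<Rightarrow> real ^ 'n \<Rightarrow> ennreal" where
  "green_function M X p D x y = (\<integral>\<^sup>+t\<in>{0<..}. killed_density M X p D t x y \<partial>lborel)"


section \<open>Assumptions on the process\<close>

definition A1 :: "(real ^ 'n \<Rightarrow> real) \<Rightarrow> bool" where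
  "A1 \<nu> \<longleftrightarrow>
     (\<exists>(g :: real \<Rightarrow> real) C5 C6.
        (\<forall>r>0. 0 < g r) \<and> antimono_on {0<..} g \<and> 1 \<le> C5 \<and> 0 < C6 \<and>
        (\<forall>x. x \<noteq> 0 \<longrightarrow> inverse C5 * g (norm x) \<le> \<nu> x \<and> \<nu> x \<le> C5 * g (norm x)) \<and>
        (\<forall>x :: real ^ 'n. 1 \<le> norm x \<longrightarrow> g (norm x) \<le> C6 * g (2 * norm x)))"

definition A2 :: "(real \<Rightarrow> real ^ 'n \<Rightarrow> ennreal) \<Rightarrow> bool" where
  "A2 p \<longleftrightarrow> (\<exists>t\<^sub>b>0. (SUP x. p t\<^sub>b x) = p t\<^sub>b 0 \<and> p t\<^sub>b 0 < \<infinity>)"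

definition A3 ::
    "'w measure \<Rightarrow> (real \<Rightarrow> 'w \<Rightarrow> real ^ 'n) \<Rightarrow> real ^ 'n ^ 'n \<Rightarrow> (real ^ 'n \<Rightarrow> real) \<Rightarrow>
     (real \<Rightarrow> real ^ 'n \<Rightarrow> ennreal) \<Rightarrow> bool" where
  "A3 M X A \<nu> p \<longleftrightarrow>
     (\<exists>C7>0. \<forall>s\<ge>1.
        (SUP (x, y)\<in>{(x, y). s / 8 \<le> norm (x - y)}. green_function M X p (ball 0 s) x y)
          \<le> ennreal (C7 / (s ^ CARD('n) * exponent_sup A \<nu> (1 / s))))"


section \<open>Potentials\<close>

definition kato ::
    "'w measure \<Rightarrow> (real \<Rightarrow> 'w \<Rightarrow> real ^ 'n) \<Rightarrow> (real ^ 'n \<Rightarrow> real) \<Rightarrow> bool" where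
  "kato M X V \<longleftrightarrow>
     V \<in> borel_measurable borel \<and>
     ((\<lambda>t. SUP x. \<integral>\<^sup>+\<omega>. (\<integral>\<^sup>+s\<in>{0..t}. ennreal \<bar>V (x + X s \<omega>)\<bar> \<partial>lborel) \<partial>M) \<longlongrightarrow> 0) (at_right 0)"

definition kato_loc ::
    "'w measure \<Rightarrow> (real \<Rightarrow> 'w \<Rightarrow> real ^ 'n) \<Rightarrow> (real ^ 'n \<Rightarrow> real) \<Rightarrow> bool" where
  "kato_loc M X V \<longleftrightarrow>
     V \<in> borel_measurable borel \<and> (\<forall>K. compact K \<longrightarrow> kato M X (\<lambda>x. V x * indicator K x))"

definition kato_potential ::
    "'w measure \<Rightarrow> (real \<Rightarrow> 'w \<Rightarrow> real ^ 'n) \<Rightarrow> (real ^ 'n \<Rightarrow> real) \<Rightarrow> bool" where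
  "kato_potential M X V \<longleftrightarrow>
     V \<in> borel_measurable borel \<and>
     kato M X (\<lambda>x. max 0 (- V x)) \<and> kato_loc M X (\<lambda>x. max 0 (V x))"

definition A4 ::
    "'w measure \<Rightarrow> (real \<Rightarrow> 'w \<Rightarrow> real ^ 'n) \<Rightarrow> (real ^ 'n \<Rightarrow> real) \<Rightarrow> real \<Rightarrow> bool" where
  "A4 M X V r0 \<longleftrightarrow>
     0 < r0 \<and> kato_potential M X V \<and> (V \<longlongrightarrow> 0) at_infinity \<and> (\<forall>x. r0 \<le> norm x \<longrightarrow> 0 \<le> V x)"

text \<open>Only used for \<open>norm x \<ge> 2 * r0\<close>, where the supremum runs over values \<open>V y \<ge> 0\<close>, so that
  \<open>ennreal\<close> truncates nothing. The supremum can be \<open>\<infinity>\<close> (\<open>V\<close> may be locally unbounded) and it can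
  be \<open>0\<close>; division in \<open>ennreal\<close> follows the convention \<open>1 / 0 = \<infinity>\<close>.\<close>

definition V_star :: "(real ^ 'n \<Rightarrow> real) \<Rightarrow> real ^ 'n \<Rightarrow> ennreal" where
  "V_star V x = (SUP y\<in>{y. norm x / 2 \<le> norm y}. ennreal (V y))"


section \<open>Solutions\<close>

definition feynman_kac ::
    "'w measure \<Rightarrow> (real \<Rightarrow> 'w \<Rightarrow> real ^ 'n) \<Rightarrow> (real ^ 'n \<Rightarrow> real) \<Rightarrow> real \<Rightarrow>
     (real ^ 'n \<Rightarrow> real) \<Rightarrow> real ^ 'n \<Rightarrow> real" where
  "feynman_kac M X V t f x =
     (LINT \<omega>|M. exp (- (LINT s:{0..t}|lborel. V (x + X s \<omega>))) * f (x + X t \<omega>))"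

text \<open>A solution is an element of some \<open>L\<^sup>p\<close>, \<open>1 \<le> p < \<infinity>\<close>, so all identities hold almost everywhere.\<close>

definition zero_energy_solution ::
    "'w measure \<Rightarrow> (real \<Rightarrow> 'w \<Rightarrow> real ^ 'n) \<Rightarrow> (real ^ 'n \<Rightarrow> real) \<Rightarrow>
     (real ^ 'n \<Rightarrow> real) \<Rightarrow> bool" where
  "zero_energy_solution M X V \<phi> \<longleftrightarrow>
     \<phi> \<in> borel_measurable borel \<and>
     (\<exists>p\<ge>1. integrable lborel (\<lambda>x. \<bar>\<phi> x\<bar> powr p)) \<and>
     \<not> (AE x in lborel. \<phi> x = 0) \<and>
     (\<forall>t\<ge>0. AE x in lborel. feynman_kac M X V t \<phi> x = \<phi> x)"

end

theory Submission
  imports Defs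
begin

text \<open>
  A solution picks up mass at a distant point \<open>x\<close> from single jumps into the centre. Started near \<open>x\<close>,
  the process jumps into the ball of radius \<open>|x|/4\<close> around the origin during a short time \<open>h\<close> with
  probability of order \<open>h \<nu>(x)\<close>, and the Kato condition keeps the potential near the origin from
  mattering within such a short time. Iterating \<open>\<phi> = T\<^sub>h \<phi>\<close> along paths that stay near \<open>x\<close>, up to a
  total time of order \<open>1 / (V\<^sup>*(x) \<or> \<Psi>(1/|x|))\<close> during which neither killing by \<open>V\<close> nor leaving the
  neighbourhood of \<open>x\<close> is likely, gives
  \<open>\<phi>(x) \<ge> c \<nu>(x) / (V\<^sup>*(x) \<or> \<Psi>(1/|x|)) \<cdot> \<integral>\<^bsub>|y| < |x|/8\<^esub> \<phi>(y) dy\<close>.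
  Summed over annuli with ratio \<open>8\<close> this is a Gronwall inequality with delay for the integral on the
  right. Since \<open>\<nu>(y) / \<Psi>(1/|y|) \<le> C |y|\<^sup>-\<^sup>d\<close>, each annulus contributes a bounded amount to the exponent, so
  the delay only costs a constant factor.

  The estimates for the process avoid the Levy-Ito decomposition: they are read off from the
  characteristic function by testing with Gaussians, and the Markov property is only used on grids.
\<close>

section \<open>Gaussian kernels\<close>

text \<open>Only the rate of the short-time bounds has to be right. The thresholds
  \<open>h0\<close>, the mollification width and the constants in front of \<open>h\<^sup>2\<close>
  may depend badly on \<open>x\<close> and \<open>\<phi>\<close>, because the iteration may use
  arbitrarily many steps within a total time fixed beforehand. Crude second order expansions
  therefore suffice.

  Two obstacles shape the estimates. The Levy density has infinite mass at the origin; the weight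
  \<open>1 - cos (a \<bullet> z)\<close> makes it finite and turns it into a second difference of
  the exponent. Being at most \<open>2\<close>, the weight can be removed from an expectation again.
  The potential may be unbounded near the origin, exactly where the jump lands. A path gets there
  within \<open>h\<close> only by leaving a ball around its start, which has probability of order
  \<open>h\<close>, and the Kato condition supplies a further small factor. The loss is thus a small
  multiple of \<open>h\<close>, paid for by half of the jump rate. The radius
  \<open>norm x / 8\<close> leaves room for this: a start within it and a displacement of at most
  that size keep the path at distance \<open>3/4 * norm x\<close> from the origin, while the jump
  lands within \<open>norm x / 4\<close>.\<close>

lemma integrable_lborel_prod:
  fixes f :: "'a::euclidean_space \<Rightarrow> real \<Rightarrow> 'b::{real_normed_field, banach, second_countable_topology}"
  assumes f: "\<And>b. b \<in> Basis \<Longrightarrow> integrable lborel (f b)"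
  shows "integrable lborel (\<lambda>x::'a. \<Prod>b\<in>Basis. f b (x \<bullet> b))"
    and "(LINT x::'a|lborel. (\<Prod>b\<in>Basis. f b (x \<bullet> b))) = (\<Prod>b\<in>Basis. LINT t|lborel. f b t)"
proof -
  interpret P: product_sigma_finite "\<lambda>_::'a. lborel :: real measure" ..
  have [measurable]: "f b \<in> borel_measurable borel" if "b \<in> Basis" for b
    using f[OF that] by (simp add: borel_measurable_integrable flip: measurable_lborel1)
  have meas: "(\<lambda>x::'a. \<Prod>b\<in>Basis. f b (x \<bullet> b)) \<in> borel_measurable borel"
    by measurable
  have sum: "(\<lambda>g. \<Sum>b\<in>Basis. g b *\<^sub>R b) \<in> measurable (Pi\<^sub>M Basis (\<lambda>_. lborel)) (borel :: 'a measure)"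
    by measurable
  have eq: "(\<Prod>b\<in>Basis. f b ((\<Sum>c\<in>Basis. g c *\<^sub>R c) \<bullet> b)) = (\<Prod>b\<in>Basis. f b (g b))" for g :: "'a \<Rightarrow> real"
    by (intro prod.cong refl) (simp only: inner_sum_left_Basis)
  show "integrable lborel (\<lambda>x::'a. \<Prod>b\<in>Basis. f b (x \<bullet> b))"
    unfolding lborel_eq[where 'a='a] integrable_distr_eq[OF sum meas] eq
    by (intro P.product_integrable_prod f finite_Basis)
  show "(LINT x::'a|lborel. (\<Prod>b\<in>Basis. f b (x \<bullet> b))) = (\<Prod>b\<in>Basis. LINT t|lborel. f b t)"
    unfolding lborel_eq[where 'a='a] integral_distr[OF sum meas] eq
    by (intro P.product_integral_prod f finite_Basis)
qed

text \<open>The product form reduces moments and Fourier transform to the one-dimensional normal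
  density; \<open>s\<close> is the standard deviation per coordinate.\<close>

definition gauss :: "real \<Rightarrow> 'a::euclidean_space \<Rightarrow> real" where
  "gauss s x = (\<Prod>b\<in>Basis. normal_density 0 s (x \<bullet> b))"

lemma gauss_nonneg [simp]: "0 \<le> gauss s x"
  by (simp add: gauss_def prod_nonneg)

lemma gauss_minus [simp]: "gauss s (- x) = gauss s x"
  by (simp add: gauss_def normal_density_def)

lemma measurable_gauss [measurable]: "gauss s \<in> borel_measurable borel"
  unfolding gauss_def by measurable

lemma gauss_eq:
  fixes x :: "'a::euclidean_space"
  assumes "0 < s"
  shows "gauss s x = (1 / (sqrt (2 * pi) * s)) ^ DIM('a) * exp (- (norm x)\<^sup>2 / (2 * s\<^sup>2))"
proof -
  have "(norm x)\<^sup>2 = (\<Sum>b\<in>Basis. (x \<bullet> b)\<^sup>2)"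
    by (simp only: power2_norm_eq_inner) (subst euclidean_inner, simp add: power2_eq_square)
  then have *: "exp (- (norm x)\<^sup>2 / (2 * s\<^sup>2)) = (\<Prod>b\<in>Basis. exp (- (x \<bullet> b)\<^sup>2 / (2 * s\<^sup>2)))"
    by (simp add: exp_sum[symmetric] sum_divide_distrib sum_negf)
  have "normal_density 0 s t = 1 / (sqrt (2 * pi) * s) * exp (- t\<^sup>2 / (2 * s\<^sup>2))" for t
    using assms by (simp add: normal_density_def real_sqrt_mult)
  then have "gauss s x = (\<Prod>b\<in>Basis. 1 / (sqrt (2 * pi) * s) * exp (- (x \<bullet> b)\<^sup>2 / (2 * s\<^sup>2)))"
    unfolding gauss_def by (intro prod.cong refl)
  also have "\<dots> = (1 / (sqrt (2 * pi) * s)) ^ DIM('a) * (\<Prod>b\<in>Basis. exp (- (x \<bullet> b)\<^sup>2 / (2 * s\<^sup>2)))"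
    by (subst prod.distrib) simp
  finally show ?thesis
    unfolding * .
qed

lemma
  assumes "0 < s"
  shows integrable_gauss [simp]: "integrable lborel (gauss s :: 'a::euclidean_space \<Rightarrow> real)"
    and integral_gauss [simp]: "(LINT x::'a|lborel. gauss s x) = 1"
proof -
  have f: "integrable lborel (normal_density 0 s)"
    using assms by simp
  show "integrable lborel (gauss s :: 'a \<Rightarrow> real)"
    using integrable_lborel_prod(1)[where f="\<lambda>_. normal_density 0 s", OF f]
    unfolding gauss_def[abs_def] .
  have "(LINT x::'a|lborel. gauss s x) = (\<Prod>b\<in>(Basis::'a set). LINT t|lborel. normal_density 0 s t)"
    unfolding gauss_def by (rule integrable_lborel_prod(2)[OF f])
  then show "(LINT x::'a|lborel. gauss s x) = 1"
    using assms by simp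
qed

text \<open>Only the coordinate \<open>b\<close> carries the power; every other factor integrates to
  one.\<close>

lemma gauss_moment:
  fixes b :: "'a::euclidean_space"
  assumes "0 < s" "b \<in> Basis"
  shows "integrable lborel (\<lambda>x. gauss s x * (x \<bullet> b) ^ k)"
    and "(LINT x|lborel. gauss s x * (x \<bullet> b) ^ k) = (LINT t|lborel. normal_density 0 s t * t ^ k)"
proof -
  let ?f = "\<lambda>c t. normal_density 0 s t * (if c = b then t ^ k else 1)"
  have f: "integrable lborel (?f c)" for c
    using integrable_normal_moment[of s 0 k] assms by (cases "c = b") auto
  have eq: "(\<Prod>c\<in>Basis. ?f c (x \<bullet> c)) = gauss s x * (x \<bullet> b) ^ k" for x
    using assms by (simp add: gauss_def prod.distrib prod.delta)
  have "(\<Prod>c\<in>Basis. LINT t|lborel. ?f c t) =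
      (\<Prod>c\<in>Basis. if c = b then LINT t|lborel. normal_density 0 s t * t ^ k else 1)"
    using assms by (intro prod.cong refl) simp
  also have "\<dots> = (LINT t|lborel. normal_density 0 s t * t ^ k)"
    using assms by (simp add: prod.delta)
  finally show "(LINT x|lborel. gauss s x * (x \<bullet> b) ^ k) = (LINT t|lborel. normal_density 0 s t * t ^ k)"
    using integrable_lborel_prod(2)[where f="?f", OF f] by (simp only: eq)
  show "integrable lborel (\<lambda>x. gauss s x * (x \<bullet> b) ^ k)"
    using integrable_lborel_prod(1)[where f="?f", OF f] by (simp only: eq)
qed

text \<open>The characteristic function of the standard normal law, coordinate by coordinate. Read
  from right to left, it displays a Gaussian as a mixture of cosines with positive weights.\<close>

lemma gauss_fourier:
  fixes u :: "'a::euclidean_space"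
  shows "(LINT \<xi>|lborel. gauss 1 \<xi> * cos (\<xi> \<bullet> u)) = exp (- (norm u)\<^sup>2 / 2)"
proof -
  let ?f = "\<lambda>b t. complex_of_real (std_normal_density t) * iexp (t * (u \<bullet> b))"
  have int: "integrable lborel (?f b)" for b
    by (rule Bochner_Integration.integrable_bound[OF integrable_normal_density[of 1 0]]) (auto simp: norm_mult)
  have val: "(CLINT t|lborel. ?f b t) = exp (- (u \<bullet> b)\<^sup>2 / 2)" for b
  proof -
    have "(CLINT t|lborel. ?f b t) = char std_normal_distribution (u \<bullet> b)"
      unfolding char_def
      by (subst integral_density) (auto simp: scaleR_conv_of_real mult.commute)
    then show ?thesis
      by (simp add: char_std_normal_distribution)
  qed
  have eq: "(\<Prod>b\<in>Basis. ?f b (\<xi> \<bullet> b)) = complex_of_real (gauss 1 \<xi>) * iexp (\<xi> \<bullet> u)" for \<xi>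
    by (subst euclidean_inner[of \<xi> u])
       (simp add: prod.distrib gauss_def of_real_prod sum_distrib_left exp_sum)
  have "(CLINT \<xi>|lborel. complex_of_real (gauss 1 \<xi>) * iexp (\<xi> \<bullet> u)) =
      complex_of_real (\<Prod>b\<in>Basis. exp (- (u \<bullet> b)\<^sup>2 / 2))"
    using integrable_lborel_prod(2)[where f="?f", OF int] unfolding eq val of_real_prod .
  also have "(\<Prod>b\<in>Basis. exp (- (u \<bullet> b)\<^sup>2 / 2)) = exp (\<Sum>b\<in>Basis. - (u \<bullet> b)\<^sup>2 / 2)"
    by (simp add: exp_sum)
  also have "(\<Sum>b\<in>Basis. - (u \<bullet> b)\<^sup>2 / 2) = - (norm u)\<^sup>2 / 2"
    by (simp only: power2_norm_eq_inner) (subst euclidean_inner, simp add: power2_eq_square sum_negf sum_divide_distrib)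
  finally have *: "(CLINT \<xi>|lborel. complex_of_real (gauss 1 \<xi>) * iexp (\<xi> \<bullet> u)) = complex_of_real (exp (- (norm u)\<^sup>2 / 2))" .
  have ii: "integrable lborel (\<lambda>\<xi>. complex_of_real (gauss 1 \<xi>) * iexp (\<xi> \<bullet> u))"
    using integrable_lborel_prod(1)[where f="?f", OF int] unfolding eq .
  have "(LINT \<xi>|lborel. gauss 1 \<xi> * cos (\<xi> \<bullet> u)) =
      (LINT \<xi>|lborel. Re (complex_of_real (gauss 1 \<xi>) * iexp (\<xi> \<bullet> u)))"
    by (simp add: Re_exp)
  also have "\<dots> = Re (CLINT \<xi>|lborel. complex_of_real (gauss 1 \<xi>) * iexp (\<xi> \<bullet> u))"
    by (rule integral_Re[OF ii])
  finally show ?thesis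
    unfolding * by simp
qed

text \<open>Fourth moments are required because the second order remainder of the semigroup involves
  the square of an exponent of quadratic growth.\<close>

lemma integrable_gauss_fourth:
  "integrable lborel (\<lambda>x::'a::euclidean_space. gauss 1 x * (1 + (norm x)\<^sup>2)\<^sup>2)"
proof -
  let ?g = "\<lambda>x::'a. 2 * gauss 1 x + 2 * real DIM('a) * (\<Sum>b\<in>Basis. gauss 1 x * (x \<bullet> b) ^ 4)"
  have "integrable lborel ?g"
    by (intro Bochner_Integration.integrable_add integrable_mult_right Bochner_Integration.integrable_sum
        integrable_gauss gauss_moment) auto
  then show "integrable lborel (\<lambda>x::'a. gauss 1 x * (1 + (norm x)\<^sup>2)\<^sup>2)"
  proof (rule Bochner_Integration.integrable_bound, goal_cases)
    case 2
    show ?case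
    proof (rule AE_I2)
      fix x :: 'a
      define N where "N = (norm x)\<^sup>2"
      have N: "N = (\<Sum>b\<in>Basis. (x \<bullet> b)\<^sup>2)"
        unfolding N_def by (simp only: power2_norm_eq_inner) (subst euclidean_inner, simp add: power2_eq_square)
      have "N\<^sup>2 \<le> (\<Sum>b\<in>Basis. ((x \<bullet> b)\<^sup>2)\<^sup>2) * real DIM('a)"
        unfolding N by (rule sum_squared_le_sum_of_squares)
      moreover have "(1 + N)\<^sup>2 \<le> 2 + 2 * N\<^sup>2"
        using zero_le_power2[of "1 - N"] by (simp add: power2_eq_square algebra_simps)
      ultimately have "(1 + N)\<^sup>2 \<le> 2 + 2 * ((\<Sum>b\<in>Basis. (x \<bullet> b) ^ 4) * real DIM('a))"
        by simp
      from mult_left_mono[OF this gauss_nonneg[of 1 x]]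
      have "gauss 1 x * (1 + N)\<^sup>2 \<le> ?g x"
        by (simp add: algebra_simps sum_distrib_left sum_distrib_right)
      moreover have "0 \<le> ?g x"
        by (intro add_nonneg_nonneg mult_nonneg_nonneg sum_nonneg) auto
      ultimately show "norm (gauss 1 x * (1 + (norm x)\<^sup>2)\<^sup>2) \<le> norm (?g x)"
        unfolding N_def by simp
    qed
  qed measurable
qed

text \<open>Chebyshev's inequality, with variance \<open>s\<^sup>2\<close> in each
  coordinate.\<close>

lemma gauss_tail:
  assumes "0 < s" "0 < \<delta>"
  shows "(LINT x:{x::'a::euclidean_space. \<delta> \<le> norm x}|lborel. gauss s x) \<le> real DIM('a) * s\<^sup>2 / \<delta>\<^sup>2"
proof -
  let ?g = "\<lambda>x::'a. (\<Sum>b\<in>Basis. gauss s x * (x \<bullet> b)\<^sup>2) / \<delta>\<^sup>2"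
  have int: "integrable lborel (\<lambda>x::'a. gauss s x * (x \<bullet> b)\<^sup>2)" if "b \<in> Basis" for b
    using assms that by (intro gauss_moment)
  have mom: "(LINT x::'a|lborel. gauss s x * (x \<bullet> b)\<^sup>2) = s\<^sup>2" if "b \<in> Basis" for b
    using integral_normal_moment_even[of s 0 1] assms that by (subst gauss_moment) (auto simp: fact_numeral)
  have "(LINT x:{x::'a. \<delta> \<le> norm x}|lborel. gauss s x) \<le> (LINT x::'a|lborel. ?g x)"
    unfolding set_lebesgue_integral_def
  proof (rule integral_mono)
    show "integrable lborel (\<lambda>x::'a. indicator {x. \<delta> \<le> norm x} x *\<^sub>R gauss s x)"
      by (intro integrable_mult_indicator integrable_gauss assms) simp
    show "integrable lborel ?g"
      by (intro integrable_divide Bochner_Integration.integrable_sum int)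
    fix x :: 'a
    have N: "(norm x)\<^sup>2 = (\<Sum>b\<in>Basis. (x \<bullet> b)\<^sup>2)"
      by (simp only: power2_norm_eq_inner) (subst euclidean_inner, simp add: power2_eq_square)
    have g: "?g x = gauss s x * ((norm x)\<^sup>2 / \<delta>\<^sup>2)"
      by (simp add: N sum_distrib_left)
    have "1 \<le> (norm x)\<^sup>2 / \<delta>\<^sup>2" if "\<delta> \<le> norm x"
      using that assms by (simp add: power_mono)
    from mult_left_mono[OF this gauss_nonneg[of s x]]
    show "indicator {x. \<delta> \<le> norm x} x *\<^sub>R gauss s x \<le> ?g x"
      unfolding g by (auto simp: indicator_def)
  qed
  also have "\<dots> = real DIM('a) * s\<^sup>2 / \<delta>\<^sup>2"
    using int by (simp add: mom)
  finally show ?thesis .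
qed

section \<open>The exponent of the process\<close>

text \<open>Fubini in the form used throughout: the expectation of a mixture is the mixture of the
  expectations. The kernel is bounded and the weight integrable, so the product is
  integrable.\<close>

lemma (in finite_measure) integral_mixture:
  fixes F :: "'a \<Rightarrow> 'b \<Rightarrow> real" and m :: "'b \<Rightarrow> real"
  assumes P: "sigma_finite_measure P"
    and m: "integrable P m"
    and F: "(\<lambda>(w, p). F w p) \<in> borel_measurable (M \<Otimes>\<^sub>M P)"
    and c: "\<And>w p. \<bar>F w p\<bar> \<le> c"
  shows "(\<integral>w. (\<integral>p. m p * F w p \<partial>P) \<partial>M) = (\<integral>p. m p * (\<integral>w. F w p \<partial>M) \<partial>P)"
proof -
  interpret P: sigma_finite_measure P by fact
  interpret pair_sigma_finite M P ..
  have [measurable]: "m \<in> borel_measurable P"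
    using m by simp
  note F [measurable]
  have c0: "0 \<le> c"
    using c[of undefined undefined] by linarith
  have int: "integrable P (\<lambda>p. m p * F w p)" if "w \<in> space M" for w
  proof (rule Bochner_Integration.integrable_bound[OF integrable_mult_right[OF m, of c]])
    show "(\<lambda>p. m p * F w p) \<in> borel_measurable P"
      using measurable_Pair2[OF F that] by simp
    show "AE p in P. norm (m p * F w p) \<le> norm (c * m p)"
      using c c0 by (intro AE_I2) (simp add: abs_mult mult.commute[of c] mult_left_mono)
  qed
  have "integrable (M \<Otimes>\<^sub>M P) (\<lambda>(w, p). m p * F w p)"
  proof (rule Fubini_integrable)
    show "(\<lambda>(w, p). m p * F w p) \<in> borel_measurable (M \<Otimes>\<^sub>M P)"
      by measurable
    show "AE w in M. integrable P (\<lambda>p. case (w, p) of (w, p) \<Rightarrow> m p * F w p)"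
      using int by (intro AE_I2) simp
    show "integrable M (\<lambda>w. \<integral>p. norm (case (w, p) of (w, p) \<Rightarrow> m p * F w p) \<partial>P)"
    proof (rule integrable_const_bound[where B="c * (\<integral>p. \<bar>m p\<bar> \<partial>P)"])
      show "AE w in M. norm (\<integral>p. norm (case (w, p) of (w, p) \<Rightarrow> m p * F w p) \<partial>P) \<le> c * (\<integral>p. \<bar>m p\<bar> \<partial>P)"
      proof (rule AE_I2)
        fix w assume w: "w \<in> space M"
        have "(\<integral>p. \<bar>m p * F w p\<bar> \<partial>P) \<le> (\<integral>p. c * \<bar>m p\<bar> \<partial>P)"
          using int[OF w] m c
          by (intro integral_mono integrable_abs integrable_mult_right) (auto simp: abs_mult mult.commute[of c] mult_left_mono)
        then show "norm (\<integral>p. norm (case (w, p) of (w, p) \<Rightarrow> m p * F w p) \<partial>P) \<le> c * (\<integral>p. \<bar>m p\<bar> \<partial>P)"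
          by simp
      qed
      show "(\<lambda>w. \<integral>p. norm (case (w, p) of (w, p) \<Rightarrow> m p * F w p) \<partial>P) \<in> borel_measurable M"
        by measurable
    qed
  qed
  from Fubini_integral[OF this] show ?thesis
    by simp
qed

text \<open>Induction by the addition theorem. Through the half-angle formula this is the source of
  the quadratic scaling of the exponent.\<close>

lemma abs_sin_of_nat_mult_le: "\<bar>sin (real k * t)\<bar> \<le> real k * \<bar>sin t\<bar>"
proof (induction k)
  case (Suc k)
  have "\<bar>sin (real (Suc k) * t)\<bar> = \<bar>sin (real k * t) * cos t + cos (real k * t) * sin t\<bar>"
    by (simp add: algebra_simps sin_add)
  also have "\<dots> \<le> \<bar>sin (real k * t)\<bar> * 1 + 1 * \<bar>sin t\<bar>"
    unfolding mult.commute[of 1] abs_mult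
    by (intro order_trans[OF abs_triangle_ineq] add_mono) (simp_all add: abs_mult mult_left_le mult.commute[of "\<bar>cos _\<bar>"])
  also have "\<dots> \<le> real k * \<bar>sin t\<bar> + \<bar>sin t\<bar>"
    using Suc by simp
  finally show ?case
    by (simp add: algebra_simps)
qed simp

lemma one_minus_cos_eq: "1 - cos t = 2 * (sin (t / 2))\<^sup>2" for t :: real
  using cos_double_sin[of "t / 2"] by simp

lemma one_minus_cos_le_square: "1 - cos t \<le> t\<^sup>2 / 2" for t :: real
proof -
  have "(sin (t / 2))\<^sup>2 \<le> (t / 2)\<^sup>2"
    using abs_sin_x_le_abs_x[of "t / 2"] unfolding abs_le_square_iff .
  then show ?thesis
    unfolding one_minus_cos_eq by (simp add: power_divide)
qed

lemma one_minus_cos_of_nat_mult_le: "1 - cos (real k * t) \<le> (real k)\<^sup>2 * (1 - cos t)"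
proof -
  have "(sin (real k * (t / 2)))\<^sup>2 \<le> (real k * sin (t / 2))\<^sup>2"
    using abs_sin_of_nat_mult_le[of k "t / 2"] by (simp add: abs_le_square_iff[symmetric] abs_mult)
  then show ?thesis
    unfolding one_minus_cos_eq by (simp add: power_mult_distrib)
qed

text \<open>For \<open>norm z\<close> at least one the left side is at most \<open>2\<close>; for
  smaller \<open>z\<close> Cauchy-Schwarz and the quadratic bound on \<open>1 - cos\<close> apply.
  The right side is integrable against the Levy density.\<close>

lemma one_minus_cos_inner_le:
  "1 - cos (\<xi> \<bullet> z) \<le> 2 * (1 + (norm \<xi>)\<^sup>2) * min 1 ((norm z)\<^sup>2)"
proof (cases "1 \<le> norm z")
  case True
  then have "min 1 ((norm z)\<^sup>2) = 1"
    by (simp add: min_def)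
  then show ?thesis
    using cos_ge_minus_one[of "\<xi> \<bullet> z"] zero_le_power2[of "norm \<xi>"]
    unfolding \<open>min 1 ((norm z)\<^sup>2) = 1\<close> mult_1_right distrib_left by linarith
next
  case False
  then have "(norm z)\<^sup>2 \<le> 1"
    by (simp add: power_le_one)
  then have m: "min 1 ((norm z)\<^sup>2) = (norm z)\<^sup>2"
    by simp
  have "(\<xi> \<bullet> z)\<^sup>2 \<le> (norm \<xi> * norm z)\<^sup>2"
    using Cauchy_Schwarz_ineq2[of \<xi> z] by (simp add: abs_le_square_iff[symmetric] abs_mult)
  then have "1 - cos (\<xi> \<bullet> z) \<le> (norm \<xi>)\<^sup>2 * (norm z)\<^sup>2 / 2"
    using one_minus_cos_le_square[of "\<xi> \<bullet> z"] by (simp add: power_mult_distrib)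
  also have "\<dots> \<le> 2 * (1 + (norm \<xi>)\<^sup>2) * (norm z)\<^sup>2"
    by (simp add: algebra_simps)
  finally show ?thesis
    unfolding m .
qed

lemma exp_minus_bounds:
  fixes x :: real
  assumes "0 \<le> x"
  shows "1 - x \<le> exp (- x)" "exp (- x) \<le> 1 - x + x\<^sup>2 / 2"
proof -
  show "1 - x \<le> exp (- x)"
    using exp_ge_add_one_self[of "- x"] by simp
  \<comment> \<open>The derivative is \<open>x - 1 + exp (- x)\<close>, which is nonnegative, and
    the function vanishes at \<open>0\<close>.\<close>
  have "mono_on {0..} (\<lambda>x::real. 1 - x + x\<^sup>2 / 2 - exp (- x))"
    by (rule mono_onI, rule DERIV_nonneg_imp_nondecreasing[where f="\<lambda>x::real. 1 - x + x\<^sup>2 / 2 - exp (- x)"])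
       (auto intro!: exI[where x="x - 1 + exp (- x)" for x] derivative_eq_intros simp: exp_ge_add_one_self
          intro: order_trans[OF _ add_mono[OF order_refl exp_ge_add_one_self]])
  from mono_onD[OF this, of 0 x] assms show "exp (- x) \<le> 1 - x + x\<^sup>2 / 2"
    by simp
qed

text \<open>The Levy density made total by the value \<open>0\<close> at the origin, where
  measurability and sign of \<open>\<nu>\<close> are not assumed.\<close>

definition levy_density :: "(real ^ 'n \<Rightarrow> real) \<Rightarrow> real ^ 'n \<Rightarrow> real" where
  "levy_density \<nu> z = indicator (- {0}) z *\<^sub>R \<nu> z"

context symmetric_levy_process
begin

abbreviation "psi \<equiv> levy_exponent A \<nu>"
abbreviation "Psi \<equiv> exponent_sup A \<nu>"
abbreviation "nu \<equiv> levy_density \<nu>"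

lemma measurable_nu [measurable]: "nu \<in> borel_measurable borel"
  using nu_measurable unfolding levy_density_def[abs_def]
  by (subst (asm) borel_measurable_restrict_space_iff) auto

lemma nu_nonneg [simp]: "0 \<le> nu z"
  using nu_pos[of z] by (cases "z = 0") (auto simp: levy_density_def)

lemma nu_eq: "z \<noteq> 0 \<Longrightarrow> nu z = \<nu> z"
  by (simp add: levy_density_def)

lemma nu_minus [simp]: "nu (- z) = nu z"
  using nu_symmetric[of z] by (cases "z = 0") (auto simp: levy_density_def)

lemma integrable_min_nu: "integrable lborel (\<lambda>z. min 1 ((norm z)\<^sup>2) * nu z)"
proof (rule integrableI_nonneg)
  have "(\<integral>\<^sup>+z. ennreal (min 1 ((norm z)\<^sup>2) * nu z) \<partial>lborel) =
      (\<integral>\<^sup>+z\<in>- {0}. ennreal (min 1 ((norm z)\<^sup>2) * \<nu> z) \<partial>lborel)"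
    by (intro nn_integral_cong) (auto simp: levy_density_def indicator_def)
  then show "(\<integral>\<^sup>+z. ennreal (min 1 ((norm z)\<^sup>2) * nu z) \<partial>lborel) < \<infinity>"
    using nu_levy by simp
qed auto

lemma integrable_one_minus_cos_nu: "integrable lborel (\<lambda>z. (1 - cos (\<xi> \<bullet> z)) * nu z)"
proof (rule Bochner_Integration.integrable_bound)
  show "integrable lborel (\<lambda>z. 2 * (1 + (norm \<xi>)\<^sup>2) * (min 1 ((norm z)\<^sup>2) * nu z))"
    by (intro integrable_mult_right integrable_min_nu)
  show "AE z in lborel. norm ((1 - cos (\<xi> \<bullet> z)) * nu z) \<le> norm (2 * (1 + (norm \<xi>)\<^sup>2) * (min 1 ((norm z)\<^sup>2) * nu z))"
  proof (rule AE_I2)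
    fix z
    have "(1 - cos (\<xi> \<bullet> z)) * nu z \<le> 2 * (1 + (norm \<xi>)\<^sup>2) * min 1 ((norm z)\<^sup>2) * nu z"
      by (intro mult_right_mono one_minus_cos_inner_le) simp
    then show "norm ((1 - cos (\<xi> \<bullet> z)) * nu z) \<le> norm (2 * (1 + (norm \<xi>)\<^sup>2) * (min 1 ((norm z)\<^sup>2) * nu z))"
      by (simp add: abs_mult)
  qed
qed measurable

lemma psi_eq: "psi \<xi> = (A *v \<xi>) \<bullet> \<xi> + (LINT z|lborel. (1 - cos (\<xi> \<bullet> z)) * nu z)"
  by (simp add: levy_exponent_def set_lebesgue_integral_def levy_density_def mult.left_commute)

lemma psi_nonneg [simp]: "0 \<le> psi \<xi>"
  unfolding psi_eq by (intro add_nonneg_nonneg A_nonneg integral_nonneg_AE AE_I2) simp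

lemma measurable_psi [measurable]: "psi \<in> borel_measurable borel"
proof -
  have [measurable]: "(\<lambda>\<xi>. (A *v \<xi>) \<bullet> \<xi>) \<in> borel_measurable borel"
    by (intro borel_measurable_continuous_onI continuous_intros linear_continuous_on
        matrix_vector_mul_bounded_linear)
  show ?thesis
    unfolding psi_eq[abs_def] by measurable
qed

lemma psi_bound: "\<exists>K\<ge>0. \<forall>\<xi>. psi \<xi> \<le> K * (1 + (norm \<xi>)\<^sup>2)"
proof (intro exI conjI allI)
  let ?a = "onorm ((*v) A)" and ?n = "LINT z|lborel. min 1 ((norm z)\<^sup>2) * nu z"
  have a: "0 \<le> ?a"
    by (simp add: onorm_pos_le matrix_vector_mul_bounded_linear)
  have n: "0 \<le> ?n"
    by (intro integral_nonneg_AE AE_I2) simp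
  show "0 \<le> ?a + 2 * ?n"
    using a n by simp
  fix \<xi>
  have "(A *v \<xi>) \<bullet> \<xi> \<le> norm (A *v \<xi>) * norm \<xi>"
    by (rule norm_cauchy_schwarz)
  also have "\<dots> \<le> ?a * norm \<xi> * norm \<xi>"
    by (intro mult_right_mono onorm matrix_vector_mul_bounded_linear) simp
  also have "\<dots> \<le> ?a * (1 + (norm \<xi>)\<^sup>2)"
    using a by (simp add: power2_eq_square algebra_simps)
  finally have 1: "(A *v \<xi>) \<bullet> \<xi> \<le> ?a * (1 + (norm \<xi>)\<^sup>2)" .
  have "(LINT z|lborel. (1 - cos (\<xi> \<bullet> z)) * nu z) \<le>
      (LINT z|lborel. 2 * (1 + (norm \<xi>)\<^sup>2) * (min 1 ((norm z)\<^sup>2) * nu z))"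
  proof (intro integral_mono integrable_one_minus_cos_nu integrable_mult_right integrable_min_nu)
    fix z
    have "(1 - cos (\<xi> \<bullet> z)) * nu z \<le> 2 * (1 + (norm \<xi>)\<^sup>2) * min 1 ((norm z)\<^sup>2) * nu z"
      by (intro mult_right_mono one_minus_cos_inner_le) simp
    then show "(1 - cos (\<xi> \<bullet> z)) * nu z \<le> 2 * (1 + (norm \<xi>)\<^sup>2) * (min 1 ((norm z)\<^sup>2) * nu z)"
      by simp
  qed
  then have 2: "(LINT z|lborel. (1 - cos (\<xi> \<bullet> z)) * nu z) \<le> 2 * ?n * (1 + (norm \<xi>)\<^sup>2)"
    unfolding integral_mult_right_zero by (simp only: mult_ac)
  show "psi \<xi> \<le> (?a + 2 * ?n) * (1 + (norm \<xi>)\<^sup>2)"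
    using 1 2 unfolding psi_eq distrib_right by linarith
qed

text \<open>The quadratic form scales exactly by the square of \<open>k\<close>; for the jump part
  the pointwise bound on \<open>1 - cos\<close> is integrated.\<close>

lemma psi_of_nat_scale: "psi (real k *\<^sub>R \<xi>) \<le> (real k)\<^sup>2 * psi \<xi>"
proof -
  have "(LINT z|lborel. (1 - cos ((real k *\<^sub>R \<xi>) \<bullet> z)) * nu z) \<le>
      (LINT z|lborel. (real k)\<^sup>2 * ((1 - cos (\<xi> \<bullet> z)) * nu z))"
    using mult_right_mono[OF one_minus_cos_of_nat_mult_le nu_nonneg]
    by (intro integral_mono integrable_one_minus_cos_nu integrable_mult_right) (simp add: mult.assoc)
  moreover have "(A *v (real k *\<^sub>R \<xi>)) \<bullet> (real k *\<^sub>R \<xi>) = (real k)\<^sup>2 * ((A *v \<xi>) \<bullet> \<xi>)"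
    by (simp add: matrix_vector_mult_scaleR power2_eq_square)
  ultimately show ?thesis
    unfolding psi_eq distrib_left integral_mult_right_zero by linarith
qed

lemma bdd_above_psi: "bdd_above (psi ` cball 0 r)"
proof -
  obtain K where K: "0 \<le> K" "\<And>\<xi>. psi \<xi> \<le> K * (1 + (norm \<xi>)\<^sup>2)"
    using psi_bound by blast
  have "psi \<xi> \<le> K * (1 + r\<^sup>2)" if "norm \<xi> \<le> r" for \<xi>
    using that K(1) by (intro order_trans[OF K(2)] mult_left_mono) (auto simp: power_mono)
  then show ?thesis
    by (intro bdd_aboveI2[where M="K * (1 + r\<^sup>2)"]) auto
qed

lemma psi_le_Psi: "norm \<xi> \<le> r \<Longrightarrow> psi \<xi> \<le> Psi r"
  unfolding exponent_sup_def by (intro cSUP_upper bdd_above_psi) simp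

lemma Psi_mono: "0 \<le> r \<Longrightarrow> r \<le> s \<Longrightarrow> Psi r \<le> Psi s"
  unfolding exponent_sup_def by (intro cSUP_subset_mono bdd_above_psi) auto

lemma Psi_nonneg: "0 \<le> r \<Longrightarrow> 0 \<le> Psi r"
  by (rule order_trans[OF psi_nonneg psi_le_Psi[of 0]]) simp

text \<open>Used to replace \<open>Psi (8 / norm x)\<close> by \<open>64 * Psi (1 / norm x)\<close>,
  so that all scales comparable to \<open>norm x\<close> share one rate.\<close>

lemma Psi_of_nat_scale:
  assumes "0 \<le> r"
  shows "Psi (real k * r) \<le> (real k)\<^sup>2 * Psi r"
proof (cases "k = 0")
  case True
  have "Psi 0 = 0"
    by (simp add: exponent_sup_def psi_eq)
  then show ?thesis
    using True by simp
next
  case False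
  have "psi \<xi> \<le> (real k)\<^sup>2 * Psi r" if "norm \<xi> \<le> real k * r" for \<xi>
  proof -
    have "psi \<xi> \<le> (real k)\<^sup>2 * psi ((1 / real k) *\<^sub>R \<xi>)"
      using psi_of_nat_scale[of k "(1 / real k) *\<^sub>R \<xi>"] False by simp
    also have "psi ((1 / real k) *\<^sub>R \<xi>) \<le> Psi r"
      using that False by (intro psi_le_Psi) (simp add: field_simps)
    finally show ?thesis
      by (simp add: mult_left_mono)
  qed
  then show ?thesis
    unfolding exponent_sup_def[of A \<nu> "real k * r"] using assms by (intro cSUP_least) (auto simp: not_less)
qed

text \<open>Rounding \<open>norm \<xi>\<close> up to an integer \<open>k\<close> makes the integer
  scaling available, and the square of \<open>norm \<xi> + 1\<close> is at most
  \<open>2 * (1 + (norm \<xi>)\<^sup>2)\<close>.\<close>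

lemma psi_scaled_le:
  assumes "0 < L"
  shows "psi (\<xi> /\<^sub>R L) \<le> 2 * (1 + (norm \<xi>)\<^sup>2) * Psi (1 / L)"
proof -
  define k where "k = nat \<lceil>norm \<xi>\<rceil>"
  have k: "norm \<xi> \<le> real k" "real k \<le> norm \<xi> + 1"
    unfolding k_def using norm_ge_zero[of \<xi>] by linarith+
  have "psi (\<xi> /\<^sub>R L) \<le> Psi (real k * (1 / L))"
    using k assms by (intro psi_le_Psi) (simp add: field_simps)
  also have "\<dots> \<le> (real k)\<^sup>2 * Psi (1 / L)"
    using assms by (intro Psi_of_nat_scale) simp
  also have "(real k)\<^sup>2 \<le> 2 * (1 + (norm \<xi>)\<^sup>2)"
  proof -
    have "(real k)\<^sup>2 \<le> (norm \<xi> + 1)\<^sup>2"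
      using k by (intro power_mono) auto
    also have "\<dots> \<le> 2 * (1 + (norm \<xi>)\<^sup>2)"
      using zero_le_power2[of "norm \<xi> - 1"] by (simp add: power2_eq_square algebra_simps)
    finally show ?thesis .
  qed
  finally show ?thesis
    using assms by (simp add: mult_right_mono Psi_nonneg)
qed

text \<open>The characteristic function is real, so the sine part has expectation zero and only
  \<open>cos b\<close> survives from the phase.\<close>

lemma expectation_cos:
  assumes "0 \<le> t"
  shows "expectation (\<lambda>w. cos (\<xi> \<bullet> X t w + b)) = cos b * exp (- t * psi \<xi>)"
proof -
  note [measurable] = measurable_X[OF assms]
  have i: "integrable M (\<lambda>w. exp (\<i> * complex_of_real (\<xi> \<bullet> X t w)))"
    by (rule integrable_const_bound[where B=1]) auto
  have "expectation (\<lambda>w. Re (exp (\<i> * complex_of_real (\<xi> \<bullet> X t w)))) = exp (- t * psi \<xi>)"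
    using characteristic_function[OF assms, of \<xi>] integral_Re[OF i] by simp
  then have c: "expectation (\<lambda>w. cos (\<xi> \<bullet> X t w)) = exp (- t * psi \<xi>)"
    by (simp add: Re_exp)
  have "expectation (\<lambda>w. Im (exp (\<i> * complex_of_real (\<xi> \<bullet> X t w)))) = 0"
    using characteristic_function[OF assms, of \<xi>] integral_Im[OF i] by simp
  then have s: "expectation (\<lambda>w. sin (\<xi> \<bullet> X t w)) = 0"
    by (simp add: Im_exp)
  have "expectation (\<lambda>w. cos (\<xi> \<bullet> X t w + b)) =
      expectation (\<lambda>w. cos (\<xi> \<bullet> X t w) * cos b - sin (\<xi> \<bullet> X t w) * sin b)"
    by (simp add: cos_add)
  also have "\<dots> = expectation (\<lambda>w. cos (\<xi> \<bullet> X t w) * cos b) - expectation (\<lambda>w. sin (\<xi> \<bullet> X t w) * sin b)"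
    by (intro Bochner_Integration.integral_diff integrable_mult_left integrable_const_bound[where B=1] AE_I2) auto
  finally show ?thesis
    using c s by simp
qed

text \<open>Gaussians are mixtures of cosines, on which the semigroup acts diagonally.\<close>

definition gauss_const :: real where
  "gauss_const = (LINT \<xi>::real^'n|lborel. gauss 1 \<xi> * (2 * (1 + (norm \<xi>)\<^sup>2)))"

lemma integrable_gauss_const: "integrable lborel (\<lambda>\<xi>::real^'n. gauss 1 \<xi> * (2 * (1 + (norm \<xi>)\<^sup>2)))"
proof (rule Bochner_Integration.integrable_bound[OF integrable_mult_right[OF integrable_gauss_fourth, of 2]])
  show "AE \<xi>::real^'n in lborel. norm (gauss 1 \<xi> * (2 * (1 + (norm \<xi>)\<^sup>2))) \<le> norm (2 * (gauss 1 \<xi> * (1 + (norm \<xi>)\<^sup>2)\<^sup>2))"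
  proof (rule AE_I2)
    fix \<xi> :: "real^'n"
    have "1 + (norm \<xi>)\<^sup>2 \<le> (1 + (norm \<xi>)\<^sup>2)\<^sup>2"
      by (rule self_le_power) auto
    from mult_left_mono[OF this, of "2 * gauss 1 \<xi>"]
    show "norm (gauss 1 \<xi> * (2 * (1 + (norm \<xi>)\<^sup>2))) \<le> norm (2 * (gauss 1 \<xi> * (1 + (norm \<xi>)\<^sup>2)\<^sup>2))"
      by (simp add: abs_mult mult.assoc mult.left_commute[of 2])
  qed
qed measurable

lemma gauss_const_nonneg: "0 \<le> gauss_const"
  unfolding gauss_const_def by (intro integral_nonneg_AE AE_I2) simp

text \<open>At frequency \<open>\<xi>\<close> at most
  \<open>1 - exp (- h * psi (\<xi> /\<^sub>R L))\<close> is lost, hence at most \<open>h\<close>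
  times the exponent; \<open>psi_scaled_le\<close> turns this into \<open>Psi (1 / L)\<close> times
  a Gaussian integrable weight. The loss rate does not depend on \<open>y\<close>.\<close>

lemma expectation_gaussian_ge:
  assumes "0 < L" "0 \<le> h"
  shows "exp (- (norm y)\<^sup>2 / (2 * L\<^sup>2)) - h * (gauss_const * Psi (1 / L))
    \<le> expectation (\<lambda>w. exp (- (norm (y + X h w))\<^sup>2 / (2 * L\<^sup>2)))"
proof -
  note [measurable] = measurable_X[OF assms(2)]
  have e: "exp (- (norm u)\<^sup>2 / (2 * L\<^sup>2)) = (LINT \<xi>|lborel. gauss 1 \<xi> * cos (\<xi> \<bullet> (u /\<^sub>R L)))" for u :: "real^'n"
    unfolding gauss_fourier using assms by (simp add: power_mult_distrib divide_simps)
  have ic: "integrable lborel (\<lambda>\<xi>. gauss 1 \<xi> * cos (\<xi> \<bullet> (y /\<^sub>R L)))"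
    by (rule Bochner_Integration.integrable_bound[OF integrable_gauss[OF zero_less_one]])
       (auto simp: abs_mult mult_left_le)
  have "expectation (\<lambda>w. exp (- (norm (y + X h w))\<^sup>2 / (2 * L\<^sup>2))) =
      (LINT \<xi>|lborel. gauss 1 \<xi> * expectation (\<lambda>w. cos (\<xi> \<bullet> ((y + X h w) /\<^sub>R L))))"
    unfolding e by (intro integral_mixture[where c=1] lborel.sigma_finite_measure_axioms) simp_all
  also have "\<dots> = (LINT \<xi>|lborel. gauss 1 \<xi> * (cos (\<xi> \<bullet> (y /\<^sub>R L)) * exp (- h * psi (\<xi> /\<^sub>R L))))"
  proof (intro Bochner_Integration.integral_cong refl arg_cong2[where f="(*)"])
    fix \<xi> :: "real^'n"
    have "\<xi> \<bullet> ((y + X h w) /\<^sub>R L) = (\<xi> /\<^sub>R L) \<bullet> X h w + \<xi> \<bullet> (y /\<^sub>R L)" for w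
      by (simp add: inner_add_right algebra_simps)
    then show "expectation (\<lambda>w. cos (\<xi> \<bullet> ((y + X h w) /\<^sub>R L))) = cos (\<xi> \<bullet> (y /\<^sub>R L)) * exp (- h * psi (\<xi> /\<^sub>R L))"
      by (simp only: expectation_cos[OF assms(2)])
  qed
  also have "\<dots> \<ge> (LINT \<xi>|lborel. gauss 1 \<xi> * cos (\<xi> \<bullet> (y /\<^sub>R L)) -
      h * Psi (1 / L) * (gauss 1 \<xi> * (2 * (1 + (norm \<xi>)\<^sup>2))))"
  proof (rule integral_mono)
    have i: "integrable lborel (\<lambda>\<xi>. gauss 1 \<xi> * F \<xi>)"
      if [measurable]: "F \<in> borel_measurable borel" and F: "\<And>\<xi>. \<bar>F \<xi>\<bar> \<le> 1" for F :: "real^'n \<Rightarrow> real"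
      by (rule Bochner_Integration.integrable_bound[OF integrable_gauss[OF zero_less_one]])
         (use F in \<open>auto simp: abs_mult intro!: mult_left_le\<close>)
    show "integrable lborel (\<lambda>\<xi>. gauss 1 \<xi> * cos (\<xi> \<bullet> (y /\<^sub>R L)) -
      h * Psi (1 / L) * (gauss 1 \<xi> * (2 * (1 + (norm \<xi>)\<^sup>2))))"
      by (intro Bochner_Integration.integrable_diff i integrable_mult_right integrable_gauss_const) auto
    have "\<bar>cos (\<xi> \<bullet> (y /\<^sub>R L)) * exp (- h * psi (\<xi> /\<^sub>R L))\<bar> \<le> 1 * 1" for \<xi>
      unfolding abs_mult using assms by (intro mult_mono) auto
    then show "integrable lborel (\<lambda>\<xi>. gauss 1 \<xi> * (cos (\<xi> \<bullet> (y /\<^sub>R L)) * exp (- h * psi (\<xi> /\<^sub>R L))))"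
      by (intro i) auto
    fix \<xi> :: "real^'n"
    let ?c = "cos (\<xi> \<bullet> (y /\<^sub>R L))" and ?x = "h * psi (\<xi> /\<^sub>R L)"
    have x: "0 \<le> ?x"
      using assms by simp
    have "?c * (1 - exp (- ?x)) \<le> 1 * (1 - exp (- ?x))"
      using x by (intro mult_right_mono) auto
    also have "\<dots> \<le> ?x"
      using exp_minus_bounds(1)[OF x] by simp
    also have "?x \<le> h * (2 * (1 + (norm \<xi>)\<^sup>2) * Psi (1 / L))"
      using assms by (intro mult_left_mono psi_scaled_le)
    finally have "?c - h * (2 * (1 + (norm \<xi>)\<^sup>2) * Psi (1 / L)) \<le> ?c * exp (- h * psi (\<xi> /\<^sub>R L))"
      by (simp add: algebra_simps)
    from mult_left_mono[OF this gauss_nonneg[of 1 \<xi>]]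
    show "gauss 1 \<xi> * cos (\<xi> \<bullet> (y /\<^sub>R L)) - h * Psi (1 / L) * (gauss 1 \<xi> * (2 * (1 + (norm \<xi>)\<^sup>2)))
        \<le> gauss 1 \<xi> * (cos (\<xi> \<bullet> (y /\<^sub>R L)) * exp (- h * psi (\<xi> /\<^sub>R L)))"
      by (simp add: algebra_simps)
  qed
  also have "(LINT \<xi>|lborel. gauss 1 \<xi> * cos (\<xi> \<bullet> (y /\<^sub>R L)) -
      h * Psi (1 / L) * (gauss 1 \<xi> * (2 * (1 + (norm \<xi>)\<^sup>2)))) =
      exp (- (norm y)\<^sup>2 / (2 * L\<^sup>2)) - h * Psi (1 / L) * gauss_const"
    unfolding e gauss_const_def
    by (subst Bochner_Integration.integral_diff[OF ic integrable_mult_right[OF integrable_gauss_const]])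
       (simp only: integral_mult_right_zero)
  finally show ?thesis
    by (simp add: mult_ac)
qed

end

section \<open>The generator on mixtures of cosines\<close>

lemma lborel_distr_reflect: "distr lborel borel (\<lambda>z::'a::euclidean_space. u - z) = lborel"
proof -
  have "lborel = density (distr lborel borel (\<lambda>z::'a. u + (-1) *\<^sub>R z)) (\<lambda>_. ennreal (\<bar>-1\<bar> ^ DIM('a)))"
    by (rule lborel_affine) simp
  then show ?thesis
    by (simp add: density_1)
qed

lemma
  fixes g :: "'a::euclidean_space \<Rightarrow> real"
  assumes [measurable]: "g \<in> borel_measurable borel"
  shows lborel_integral_reflect: "(LINT z|lborel. g (u - z)) = (LINT z|lborel. g z)"
    and lborel_integrable_reflect: "integrable lborel (\<lambda>z. g (u - z)) \<longleftrightarrow> integrable lborel g"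
proof -
  have "(LINT z|distr lborel borel (\<lambda>z. u - z). g z) = (LINT z|lborel. g (u - z))"
    by (rule integral_distr) auto
  then show "(LINT z|lborel. g (u - z)) = (LINT z|lborel. g z)"
    by (simp add: lborel_distr_reflect)
  have "integrable (distr lborel borel (\<lambda>z. u - z)) g \<longleftrightarrow> integrable lborel (\<lambda>z. g (u - z))"
    by (rule integrable_distr_eq) auto
  then show "integrable lborel (\<lambda>z. g (u - z)) \<longleftrightarrow> integrable lborel g"
    by (simp add: lborel_distr_reflect)
qed

context symmetric_levy_process
begin

lemma integrable_weighted_nu:
  assumes [measurable]: "F \<in> borel_measurable borel" and c: "\<And>z. \<bar>F z\<bar> \<le> c"
  shows "integrable lborel (\<lambda>z. (1 - cos (a \<bullet> z)) * F z * nu z)"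
proof (rule Bochner_Integration.integrable_bound[OF integrable_mult_right[OF integrable_one_minus_cos_nu[of a], of c]])
  show "AE z in lborel. norm ((1 - cos (a \<bullet> z)) * F z * nu z) \<le> norm (c * ((1 - cos (a \<bullet> z)) * nu z))"
  proof (rule AE_I2)
    fix z
    have "\<bar>F z\<bar> * ((1 - cos (a \<bullet> z)) * nu z) \<le> c * ((1 - cos (a \<bullet> z)) * nu z)"
      by (intro mult_right_mono c) simp
    moreover have "0 \<le> c"
      using c[of 0] by linarith
    ultimately show "norm ((1 - cos (a \<bullet> z)) * F z * nu z) \<le> norm (c * ((1 - cos (a \<bullet> z)) * nu z))"
      by (simp add: abs_mult mult_ac)
  qed
qed measurable

text \<open>The weight \<open>1 - cos (a \<bullet> z)\<close> vanishes at the origin, so the singularity of \<open>\<nu>\<close> there does not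
  contribute to the second difference of the exponent; the Gaussian part contributes a constant.\<close>

lemma psi_second_difference:
  "psi (\<xi> + a) / 2 + psi (\<xi> - a) / 2 - psi \<xi> =
    (A *v a) \<bullet> a + (LINT z|lborel. (1 - cos (a \<bullet> z)) * cos (\<xi> \<bullet> z) * nu z)"
proof -
  have Q: "((A *v (\<xi> + a)) \<bullet> (\<xi> + a)) / 2 + ((A *v (\<xi> - a)) \<bullet> (\<xi> - a)) / 2 - (A *v \<xi>) \<bullet> \<xi> = (A *v a) \<bullet> a"
    by (simp add: linear_add[OF matrix_vector_mul_linear] linear_diff[OF matrix_vector_mul_linear]
        inner_add_left inner_add_right inner_diff_left inner_diff_right field_simps)
  have "(LINT z|lborel. (1 - cos ((\<xi> + a) \<bullet> z)) * nu z) / 2 + (LINT z|lborel. (1 - cos ((\<xi> - a) \<bullet> z)) * nu z) / 2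
      - (LINT z|lborel. (1 - cos (\<xi> \<bullet> z)) * nu z) =
      (LINT z|lborel. (1 - cos ((\<xi> + a) \<bullet> z)) * nu z / 2 + (1 - cos ((\<xi> - a) \<bullet> z)) * nu z / 2
        - (1 - cos (\<xi> \<bullet> z)) * nu z)"
    by (simp add: integrable_one_minus_cos_nu del: times_divide_eq_left)
  also have "\<dots> = (LINT z|lborel. (1 - cos (a \<bullet> z)) * cos (\<xi> \<bullet> z) * nu z)"
    by (intro Bochner_Integration.integral_cong refl)
       (simp add: inner_add_left inner_diff_left cos_add cos_diff field_simps)
  finally have I: "(LINT z|lborel. (1 - cos ((\<xi> + a) \<bullet> z)) * nu z) / 2 + (LINT z|lborel. (1 - cos ((\<xi> - a) \<bullet> z)) * nu z) / 2
      - (LINT z|lborel. (1 - cos (\<xi> \<bullet> z)) * nu z) = (LINT z|lborel. (1 - cos (a \<bullet> z)) * cos (\<xi> \<bullet> z) * nu z)" .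
  have "(q1 + i1) / 2 + (q2 + i2) / 2 - (q3 + i3) = q + i"
    if "q1 / 2 + q2 / 2 - q3 = q" "i1 / 2 + i2 / 2 - i3 = i" for q1 q2 q3 q i1 i2 i3 i :: real
    using that by (simp add: field_simps)
  from this[OF Q I] show ?thesis
    unfolding psi_eq .
qed

text \<open>The Levy density is even, so the sine part cancels under reflection.\<close>

lemma weighted_nu_cos:
  "(LINT z|lborel. (1 - cos (a \<bullet> z)) * cos (\<xi> \<bullet> z + b) * nu z) =
    cos b * (LINT z|lborel. (1 - cos (a \<bullet> z)) * cos (\<xi> \<bullet> z) * nu z)"
proof -
  let ?S = "\<lambda>z. (1 - cos (a \<bullet> z)) * sin (\<xi> \<bullet> z) * nu z"
  have "(LINT z|lborel. ?S (- z)) = (LINT z|lborel. ?S z)"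
    using lborel_integral_reflect[of ?S 0] by simp
  moreover have "(LINT z|lborel. ?S (- z)) = - (LINT z|lborel. ?S z)"
    by (subst Bochner_Integration.integral_minus[symmetric]) (intro Bochner_Integration.integral_cong refl, simp)
  ultimately have S: "(LINT z|lborel. ?S z) = 0"
    by simp
  have "(LINT z|lborel. (1 - cos (a \<bullet> z)) * cos (\<xi> \<bullet> z + b) * nu z) =
      (LINT z|lborel. cos b * ((1 - cos (a \<bullet> z)) * cos (\<xi> \<bullet> z) * nu z) - sin b * ?S z)"
    by (intro Bochner_Integration.integral_cong refl) (simp add: cos_add algebra_simps)
  also have "\<dots> = cos b * (LINT z|lborel. (1 - cos (a \<bullet> z)) * cos (\<xi> \<bullet> z) * nu z) - sin b * (LINT z|lborel. ?S z)"
    by (subst Bochner_Integration.integral_diff)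
       (auto intro!: integrable_mult_right integrable_weighted_nu[where c=1])
  finally show ?thesis
    using S by simp
qed

text \<open>The product of two cosines is a combination of cosines at the frequencies
  \<open>\<xi>\<close>, \<open>\<xi> + a\<close> and \<open>\<xi> - a\<close>.\<close>

lemma expectation_weighted_cos:
  assumes h: "0 \<le> h"
  shows "expectation (\<lambda>w. (1 - cos (a \<bullet> X h w)) * cos (\<xi> \<bullet> X h w + b)) =
    cos b * (exp (- h * psi \<xi>) - exp (- h * psi (\<xi> + a)) / 2 - exp (- h * psi (\<xi> - a)) / 2)"
proof -
  note [measurable] = measurable_X[OF h]
  have i: "integrable M (\<lambda>w. cos (\<eta> \<bullet> X h w + b))" for \<eta>
    by (rule integrable_const_bound[where B=1]) auto
  have "expectation (\<lambda>w. (1 - cos (a \<bullet> X h w)) * cos (\<xi> \<bullet> X h w + b)) =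
      expectation (\<lambda>w. cos (\<xi> \<bullet> X h w + b) - cos ((\<xi> + a) \<bullet> X h w + b) / 2 - cos ((\<xi> - a) \<bullet> X h w + b) / 2)"
    by (intro Bochner_Integration.integral_cong refl)
       (simp add: inner_add_left inner_diff_left cos_add cos_diff sin_add sin_diff field_simps)
  also have "\<dots> = expectation (\<lambda>w. cos (\<xi> \<bullet> X h w + b)) - expectation (\<lambda>w. cos ((\<xi> + a) \<bullet> X h w + b)) / 2
      - expectation (\<lambda>w. cos ((\<xi> - a) \<bullet> X h w + b)) / 2"
    by (simp add: i)
  finally have e: "expectation (\<lambda>w. (1 - cos (a \<bullet> X h w)) * cos (\<xi> \<bullet> X h w + b)) = \<dots>" .
  show ?thesis
    unfolding e expectation_cos[OF h] by (simp add: algebra_simps)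
qed

text \<open>Short-time expansion at each frequency: the first order terms of the three exponentials
  combine to the second difference of the exponent, that is, the Gaussian constant plus the weighted
  jump integral. Remainders are quadratic in \<open>h\<close> with a constant independent of
  \<open>y\<close>.\<close>

lemma mixture_generator_ge:
  fixes P :: "'b measure" and freq :: "'b \<Rightarrow> real^'n"
  assumes P: "sigma_finite_measure P"
    and m: "\<And>p. 0 \<le> m p" "integrable P (\<lambda>p. m p * (1 + (norm (freq p))\<^sup>2)\<^sup>2)"
    and [measurable]: "m \<in> borel_measurable P" "freq \<in> borel_measurable P" "phase \<in> borel_measurable P"
    and f_eq: "\<And>u. f u = (LINT p|P. m p * cos (freq p \<bullet> u + phase p))"
    and f_nonneg: "\<And>u. 0 \<le> f u"
  shows "\<exists>C\<ge>0. \<forall>h\<ge>0. \<forall>y. h * (LINT z|lborel. (1 - cos (a \<bullet> z)) * f (y + z) * nu z) - h\<^sup>2 * C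
    \<le> expectation (\<lambda>w. (1 - cos (a \<bullet> X h w)) * f (y + X h w))"
proof -
  define J where "J \<xi> = (LINT z|lborel. (1 - cos (a \<bullet> z)) * cos (\<xi> \<bullet> z) * nu z)" for \<xi>
  define Q where "Q = (A *v a) \<bullet> a"
  have Q: "0 \<le> Q"
    unfolding Q_def by (rule A_nonneg)
  have J_eq: "J \<xi> = psi (\<xi> + a) / 2 + psi (\<xi> - a) / 2 - psi \<xi> - Q" for \<xi>
    unfolding J_def Q_def psi_second_difference by simp
  then have [measurable]: "J \<in> borel_measurable borel"
    unfolding J_eq[abs_def] by measurable
  define J0 where "J0 = (LINT z|lborel. (1 - cos (a \<bullet> z)) * nu z)"
  have J0: "\<bar>J \<xi>\<bar> \<le> J0" for \<xi>
  proof -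
    have "\<bar>J \<xi>\<bar> \<le> (LINT z|lborel. \<bar>(1 - cos (a \<bullet> z)) * cos (\<xi> \<bullet> z) * nu z\<bar>)"
      unfolding J_def by (rule integral_abs_bound)
    also have "\<dots> \<le> J0"
      unfolding J0_def
    proof (intro integral_mono integrable_abs integrable_weighted_nu[where c=1] integrable_one_minus_cos_nu)
      fix z
      have "\<bar>cos (\<xi> \<bullet> z)\<bar> * ((1 - cos (a \<bullet> z)) * nu z) \<le> 1 * ((1 - cos (a \<bullet> z)) * nu z)"
        by (intro mult_right_mono) auto
      then show "\<bar>(1 - cos (a \<bullet> z)) * cos (\<xi> \<bullet> z) * nu z\<bar> \<le> (1 - cos (a \<bullet> z)) * nu z"
        by (simp add: abs_mult mult_ac)
    qed auto
    finally show ?thesis .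
  qed
  obtain K where K: "0 \<le> K" "\<And>\<xi>. psi \<xi> \<le> K * (1 + (norm \<xi>)\<^sup>2)"
    using psi_bound by blast
  \<comment> \<open>Both \<open>psi (\<xi> + a)\<close> and \<open>psi (\<xi> - a)\<close> are at
    most \<open>K * (2 * (1 + (norm a)\<^sup>2) * (1 + (norm \<xi>)\<^sup>2))\<close>;
    \<open>K'\<close> collects what the square of this contributes apart from
    \<open>\<xi>\<close>.\<close>
  define K' where "K' = K\<^sup>2 * (4 * (1 + (norm a)\<^sup>2)\<^sup>2)"
  \<comment> \<open>Bounds the Taylor remainders of the three exponentials together, with their
    weights \<open>1\<close>, \<open>1/2\<close>, \<open>1/2\<close>; the outer division by two is
    the Taylor coefficient.\<close>
  define R where "R \<xi> = ((psi \<xi>)\<^sup>2 + (psi (\<xi> + a))\<^sup>2 / 2 + (psi (\<xi> - a))\<^sup>2 / 2) / 2" for \<xi>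
  have R: "R \<xi> \<le> K' * (1 + (norm \<xi>)\<^sup>2)\<^sup>2" for \<xi>
  proof -
    let ?N = "1 + (norm \<xi>)\<^sup>2" and ?a = "1 + (norm a)\<^sup>2"
    have sq: "(psi \<eta>)\<^sup>2 \<le> K\<^sup>2 * (2 * ?a * ?N)\<^sup>2" if "1 + (norm \<eta>)\<^sup>2 \<le> 2 * ?a * ?N" for \<eta>
    proof -
      have "psi \<eta> \<le> K * (2 * ?a * ?N)"
        using K(2)[of \<eta>] mult_left_mono[OF that K(1)] by linarith
      then show ?thesis
        unfolding power_mult_distrib[symmetric] by (intro power_mono) auto
    qed
    have pm: "1 + (norm \<eta>)\<^sup>2 \<le> 2 * ?a * ?N" if "norm \<eta> \<le> norm \<xi> + norm a" for \<eta> :: "real^'n"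
    proof -
      have "(norm \<eta>)\<^sup>2 \<le> (norm \<xi> + norm a)\<^sup>2"
        using that by (intro power_mono) auto
      also have "\<dots> \<le> 2 * (norm \<xi>)\<^sup>2 + 2 * (norm a)\<^sup>2"
        using zero_le_power2[of "norm \<xi> - norm a"] by (simp add: power2_eq_square algebra_simps)
      also have "\<dots> + 1 \<le> 2 * ?a * ?N"
        by (simp add: algebra_simps)
      finally show ?thesis
        by linarith
    qed
    have "(psi \<xi>)\<^sup>2 \<le> K\<^sup>2 * (2 * ?a * ?N)\<^sup>2" "(psi (\<xi> + a))\<^sup>2 \<le> K\<^sup>2 * (2 * ?a * ?N)\<^sup>2"
      "(psi (\<xi> - a))\<^sup>2 \<le> K\<^sup>2 * (2 * ?a * ?N)\<^sup>2"
      by (rule sq[OF pm], simp add: norm_triangle_ineq norm_triangle_ineq4)+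
    moreover have "(r + s / 2 + t / 2) / 2 \<le> u" if "r \<le> u" "s \<le> u" "t \<le> u" for r s t u :: real
      using that unfolding add_divide_distrib by linarith
    ultimately have "R \<xi> \<le> K\<^sup>2 * (2 * ?a * ?N)\<^sup>2"
      unfolding R_def by blast
    also have "K\<^sup>2 * (2 * ?a * ?N)\<^sup>2 = K' * ?N\<^sup>2"
      unfolding K'_def by algebra
    finally show ?thesis .
  qed
  define C where "C = (LINT p|P. m p * (K' * (1 + (norm (freq p))\<^sup>2)\<^sup>2))"
  have mI: "integrable P m"
  proof (rule Bochner_Integration.integrable_bound[OF m(2)])
    have "1 \<le> (1 + (norm (freq p))\<^sup>2)\<^sup>2" for p
      by (rule one_le_power) simp
    from mult_left_mono[OF this m(1)]
    show "AE p in P. norm (m p) \<le> norm (m p * (1 + (norm (freq p))\<^sup>2)\<^sup>2)"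
      using m(1) by (intro AE_I2) (simp add: abs_mult)
  qed simp
  have mB: "integrable P (\<lambda>p. m p * F p)"
    if [measurable]: "F \<in> borel_measurable P" and F: "\<And>p. \<bar>F p\<bar> \<le> c" for F c
  proof (rule Bochner_Integration.integrable_bound[OF integrable_mult_right[OF mI, of c]])
    have "0 \<le> c"
      using F[of undefined] by linarith
    then show "AE p in P. norm (m p * F p) \<le> norm (c * m p)"
      using mult_left_mono[OF F m(1)] m(1) by (intro AE_I2) (simp add: abs_mult mult.commute[of c])
  qed simp
  have mK: "integrable P (\<lambda>p. m p * (K' * (1 + (norm (freq p))\<^sup>2)\<^sup>2))"
    using integrable_mult_right[OF m(2), of K'] by (simp add: mult_ac)
  have [measurable]: "f \<in> borel_measurable borel"
  proof -
    interpret sigma_finite_measure P by fact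
    show ?thesis
      unfolding f_eq[abs_def] by measurable
  qed
  have main: "h * (LINT z|lborel. (1 - cos (a \<bullet> z)) * f (y + z) * nu z) - h\<^sup>2 * C
    \<le> expectation (\<lambda>w. (1 - cos (a \<bullet> X h w)) * f (y + X h w))" if h: "0 \<le> h" for h y
  proof -
    note [measurable] = measurable_X[OF h]
    let ?b = "\<lambda>p. freq p \<bullet> y + phase p"
    let ?E = "\<lambda>p. expectation (\<lambda>w. (1 - cos (a \<bullet> X h w)) * cos (freq p \<bullet> (y + X h w) + phase p))"
    let ?N = "LINT z|lborel. (1 - cos (a \<bullet> z)) * f (y + z) * nu z" and ?R = "\<lambda>p. K' * (1 + (norm (freq p))\<^sup>2)\<^sup>2"
    \<comment> \<open>The weight makes the Levy measure finite, so the exchange of mixture and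
      integral applies on the jump side too.\<close>
    define N where "N = density lborel (\<lambda>z. ennreal ((1 - cos (a \<bullet> z)) * nu z))"
    have setsN [measurable_cong]: "sets N = sets borel"
      by (simp add: N_def)
    interpret N: finite_measure N
    proof
      have "emeasure N (space N) = (\<integral>\<^sup>+z. ennreal ((1 - cos (a \<bullet> z)) * nu z) \<partial>lborel)"
        unfolding N_def by (simp add: emeasure_density)
      also have "\<dots> < \<infinity>"
        using integrable_one_minus_cos_nu[of a] by (simp add: integrable_iff_bounded)
      finally show "emeasure N (space N) \<noteq> \<infinity>"
        by simp
    qed
    have N_int: "(LINT z|N. F z) = (LINT z|lborel. (1 - cos (a \<bullet> z)) * F z * nu z)"
      if [measurable]: "F \<in> borel_measurable borel" for F :: "real^'n \<Rightarrow> real"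
      unfolding N_def by (subst integral_density) (auto simp: mult_ac)
    have "?N = (LINT z|N. f (y + z))"
      by (rule N_int[symmetric]) measurable
    also have "\<dots> = (LINT p|P. m p * (LINT z|N. cos (freq p \<bullet> (y + z) + phase p)))"
      unfolding f_eq by (intro N.integral_mixture[where c=1] P mI) simp_all
    also have "\<dots> = (LINT p|P. m p * (cos (?b p) * J (freq p)))"
    proof (intro Bochner_Integration.integral_cong refl arg_cong2[where f="(*)"])
      fix p
      have "freq p \<bullet> (y + z) + phase p = freq p \<bullet> z + ?b p" for z
        by (simp add: inner_add_right)
      then have "(LINT z|N. cos (freq p \<bullet> (y + z) + phase p)) = (LINT z|N. cos (freq p \<bullet> z + ?b p))"
        by (simp only:)
      also have "\<dots> = (LINT z|lborel. (1 - cos (a \<bullet> z)) * cos (freq p \<bullet> z + ?b p) * nu z)"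
        by (rule N_int) measurable
      finally show "(LINT z|N. cos (freq p \<bullet> (y + z) + phase p)) = cos (?b p) * J (freq p)"
        unfolding weighted_nu_cos J_def .
    qed
    finally have nu_side: "?N =
      (LINT p|P. m p * (cos (?b p) * J (freq p)))" .
    have E_eq: "?E p =
      cos (?b p) * (exp (- h * psi (freq p)) - exp (- h * psi (freq p + a)) / 2 - exp (- h * psi (freq p - a)) / 2)" for p
    proof -
      have "freq p \<bullet> (y + X h w) + phase p = freq p \<bullet> X h w + ?b p" for w
        by (simp add: inner_add_right)
      then show ?thesis
        by (simp only: expectation_weighted_cos[OF h])
    qed
    have E_ge: "h * (cos (?b p) * Q) + h * (cos (?b p) * J (freq p)) - h\<^sup>2 * ?R p
      \<le> ?E p" for p
    proof -
      \<comment> \<open>Remainder after the first order term of the exponential, between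
        \<open>0\<close> and \<open>h\<^sup>2 * ((psi \<eta>)\<^sup>2 / 2)\<close>.\<close>
      define \<rho> where "\<rho> \<eta> = exp (- h * psi \<eta>) - 1 + h * psi \<eta>" for \<eta>
      have \<rho>: "0 \<le> \<rho> \<eta>" "\<rho> \<eta> \<le> h\<^sup>2 * ((psi \<eta>)\<^sup>2 / 2)" for \<eta>
        using exp_minus_bounds[of "h * psi \<eta>"] h by (simp_all add: \<rho>_def power_mult_distrib)
      let ?r = "\<rho> (freq p) - \<rho> (freq p + a) / 2 - \<rho> (freq p - a) / 2"
      have "\<bar>?r\<bar> \<le> \<rho> (freq p) + \<rho> (freq p + a) / 2 + \<rho> (freq p - a) / 2"
        using \<rho>(1)[of "freq p"] \<rho>(1)[of "freq p + a"] \<rho>(1)[of "freq p - a"] by linarith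
      also have "\<dots> \<le> h\<^sup>2 * R (freq p)"
        using \<rho>(2)[of "freq p"] \<rho>(2)[of "freq p + a"] \<rho>(2)[of "freq p - a"]
        unfolding R_def by (simp add: field_simps)
      also have "\<dots> \<le> h\<^sup>2 * ?R p"
        by (intro mult_left_mono R) simp
      finally have r: "\<bar>?r\<bar> \<le> h\<^sup>2 * ?R p" .
      have "\<bar>cos (?b p) * ?r\<bar> \<le> 1 * \<bar>?r\<bar>"
        unfolding abs_mult by (intro mult_right_mono) auto
      from abs_le_D2[OF order_trans[OF this[unfolded mult_1_left] r]] have cr: "- (h\<^sup>2 * ?R p) \<le> cos (?b p) * ?r"
        by (subst minus_le_iff)
      have e: "exp (- h * psi (freq p)) - exp (- h * psi (freq p + a)) / 2 - exp (- h * psi (freq p - a)) / 2 =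
        h * (Q + J (freq p)) + ?r"
        unfolding J_eq \<rho>_def by (simp add: field_simps)
      have "h * (c * q) + h * (c * j) - B \<le> c * (h * (q + j) + r)" if "- B \<le> c * r" for c q j r B :: real
        using that by (simp add: algebra_simps)
      from this[OF cr] show ?thesis
        unfolding E_eq e .
    qed
    have Eb: "\<bar>?E p\<bar> \<le> 2" for p
    proof -
      have "\<bar>(1 - cos s) * cos t\<bar> \<le> 2" for s t :: real
        using mult_mono[of "\<bar>1 - cos s\<bar>" 2 "\<bar>cos t\<bar>" 1] abs_cos_le_one[of s] by (simp add: abs_mult)
      then have "integrable M (\<lambda>w. (1 - cos (a \<bullet> X h w)) * cos (freq p \<bullet> (y + X h w) + phase p))"
        and b: "\<bar>(1 - cos (a \<bullet> X h w)) * cos (freq p \<bullet> (y + X h w) + phase p)\<bar> \<le> 2" for w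
        by (auto intro!: integrable_const_bound[where B=2])
      then show ?thesis
        unfolding abs_le_iff
        by (intro conjI integral_le_const AE_I2, simp, simp)
           (subst minus_le_iff, intro integral_ge_const AE_I2, simp, subst minus_le_iff, simp)
    qed
    have EM: "(\<lambda>p. ?E p) \<in> borel_measurable P"
      unfolding E_eq by measurable
    have cJ: "\<bar>cos (?b p) * J (freq p)\<bar> \<le> 1 * J0" for p
      unfolding abs_mult using J0[of "freq p"] by (intro mult_mono) auto
    have cQ: "\<bar>cos (?b p) * Q\<bar> \<le> 1 * Q" for p
      unfolding abs_mult using Q by (intro mult_mono) auto
    have i1: "integrable P (\<lambda>p. m p * (cos (?b p) * Q))"
      by (rule mB[OF _ cQ]) measurable
    have i2: "integrable P (\<lambda>p. m p * (cos (?b p) * J (freq p)))"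
      by (rule mB[OF _ cJ]) measurable
    have "(LINT p|P. m p * (cos (?b p) * Q)) = Q * f y"
    proof -
      have "(LINT p|P. m p * (cos (?b p) * Q)) = (LINT p|P. (m p * cos (?b p)) * Q)"
        by (simp add: mult_ac)
      then show ?thesis
        unfolding f_eq by (simp add: mult.commute)
    qed
    \<comment> \<open>The Gaussian part contributes \<open>h * (Q * f y)\<close>. It is nonnegative
      because \<open>f\<close> is, so inserting it only enlarges the right side.\<close>
    then have "h * ?N - h\<^sup>2 * C
      \<le> h * (LINT p|P. m p * (cos (?b p) * Q)) + h * (LINT p|P. m p * (cos (?b p) * J (freq p))) - h\<^sup>2 * C"
      unfolding nu_side using Q f_nonneg[of y] h by simp
    also have "\<dots> = (LINT p|P. h * (m p * (cos (?b p) * Q)) + h * (m p * (cos (?b p) * J (freq p)))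
        - h\<^sup>2 * (m p * ?R p))"
      unfolding C_def
      by (subst Bochner_Integration.integral_diff)
         (auto intro!: Bochner_Integration.integrable_add integrable_mult_right i1 i2 mK
            simp: Bochner_Integration.integral_add[OF integrable_mult_right[OF i1] integrable_mult_right[OF i2]]
            simp del: integrable_mult_right_iff)
    also have "\<dots> \<le> (LINT p|P. m p * ?E p)"
    proof (rule integral_mono)
      show "integrable P (\<lambda>p. h * (m p * (cos (?b p) * Q)) + h * (m p * (cos (?b p) * J (freq p)))
        - h\<^sup>2 * (m p * ?R p))"
        by (intro Bochner_Integration.integrable_diff Bochner_Integration.integrable_add integrable_mult_right i1 i2 mK)
      show "integrable P (\<lambda>p. m p * ?E p)"
        by (rule mB[OF EM Eb])
      fix p
      show "h * (m p * (cos (?b p) * Q)) + h * (m p * (cos (?b p) * J (freq p)))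
          - h\<^sup>2 * (m p * ?R p)
        \<le> m p * ?E p"
        using mult_left_mono[OF E_ge[of p] m(1)[of p]] by (simp add: algebra_simps)
    qed
    also have "\<dots> = expectation (\<lambda>w. LINT p|P. m p * ((1 - cos (a \<bullet> X h w)) * cos (freq p \<bullet> (y + X h w) + phase p)))"
    proof (rule integral_mixture[symmetric, where c=2, OF P mI])
      show "\<bar>(1 - cos (a \<bullet> X h w)) * cos (freq p \<bullet> (y + X h w) + phase p)\<bar> \<le> 2" for w p
        using mult_mono[of "\<bar>1 - cos (a \<bullet> X h w)\<bar>" 2 "\<bar>cos (freq p \<bullet> (y + X h w) + phase p)\<bar>" 1]
          abs_cos_le_one[of "a \<bullet> X h w"] by (simp add: abs_mult)
    qed measurable
    also have "\<dots> = expectation (\<lambda>w. (1 - cos (a \<bullet> X h w)) * f (y + X h w))"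
      unfolding f_eq
      by (simp only: integral_mult_right_zero[symmetric] mult.left_commute[of "m _"])
    finally show ?thesis .
  qed
  have "0 \<le> K'"
    by (simp add: K'_def)
  then have "0 \<le> C"
    unfolding C_def using m(1) by (intro integral_nonneg_AE AE_I2) simp
  with main show ?thesis
    by blast
qed

end

section \<open>Markov property and exit from balls\<close>

text \<open>Independence says that the joint law is the product law, and Tonelli does the
  rest.\<close>

lemma (in prob_space) nn_integral_indep_var:
  assumes "indep_var S U T W"
    and F [measurable]: "(\<lambda>(u, v). F u v) \<in> borel_measurable (S \<Otimes>\<^sub>M T)"
  shows "(\<integral>\<^sup>+w. F (U w) (W w) \<partial>M) = (\<integral>\<^sup>+w. (\<integral>\<^sup>+w'. F (U w) (W w') \<partial>M) \<partial>M)"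
proof -
  have [measurable]: "U \<in> measurable M S" "W \<in> measurable M T"
    and eq: "distr M S U \<Otimes>\<^sub>M distr M T W = distr M (S \<Otimes>\<^sub>M T) (\<lambda>w. (U w, W w))"
    using assms(1) by (auto simp: indep_var_distribution_eq)
  interpret W: prob_space "distr M T W"
    by (rule prob_space_distr) measurable
  have sets_eq: "sets (S \<Otimes>\<^sub>M distr M T W) = sets (S \<Otimes>\<^sub>M T)" "sets (distr M S U \<Otimes>\<^sub>M distr M T W) = sets (S \<Otimes>\<^sub>M T)"
    by (intro sets_pair_measure_cong; simp)+
  have F1: "case_prod F \<in> borel_measurable (S \<Otimes>\<^sub>M distr M T W)"
    and F2: "case_prod F \<in> borel_measurable (distr M S U \<Otimes>\<^sub>M distr M T W)"
    using F by (simp_all only: measurable_cong_sets[OF sets_eq(1) refl] measurable_cong_sets[OF sets_eq(2) refl])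
  have I: "(\<lambda>u. \<integral>\<^sup>+v. F u v \<partial>distr M T W) \<in> borel_measurable S"
    using W.borel_measurable_nn_integral[OF F1] .
  have "(\<integral>\<^sup>+w. F (U w) (W w) \<partial>M) = (\<integral>\<^sup>+p. case_prod F p \<partial>distr M (S \<Otimes>\<^sub>M T) (\<lambda>w. (U w, W w)))"
    by (subst nn_integral_distr) simp_all
  also have "\<dots> = (\<integral>\<^sup>+u. (\<integral>\<^sup>+v. F u v \<partial>distr M T W) \<partial>distr M S U)"
    unfolding eq[symmetric] using W.nn_integral_fst[OF F2] by simp
  also have "\<dots> = (\<integral>\<^sup>+w. (\<integral>\<^sup>+v. F (U w) v \<partial>distr M T W) \<partial>M)"
    using nn_integral_distr[OF \<open>U \<in> measurable M S\<close>] I by simp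
  also have "\<dots> = (\<integral>\<^sup>+w. (\<integral>\<^sup>+w'. F (U w) (W w') \<partial>M) \<partial>M)"
  proof (rule nn_integral_cong)
    fix w assume "w \<in> space M"
    then have "U w \<in> space S"
      using \<open>U \<in> measurable M S\<close> by (rule measurable_space[rotated])
    from measurable_Pair2[OF F this]
    show "(\<integral>\<^sup>+v. F (U w) v \<partial>distr M T W) = (\<integral>\<^sup>+w'. F (U w) (W w') \<partial>M)"
      using nn_integral_distr[OF \<open>W \<in> measurable M T\<close>] by simp
  qed
  finally show ?thesis .
qed

context levy_process
begin

lemma right_approx_tendsto:
  assumes w: "w \<in> space M" and t: "0 \<le> t" and s: "s \<longlonglongrightarrow> t" "\<And>n. t < s n"
  shows "(\<lambda>n. X (s n) w) \<longlonglongrightarrow> X t w"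
proof -
  have "((\<lambda>t. X t w) \<longlongrightarrow> X t w) (at_right t)"
    using cadlag_paths[OF w] t by (simp add: cadlag_def)
  moreover have "filterlim s (at_right t) sequentially"
    using s by (auto simp: filterlim_at intro: always_eventually)
  ultimately show ?thesis
    by (rule filterlim_compose)
qed

text \<open>The first grid point strictly to the right of \<open>t\<close>; strictness is what right
  continuity of the paths calls for.\<close>

lemma grid_right_approx:
  fixes t \<delta> :: real
  assumes "0 < \<delta>"
  shows "t < (real_of_int \<lfloor>t / \<delta>\<rfloor> + 1) * \<delta>" "(real_of_int \<lfloor>t / \<delta>\<rfloor> + 1) * \<delta> \<le> t + \<delta>"
proof -
  have "t / \<delta> < real_of_int \<lfloor>t / \<delta>\<rfloor> + 1" "real_of_int \<lfloor>t / \<delta>\<rfloor> \<le> t / \<delta>"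
    by linarith+
  from pos_divide_less_eq[THEN iffD1, OF assms this(1)] pos_le_divide_eq[THEN iffD1, OF assms this(2)]
  show "t < (real_of_int \<lfloor>t / \<delta>\<rfloor> + 1) * \<delta>" "(real_of_int \<lfloor>t / \<delta>\<rfloor> + 1) * \<delta> \<le> t + \<delta>"
    by (simp_all add: distrib_right)
qed

lemma grid_right_tendsto:
  fixes t h :: real
  assumes "0 < h"
  shows "(\<lambda>m. (real_of_int \<lfloor>t / (h / 2 ^ m)\<rfloor> + 1) * (h / 2 ^ m)) \<longlonglongrightarrow> t"
proof (rule real_tendsto_sandwich)
  show "\<forall>\<^sub>F m in sequentially. t \<le> (real_of_int \<lfloor>t / (h / 2 ^ m)\<rfloor> + 1) * (h / 2 ^ m)"
    using grid_right_approx(1)[of "h / 2 ^ m" t for m] assms by (intro always_eventually allI less_imp_le) simp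
  show "\<forall>\<^sub>F m in sequentially. (real_of_int \<lfloor>t / (h / 2 ^ m)\<rfloor> + 1) * (h / 2 ^ m) \<le> t + h / 2 ^ m"
    using grid_right_approx(2)[of "h / 2 ^ m" t for m] assms by (intro always_eventually allI) simp
  have "(\<lambda>m. h / 2 ^ m) \<longlonglongrightarrow> 0"
    using tendsto_mult[OF tendsto_const[of h] LIMSEQ_power_zero[of "1 / 2 :: real"]]
    by (simp add: power_one_over field_simps)
  from tendsto_add[OF tendsto_const[of t] this]
  show "(\<lambda>m. t + h / 2 ^ m) \<longlonglongrightarrow> t"
    by simp
qed simp

text \<open>By right continuity the process is the pointwise limit of its values at the next dyadic
  time, and each approximation takes countably many time values. Truncating time at \<open>0\<close>
  makes the map total.\<close>

lemma measurable_X_joint: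
  "(\<lambda>(s, w). X (max 0 s) w) \<in> borel_measurable (borel \<Otimes>\<^sub>M M)"
proof -
  let ?g = "\<lambda>m (s :: real). nat (\<lfloor>max 0 s / (1 / 2 ^ m)\<rfloor> + 1) :: nat"
  define f where "f m p = X (real (?g m (fst p)) * (1 / 2 ^ m)) (snd p)" for m :: nat and p :: "real \<times> 'w"
  have f: "f m \<in> borel_measurable (borel \<Otimes>\<^sub>M M)" for m
  proof -
    have "(\<lambda>p. (\<lambda>i (s, w). X (real i * (1 / 2 ^ m)) w) (?g m (fst p)) p) \<in> borel_measurable (borel \<Otimes>\<^sub>M M)"
    proof (rule measurable_compose_countable[where f="\<lambda>i (s, w). X (real i * (1 / 2 ^ m)) w" and g="\<lambda>p. ?g m (fst p)"])
      fix i :: nat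
      show "(\<lambda>(s, w). X (real i * (1 / 2 ^ m)) w) \<in> borel_measurable (borel \<Otimes>\<^sub>M M)"
        using measurable_compose[OF measurable_snd measurable_X[of "real i * (1 / 2 ^ m)"]]
        by (simp add: case_prod_unfold)
    qed measurable
    then show ?thesis
      by (simp add: f_def[abs_def] case_prod_unfold)
  qed
  have lim: "(\<lambda>m. f m p) \<longlonglongrightarrow> X (max 0 (fst p)) (snd p)" if "p \<in> space (borel \<Otimes>\<^sub>M M)" for p
  proof -
    have w: "snd p \<in> space M"
      using that by (auto simp: space_pair_measure)
    let ?t = "max 0 (fst p)"
    have g: "real (nat (\<lfloor>?t / (1 / 2 ^ m)\<rfloor> + 1)) = real_of_int \<lfloor>?t / (1 / 2 ^ m)\<rfloor> + 1" for m :: nat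
    proof -
      have "0 \<le> \<lfloor>?t / (1 / 2 ^ m)\<rfloor>"
        by simp
      then show ?thesis
        by (simp add: of_nat_nat)
    qed
    have "(\<lambda>m. X (real (nat (\<lfloor>?t / (1 / 2 ^ m)\<rfloor> + 1)) * (1 / 2 ^ m)) (snd p)) \<longlonglongrightarrow> X ?t (snd p)"
      unfolding g
    proof (rule right_approx_tendsto[OF w])
      show "?t < (real_of_int \<lfloor>?t / (1 / 2 ^ m)\<rfloor> + 1) * (1 / 2 ^ m)" for m :: nat
        by (rule grid_right_approx(1)) simp
      show "(\<lambda>m. (real_of_int \<lfloor>?t / (1 / 2 ^ m)\<rfloor> + 1) * (1 / 2 ^ m)) \<longlonglongrightarrow> ?t"
        by (rule grid_right_tendsto) simp
    qed simp
    then show ?thesis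
      by (simp add: f_def)
  qed
  show ?thesis
    using borel_measurable_LIMSEQ_metric[OF f lim] by (simp add: case_prod_unfold)
qed

text \<open>The path on the grid is a function of the increments up to
  \<open>real K * \<delta>\<close>, and the last increment is independent of these. The start at the
  origin holds almost surely only, so both translations into increments are almost everywhere
  identities.\<close>

lemma grid_markov:
  fixes f :: "real^'n \<Rightarrow> ennreal"
  assumes \<delta>: "0 \<le> \<delta>" and s: "real K * \<delta> \<le> s"
    and [measurable]: "f \<in> borel_measurable borel" "\<And>i. B i \<in> sets borel"
  shows "(\<integral>\<^sup>+w\<in>{w. \<forall>i\<le>K. X (real i * \<delta>) w \<in> B i}. f (X s w) \<partial>M) =
    (\<integral>\<^sup>+w\<in>{w. \<forall>i\<le>K. X (real i * \<delta>) w \<in> B i}.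
      (\<integral>\<^sup>+w'. f (X (real K * \<delta>) w + X (s - real K * \<delta>) w') \<partial>M) \<partial>M)"
proof -
  \<comment> \<open>Grid times up to index \<open>K\<close>, then constantly \<open>s\<close>;
    increment number \<open>K\<close> is thus the remaining move from
    \<open>real K * \<delta>\<close> to \<open>s\<close>.\<close>
  define u where "u i = (if i \<le> K then real i * \<delta> else s)" for i
  have u0: "u 0 = 0"
    by (simp add: u_def)
  have u_nonneg: "0 \<le> u i" for i
    using \<delta> s by (auto simp: u_def intro: order_trans[OF _ s])
  have "real i * \<delta> \<le> s" if "i \<le> K" for i
    using that \<delta> by (intro order_trans[OF mult_right_mono s]) simp_all
  then have "mono u"
    using \<delta> unfolding u_def by (auto intro!: monoI mult_right_mono)
  define D where "D i w = X (u (Suc i)) w - X (u i) w" for i w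
  have ind: "indep_vars (\<lambda>_. borel) D {..<Suc K}"
    unfolding D_def using independent_increments[of u "Suc K"] \<open>mono u\<close> u0 by simp
  define I where "I = {..<K}"
  define U where "U w = restrict (\<lambda>i. D i w) I" for w
  define W where "W w = restrict (\<lambda>i. D i w) {K}" for w
  have UW: "indep_var (PiM I (\<lambda>_. borel)) U (PiM {K} (\<lambda>_. borel)) W"
    unfolding U_def W_def using indep_var_restrict[OF ind, of I "{K}"] by (auto simp: I_def)
  have W_eq: "W w K = D K w" for w
    by (simp add: W_def)
  define S where "S i x = (\<Sum>l<i. x l)" for i and x :: "nat \<Rightarrow> real^'n"
  have [measurable]: "S i \<in> borel_measurable (PiM I (\<lambda>_. borel))" if "i \<le> K" for i
    unfolding S_def using that by (auto simp: I_def)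
  define E where "E = {x. \<forall>i\<le>K. S i x \<in> B i}"
  have E_eq: "indicator E x = (\<Prod>i\<le>K. indicator (B i) (S i x) :: ennreal)" for x
    by (auto simp: E_def indicator_def prod_zero_iff intro!: prod.neutral[symmetric])
  have [measurable]: "(\<lambda>x. indicator E x :: ennreal) \<in> borel_measurable (PiM I (\<lambda>_. borel))"
    unfolding E_eq by measurable
  have SK [measurable]: "S K \<in> borel_measurable (PiM I (\<lambda>_. borel))"
    by simp
  have S_eq: "S i (U w) = X (real i * \<delta>) w" if "i \<le> K" "X 0 w = 0" for i w
  proof -
    have "S i (U w) = (\<Sum>l<i. X (u (Suc l)) w - X (u l) w)"
      unfolding S_def U_def D_def using that by (intro sum.cong) (auto simp: I_def)
    also have "\<dots> = X (u i) w - X (u 0) w"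
      by (rule sum_lessThan_telescope)
    finally show ?thesis
      using that u0 by (simp add: u_def)
  qed
  have u': "u K = real K * \<delta>" "u (Suc K) = s"
    by (simp_all add: u_def)
  have W_meas: "(\<lambda>w. W w K) \<in> borel_measurable M" and [measurable]: "X (s - real K * \<delta>) \<in> borel_measurable M"
    using measurable_X[OF u_nonneg[of K]] measurable_X[OF u_nonneg[of "Suc K"]] s
    unfolding W_eq D_def u' by (auto intro: measurable_X)
  note W_meas [measurable]
  have W_distr: "(\<integral>\<^sup>+w'. f (x + W w' K) \<partial>M) = (\<integral>\<^sup>+w'. f (x + X (s - real K * \<delta>) w') \<partial>M)" for x
  proof -
    have "distr M borel (\<lambda>w. W w K) = distr M borel (X (s - real K * \<delta>))"
      using stationary_increments[of "u K" "s - u K"] u_nonneg[of K] s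
      unfolding W_eq D_def u' by simp
    then have "(\<integral>\<^sup>+v. f (x + v) \<partial>distr M borel (\<lambda>w. W w K)) = (\<integral>\<^sup>+v. f (x + v) \<partial>distr M borel (X (s - real K * \<delta>)))"
      by simp
    then show ?thesis
      by (simp add: nn_integral_distr)
  qed
  have "(\<integral>\<^sup>+w\<in>{w. \<forall>i\<le>K. X (real i * \<delta>) w \<in> B i}. f (X s w) \<partial>M) =
      (\<integral>\<^sup>+w. f (S K (U w) + W w K) * indicator E (U w) \<partial>M)"
    using start_0
    by (intro nn_integral_cong_AE, eventually_elim)
       (auto simp: S_eq indicator_def E_def W_eq D_def u')
  also have "\<dots> = (\<integral>\<^sup>+w. (\<integral>\<^sup>+w'. f (S K (U w) + W w' K) * indicator E (U w) \<partial>M) \<partial>M)"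
    using nn_integral_indep_var[OF UW, of "\<lambda>x v. f (S K x + v K) * indicator E x"] by simp
  also have "\<dots> = (\<integral>\<^sup>+w. (\<integral>\<^sup>+w'. f (S K (U w) + X (s - real K * \<delta>) w') \<partial>M) * indicator E (U w) \<partial>M)"
    by (simp add: nn_integral_multc W_distr)
  also have "\<dots> = (\<integral>\<^sup>+w\<in>{w. \<forall>i\<le>K. X (real i * \<delta>) w \<in> B i}.
      (\<integral>\<^sup>+w'. f (X (real K * \<delta>) w + X (s - real K * \<delta>) w') \<partial>M) \<partial>M)"
    using start_0
    by (intro nn_integral_cong_AE, eventually_elim) (auto simp: S_eq indicator_def E_def)
  finally show ?thesis .
qed

text \<open>Leaving the closed ball of radius \<open>r\<close> during \<open>[0, h]\<close>, tested
  at dyadic times only, which keeps the event measurable without completion. Right continuity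
  recovers all other times.\<close>

definition exit_event :: "real \<Rightarrow> real \<Rightarrow> 'w set" where
  "exit_event h r = {w\<in>space M. \<exists>m. \<exists>j\<le>2 ^ m. r < norm (X (real j * (h / 2 ^ m)) w)}"

lemma sets_exit_event [measurable]:
  assumes "0 \<le> h"
  shows "exit_event h r \<in> sets M"
proof -
  have [measurable]: "X (real j * (h / 2 ^ m)) \<in> borel_measurable M" for j m :: nat
    using assms by (intro measurable_X) simp
  show ?thesis
    unfolding exit_event_def by measurable
qed

text \<open>The strict inequality is an open condition, so by right continuity it persists at dyadic
  times shortly after \<open>s\<close>, and these can be chosen below \<open>t\<close>.\<close>

lemma grid_exit:
  assumes w: "w \<in> space M" and st: "0 \<le> s" "s < t" "t \<le> h" and r: "r < norm (X s w)"
  shows "\<exists>m. \<exists>j\<le>2 ^ m. real j * (h / 2 ^ m) < t \<and> r < norm (X (real j * (h / 2 ^ m)) w)"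
proof -
  have h: "0 < h"
    using st by linarith
  define q where "q m = (real_of_int \<lfloor>s / (h / 2 ^ m)\<rfloor> + 1) * (h / 2 ^ m)" for m :: nat
  have q: "q \<longlonglongrightarrow> s" "\<And>m. s < q m"
    unfolding q_def using grid_right_tendsto[OF h] grid_right_approx(1)[of "h / 2 ^ m" s for m] h by auto
  have "(\<lambda>m. norm (X (q m) w)) \<longlonglongrightarrow> norm (X s w)"
    by (intro tendsto_norm right_approx_tendsto w st q)
  then have "\<forall>\<^sub>F m in sequentially. r < norm (X (q m) w)"
    using r by (rule order_tendstoD)
  moreover have "\<forall>\<^sub>F m in sequentially. q m < t"
    using q(1) st(2) by (rule order_tendstoD)
  ultimately obtain m where m: "r < norm (X (q m) w)" "q m < t"
    using eventually_happens'[OF sequentially_bot eventually_conj] by blast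
  define j where "j = nat (\<lfloor>s / (h / 2 ^ m)\<rfloor> + 1)"
  have "0 \<le> \<lfloor>s / (h / 2 ^ m)\<rfloor>"
    using st h by simp
  then have qj: "q m = real j * (h / 2 ^ m)"
    unfolding q_def j_def by (simp add: of_nat_nat)
  have "real j * (h / 2 ^ m) < h"
    using m st qj by linarith
  then have "real j < 2 ^ m"
    using h by (simp add: field_simps)
  then have "real j < real (2 ^ m)"
    by simp
  then have "j \<le> 2 ^ m"
    by (simp only: of_nat_less_iff)
  then show ?thesis
    using m qj by (intro exI[of _ m] exI[of _ j]) simp
qed

lemma norm_X_le_of_notin_exit_event:
  assumes "w \<in> space M" "w \<notin> exit_event h r" "0 \<le> s" "s \<le> h"
  shows "norm (X s w) \<le> r"
proof (rule ccontr)
  assume r: "\<not> norm (X s w) \<le> r"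
  show False
  proof (cases "s = h")
    \<comment> \<open>The endpoint has no room to its right, but it is itself the grid point
      \<open>j = 1\<close> of level \<open>m = 0\<close>.\<close>
    case True
    have "\<forall>m. \<forall>j\<le>2 ^ m. \<not> r < norm (X (real j * (h / 2 ^ m)) w)"
      using assms unfolding exit_event_def by blast
    from this[rule_format, of 1 0] show False
      using r True by simp
  next
    case False
    then show False
      using grid_exit[of w s h h r] assms r unfolding exit_event_def by auto
  qed
qed

end

section \<open>Exit probabilities and occupation times\<close>

lemma nn_integral_lborel_shift:
  fixes g :: "'a::euclidean_space \<Rightarrow> ennreal"
  assumes [measurable]: "g \<in> borel_measurable borel"
  shows "(\<integral>\<^sup>+x. g (c + x) \<partial>lborel) = (\<integral>\<^sup>+x. g x \<partial>lborel)"
proof -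
  have "(\<integral>\<^sup>+x. g x \<partial>lborel) = (\<integral>\<^sup>+x. g x \<partial>distr lborel borel ((+) c))"
    by (simp only: lborel_distr_plus)
  also have "\<dots> = (\<integral>\<^sup>+x. g (c + x) \<partial>lborel)"
    by (rule nn_integral_distr) auto
  finally show ?thesis
    by simp
qed

context symmetric_levy_process
begin

text \<open>The denominator is the value of
  \<open>1 - exp (- (norm x)\<^sup>2 / (2 * r\<^sup>2))\<close> on the sphere of radius
  \<open>r\<close>, hence its smallest value outside the ball.\<close>

definition exit_const :: real where
  "exit_const = gauss_const / (1 - exp (- 1 / 2))"

lemma exit_const_nonneg: "0 \<le> exit_const"
  unfolding exit_const_def by (intro divide_nonneg_nonneg gauss_const_nonneg) simp

text \<open>Optional stopping along the grid for the bounded function \<open>1 - exp (- |x|\<^sup>2 / (2 r\<^sup>2))\<close>,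
  which is bounded away from \<open>0\<close> outside the ball of radius \<open>r\<close>.\<close>

lemma emeasure_grid_exit:
  assumes \<delta>: "0 \<le> \<delta>" and r: "0 < r"
  shows "emeasure M {w\<in>space M. \<exists>j\<le>K. r < norm (X (real j * \<delta>) w)}
    \<le> ennreal (real K * \<delta> * (exit_const * Psi (1 / r)))"
proof -
  define v where "v y = 1 - exp (- (norm y)\<^sup>2 / (2 * r\<^sup>2))" for y :: "real^'n"
  define \<theta> where "\<theta> = 1 - exp (- 1 / 2 :: real)"
  define c where "c = \<delta> * (gauss_const * Psi (1 / r))"
  have \<theta>: "0 < \<theta>"
    by (simp add: \<theta>_def)
  have c: "0 \<le> c"
    unfolding c_def using \<delta> r by (intro mult_nonneg_nonneg gauss_const_nonneg Psi_nonneg) auto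
  have v: "0 \<le> v y" "v y \<le> 1" for y
    by (simp_all add: v_def)
  have [measurable]: "v \<in> borel_measurable borel"
    unfolding v_def by measurable
  have v_\<theta>: "\<theta> \<le> v y" if "r < norm y" for y
  proof -
    have "r\<^sup>2 \<le> (norm y)\<^sup>2"
      using that r by (intro power_mono) auto
    then have "- (norm y)\<^sup>2 / (2 * r\<^sup>2) \<le> - 1 / 2"
      using r by (simp add: field_simps)
    then show ?thesis
      unfolding v_def \<theta>_def by simp
  qed
  have [measurable]: "X (real i * \<delta>) \<in> borel_measurable M" "X \<delta> \<in> borel_measurable M" for i :: nat
    using \<delta> by (auto intro: measurable_X)
  have step: "(\<integral>\<^sup>+w. ennreal (v (y + X \<delta> w)) \<partial>M) \<le> ennreal (v y) + ennreal c" for y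
  proof -
    have i: "integrable M (\<lambda>w. exp (- (norm (y + X \<delta> w))\<^sup>2 / (2 * r\<^sup>2)))"
      by (rule integrable_const_bound[where B=1]) auto
    then have iw: "integrable M (\<lambda>w. v (y + X \<delta> w))"
      unfolding v_def by (intro Bochner_Integration.integrable_diff) auto
    have "expectation (\<lambda>w. v (y + X \<delta> w)) = 1 - expectation (\<lambda>w. exp (- (norm (y + X \<delta> w))\<^sup>2 / (2 * r\<^sup>2)))"
      unfolding v_def using i by (subst Bochner_Integration.integral_diff) (auto simp: prob_space)
    also have "\<dots> \<le> v y + c"
      using expectation_gaussian_ge[OF r \<delta>, of y] unfolding v_def c_def by linarith
    finally have "(\<integral>\<^sup>+w. ennreal (v (y + X \<delta> w)) \<partial>M) \<le> ennreal (v y + c)"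
      using iw v by (subst nn_integral_eq_integral) (auto intro: ennreal_leI)
    then show ?thesis
      using v c by (simp add: ennreal_plus)
  qed
  define A where "A k = {w. \<forall>i\<le>k. X (real i * \<delta>) w \<in> cball 0 r}" for k :: nat
  have A_meas: "A k \<inter> space M \<in> sets M" for k
  proof -
    have "A k \<inter> space M = {w\<in>space M. \<forall>i\<le>k. norm (X (real i * \<delta>) w) \<le> r}"
      by (auto simp: A_def)
    also have "\<dots> \<in> sets M"
      by measurable
    finally show ?thesis .
  qed
  have [measurable]: "(\<lambda>w. indicator (A k) w :: ennreal) \<in> borel_measurable M" for k
    using A_meas by (simp add: borel_measurable_indicator_iff)
  \<comment> \<open>The stopped barrier: \<open>v\<close> along the path as long as it has stayed in
    the ball, frozen at \<open>\<theta>\<close> afterwards. Its expectation grows by at most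
    \<open>c\<close> per step.\<close>
  define G where "G k w = ennreal (v (X (real k * \<delta>) w)) * indicator (A k) w + ennreal \<theta> * (1 - indicator (A k) w)"
    for k w
  define a where "a k = (\<integral>\<^sup>+w. G k w \<partial>M)" for k
  have a_Suc: "a (Suc k) \<le> a k + ennreal c" for k
  proof -
    have "a (Suc k) \<le> (\<integral>\<^sup>+w. ennreal (v (X (real (Suc k) * \<delta>) w)) * indicator (A k) w + ennreal \<theta> * (1 - indicator (A k) w) \<partial>M)"
      unfolding a_def
    proof (rule nn_integral_mono)
      fix w
      have "A (Suc k) \<subseteq> A k"
        by (auto simp: A_def)
      moreover have "ennreal \<theta> \<le> ennreal (v (X (real (Suc k) * \<delta>) w))" if "w \<in> A k" "w \<notin> A (Suc k)"
        using that by (intro ennreal_leI v_\<theta>) (auto simp: A_def le_Suc_eq)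
      ultimately show "G (Suc k) w \<le> ennreal (v (X (real (Suc k) * \<delta>) w)) * indicator (A k) w + ennreal \<theta> * (1 - indicator (A k) w)"
        unfolding G_def by (auto simp: indicator_def)
    qed
    also have "\<dots> = (\<integral>\<^sup>+w\<in>A k. ennreal (v (X (real (Suc k) * \<delta>) w)) \<partial>M) + (\<integral>\<^sup>+w. ennreal \<theta> * (1 - indicator (A k) w) \<partial>M)"
      by (rule nn_integral_add) measurable
    also have "(\<integral>\<^sup>+w\<in>A k. ennreal (v (X (real (Suc k) * \<delta>) w)) \<partial>M) =
        (\<integral>\<^sup>+w\<in>A k. (\<integral>\<^sup>+w'. ennreal (v (X (real k * \<delta>) w + X (real (Suc k) * \<delta> - real k * \<delta>) w')) \<partial>M) \<partial>M)"
      unfolding A_def using \<delta> by (intro grid_markov) (auto intro!: mult_right_mono)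
    also have "\<dots> \<le> (\<integral>\<^sup>+w. ennreal (v (X (real k * \<delta>) w)) * indicator (A k) w + ennreal c \<partial>M)"
    proof (rule nn_integral_mono)
      fix w
      have "real (Suc k) * \<delta> - real k * \<delta> = \<delta>"
        by (simp add: algebra_simps)
      then show "(\<integral>\<^sup>+w'. ennreal (v (X (real k * \<delta>) w + X (real (Suc k) * \<delta> - real k * \<delta>) w')) \<partial>M) * indicator (A k) w
        \<le> ennreal (v (X (real k * \<delta>) w)) * indicator (A k) w + ennreal c"
        using step[of "X (real k * \<delta>) w"] by (auto simp: indicator_def)
    qed
    also have "\<dots> = (\<integral>\<^sup>+w\<in>A k. ennreal (v (X (real k * \<delta>) w)) \<partial>M) + ennreal c"
      by (subst nn_integral_add) (auto simp: emeasure_space_1)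
    finally have "a (Suc k) \<le> (\<integral>\<^sup>+w\<in>A k. ennreal (v (X (real k * \<delta>) w)) \<partial>M) + ennreal c
        + (\<integral>\<^sup>+w. ennreal \<theta> * (1 - indicator (A k) w) \<partial>M)"
      by (simp add: add_right_mono)
    also have "\<dots> = a k + ennreal c"
    proof -
      have "a k = (\<integral>\<^sup>+w\<in>A k. ennreal (v (X (real k * \<delta>) w)) \<partial>M) + (\<integral>\<^sup>+w. ennreal \<theta> * (1 - indicator (A k) w) \<partial>M)"
        unfolding a_def G_def by (rule nn_integral_add) measurable
      then show ?thesis
        by (simp only: ac_simps)
    qed
    finally show ?thesis .
  qed
  \<comment> \<open>The path starts at the origin almost surely, and \<open>v\<close> vanishes
    there.\<close>
  have "a 0 = (\<integral>\<^sup>+w. 0 \<partial>M)"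
    unfolding a_def using start_0
    by (intro nn_integral_cong_AE, eventually_elim) (use r in \<open>auto simp: G_def A_def v_def\<close>)
  then have "a k \<le> ennreal (real k * c)" for k
  proof (induction k)
    case (Suc k)
    then have "a (Suc k) \<le> ennreal (real k * c) + ennreal c"
      by (intro order_trans[OF a_Suc] add_right_mono) simp
    then show ?case
      using c by (simp add: algebra_simps flip: ennreal_plus)
  qed simp
  note a_K = this[of K]
  have "ennreal \<theta> * emeasure M {w\<in>space M. \<exists>j\<le>K. r < norm (X (real j * \<delta>) w)} =
      (\<integral>\<^sup>+w. ennreal \<theta> * indicator {w\<in>space M. \<exists>j\<le>K. r < norm (X (real j * \<delta>) w)} w \<partial>M)"
    by (subst nn_integral_cmult_indicator) auto
  also have "\<dots> \<le> a K"
    unfolding a_def G_def A_def by (intro nn_integral_mono) (auto simp: indicator_def not_le)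
  also note a_K
  also have "real K * c = \<theta> * (real K * \<delta> * (exit_const * Psi (1 / r)))"
    using \<theta> unfolding c_def exit_const_def \<theta>_def by simp
  finally show ?thesis
    using \<theta> by (simp add: ennreal_mult' ennreal_mult_le_mult_iff)
qed

lemma exit_grid_mono:
  assumes "j \<le> 2 ^ m" "m \<le> m'"
  shows "\<exists>j'\<le>2 ^ m'. real j' * (h / 2 ^ m') = real j * (h / 2 ^ m)"
proof (intro exI conjI)
  have "j * 2 ^ (m' - m) \<le> 2 ^ m * 2 ^ (m' - m)"
    using assms by simp
  then show "j * 2 ^ (m' - m) \<le> 2 ^ m'"
    using assms(2) by (simp flip: power_add)
  have "(2::real) ^ m' = 2 ^ m * 2 ^ (m' - m)"
    using assms(2) by (simp flip: power_add)
  then show "real (j * 2 ^ (m' - m)) * (h / 2 ^ m') = real j * (h / 2 ^ m)"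
    by simp
qed

text \<open>On the level \<open>m\<close> grid the number of steps times the mesh is always
  \<open>h\<close>, so the grid bound is uniform in \<open>m\<close> and passes to the increasing
  union.\<close>

lemma emeasure_exit_event:
  assumes h: "0 \<le> h" and r: "0 < r"
  shows "emeasure M (exit_event h r) \<le> ennreal (h * (exit_const * Psi (1 / r)))"
proof -
  define E where "E m = {w\<in>space M. \<exists>j\<le>2 ^ m. r < norm (X (real j * (h / 2 ^ m)) w)}" for m :: nat
  have [measurable]: "X (real j * (h / 2 ^ m)) \<in> borel_measurable M" for j m :: nat
    using h by (intro measurable_X) simp
  have E_sets: "E m \<in> sets M" for m
    unfolding E_def by measurable
  have "incseq E"
  proof (rule incseq_SucI, rule subsetI)
    fix m w assume "w \<in> E m"
    then obtain j where j: "j \<le> 2 ^ m" "r < norm (X (real j * (h / 2 ^ m)) w)" "w \<in> space M"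
      by (auto simp: E_def)
    obtain j' where "j' \<le> 2 ^ Suc m" "real j' * (h / 2 ^ Suc m) = real j * (h / 2 ^ m)"
      using exit_grid_mono[OF j(1), of "Suc m" h] by auto
    then show "w \<in> E (Suc m)"
      using j unfolding E_def by (intro CollectI conjI exI[of _ j']) simp_all
  qed
  have "exit_event h r = (\<Union>m. E m)"
    unfolding exit_event_def E_def by blast
  also have "emeasure M (\<Union>m. E m) = (SUP m. emeasure M (E m))"
    using E_sets \<open>incseq E\<close> by (intro SUP_emeasure_incseq[symmetric]) blast+
  also have "\<dots> \<le> ennreal (h * (exit_const * Psi (1 / r)))"
  proof (rule SUP_least)
    fix m :: nat
    have "emeasure M (E m) \<le> ennreal (real (2 ^ m) * (h / 2 ^ m) * (exit_const * Psi (1 / r)))"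
      unfolding E_def using h r by (intro emeasure_grid_exit) auto
    then show "emeasure M (E m) \<le> ennreal (h * (exit_const * Psi (1 / r)))"
      by simp
  qed
  finally show ?thesis .
qed

text \<open>A path started at \<open>y\<close> reaches the support of \<open>f\<close> only after leaving the ball of radius \<open>r\<close>;
  apply the Markov property at the first dyadic exit time.\<close>

lemma occupation_le:
  fixes f :: "real^'n \<Rightarrow> ennreal"
  assumes h: "0 < h" and [measurable]: "f \<in> borel_measurable borel"
    and far: "\<And>z. norm z \<le> r \<Longrightarrow> f (y + z) = 0"
    and U: "\<And>x. (\<integral>\<^sup>+w. (\<integral>\<^sup>+s\<in>{0..h}. f (x + X s w) \<partial>lborel) \<partial>M) \<le> U"
  shows "(\<integral>\<^sup>+w. (\<integral>\<^sup>+s\<in>{0..h}. f (y + X s w) \<partial>lborel) \<partial>M) \<le> emeasure M (exit_event h r) * U"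
proof -
  interpret LM: pair_sigma_finite lborel M ..
  define Y where "Y s w = X (max 0 s) w" for s w
  have Y_joint: "(\<lambda>(s, w). Y s w) \<in> borel_measurable (borel \<Otimes>\<^sub>M M)"
    unfolding Y_def by (rule measurable_X_joint)
  have [measurable]: "(\<lambda>p. Y (t p) (w p)) \<in> borel_measurable N"
    if "t \<in> borel_measurable N" "w \<in> measurable N M" for t w and N :: "'c measure"
    using measurable_compose[OF measurable_Pair[OF that] Y_joint] by simp
  have XY: "(\<integral>\<^sup>+s\<in>{0..h}. f (x + X s w) \<partial>lborel) = (\<integral>\<^sup>+s\<in>{0..h}. f (x + Y s w) \<partial>lborel)" for x w
    by (intro nn_integral_cong) (auto simp: Y_def indicator_def)
  define \<delta> where "\<delta> m = h / 2 ^ m" for m :: nat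
  have \<delta>: "0 \<le> \<delta> m" for m
    using h by (simp add: \<delta>_def)
  have [measurable]: "X (real j * \<delta> m) \<in> borel_measurable M" for j m :: nat
    using \<delta>[of m] by (intro measurable_X) simp
  \<comment> \<open>An exit is seen on the grid strictly before \<open>s\<close>; the process can
    then be restarted at that grid time.\<close>
  define H where "H m s w \<longleftrightarrow> (\<exists>j\<le>2 ^ m. real j * \<delta> m < s \<and> r < norm (X (real j * \<delta> m) w))" for m s w
  have H_meas [measurable]: "Measurable.pred N (\<lambda>p. H m (t p) (w p))"
    if "t \<in> borel_measurable N" "w \<in> measurable N M" for t w m and N :: "'c measure"
  proof -
    note that [measurable]
    have [measurable]: "(\<lambda>p. X (real j * \<delta> m) (w p)) \<in> borel_measurable N" for j
      by measurable
    show ?thesis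
      unfolding H_def by measurable
  qed
  define I where "I m w = (\<integral>\<^sup>+s\<in>{0..h}. f (y + Y s w) * indicator {s. H m s w} s \<partial>lborel)" for m w
  have H_Suc: "H (Suc m) s w" if "H m s w" for m s w
  proof -
    obtain j where j: "j \<le> 2 ^ m" "real j * \<delta> m < s" "r < norm (X (real j * \<delta> m) w)"
      using \<open>H m s w\<close> by (auto simp: H_def)
    obtain j' where "j' \<le> 2 ^ Suc m" "real j' * \<delta> (Suc m) = real j * \<delta> m"
      using exit_grid_mono[OF j(1), of "Suc m" h] by (auto simp: \<delta>_def)
    then show ?thesis
      using j unfolding H_def by (intro exI[of _ j']) simp
  qed
  have ind_eq: "indicator {s. H m s w} s = (if H m s w then 1 else 0 :: ennreal)" for m s w
    by simp
  have split: "(\<integral>\<^sup>+s\<in>{0..h}. f (y + Y s w) \<partial>lborel) \<le> (SUP m. I m w)" if w: "w \<in> space M" for w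
  proof -
    \<comment> \<open>Times outside the ball that no grid exit precedes. Of two such times the
      earlier would produce a grid exit before the later one, so there is at most one, a null set in
      time.\<close>
    define Z where "Z = {s\<in>{0..h}. r < norm (X s w) \<and> (\<forall>m. \<not> H m s w)}"
    have "s = t" if "s \<in> Z" "t \<in> Z" for s t
      using that grid_exit[OF w, of s t h r] grid_exit[OF w, of t s h r]
      unfolding Z_def H_def \<delta>_def by (cases s t rule: linorder_cases) auto
    then obtain z where z: "Z \<subseteq> {z}"
      by (cases "Z = {}") auto
    have [measurable]: "(\<lambda>s. Y s w) \<in> borel_measurable borel"
      using measurable_Pair1[OF Y_joint w] by simp
    have [measurable]: "Measurable.pred borel (\<lambda>s. H m s w)" for m
      unfolding H_def by measurable
    have "(\<integral>\<^sup>+s\<in>{0..h}. f (y + Y s w) \<partial>lborel) \<le>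
        (\<integral>\<^sup>+s. (SUP m. f (y + Y s w) * indicator {s. H m s w} s * indicator {0..h} s) \<partial>lborel)"
    proof (rule nn_integral_mono_AE)
      show "AE s in lborel. f (y + Y s w) * indicator {0..h} s \<le> (SUP m. f (y + Y s w) * indicator {s. H m s w} s * indicator {0..h} s)"
        using AE_lborel_singleton[of z]
      proof eventually_elim
        case (elim s)
        show ?case
        proof (cases "s \<in> {0..h} \<and> f (y + Y s w) \<noteq> 0")
          case True
          then have "r < norm (X s w)"
            using far[of "X s w"] by (fastforce simp: Y_def)
          moreover have "s \<notin> Z"
            using elim z by auto
          ultimately obtain m where "H m s w"
            using True by (auto simp: Z_def)
          then have "f (y + Y s w) * indicator {0..h} s = f (y + Y s w) * indicator {s. H m s w} s * indicator {0..h} s"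
            by simp
          then show ?thesis
            by (simp only:) (rule SUP_upper, simp)
        qed auto
      qed
    qed
    also have "\<dots> = (SUP m. I m w)"
      unfolding I_def
    proof (rule nn_integral_monotone_convergence_SUP)
      show "incseq (\<lambda>m s. f (y + Y s w) * indicator {s. H m s w} s * indicator {0..h} s)"
        using H_Suc by (intro incseq_SucI le_funI mult_right_mono mult_left_mono) (auto simp: indicator_def)
    qed (simp only: ind_eq, measurable)
    finally show ?thesis .
  qed
  have I_meas [measurable]: "I m \<in> borel_measurable M" for m
    unfolding I_def ind_eq by measurable
  have "(\<integral>\<^sup>+w. (\<integral>\<^sup>+s\<in>{0..h}. f (y + X s w) \<partial>lborel) \<partial>M) \<le> (\<integral>\<^sup>+w. (SUP m. I m w) \<partial>M)"
    unfolding XY by (intro nn_integral_mono split)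
  also have "\<dots> = (SUP m. \<integral>\<^sup>+w. I m w \<partial>M)"
  proof (rule nn_integral_monotone_convergence_SUP)
    show "incseq I"
      unfolding I_def using H_Suc
      by (intro incseq_SucI le_funI nn_integral_mono mult_right_mono mult_left_mono) (auto simp: indicator_def)
  qed simp
  also have "\<dots> \<le> emeasure M (exit_event h r) * U"
  proof (rule SUP_least)
    fix m :: nat
    \<comment> \<open>Inside the ball before index \<open>j\<close> and outside at \<open>j\<close>:
      the event \<open>E j\<close> says that the first grid exit has index \<open>j\<close>, so
      these events are disjoint and their probabilities add up to at most that of the exit
      event.\<close>
    define B where "B j i = (if i < j then cball 0 r else - cball (0::real^'n) r)" for i j :: nat
    have [measurable]: "B j i \<in> sets borel" for i j
      by (auto simp: B_def)
    define E where "E j = {w. \<forall>i\<le>j. X (real i * \<delta> m) w \<in> B j i}" for j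
    have E_meas: "E j \<inter> space M \<in> sets M" for j
    proof -
      have "E j \<inter> space M = {w\<in>space M. \<forall>i\<le>j. X (real i * \<delta> m) w \<in> B j i}"
        by (auto simp: E_def)
      also have "\<dots> \<in> sets M"
        by measurable
      finally show ?thesis .
    qed
    have [measurable]: "(\<lambda>w. indicator (E j) w :: ennreal) \<in> borel_measurable M" for j
      using E_meas by (simp add: borel_measurable_indicator_iff)
    let ?T = "\<lambda>j s w. f (y + Y s w) * indicator (E j) w * indicator {real j * \<delta> m<..h} s"
    have E_least: "\<exists>j\<le>2 ^ m. real j * \<delta> m < s \<and> w \<in> E j" if "H m s w" for s w
    proof -
      let ?P = "\<lambda>j. r < norm (X (real j * \<delta> m) w)"
      obtain i where i: "i \<le> 2 ^ m" "real i * \<delta> m < s" "?P i"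
        using \<open>H m s w\<close> by (auto simp: H_def)
      define j where "j = (LEAST j. ?P j)"
      have j: "?P j" "j \<le> i"
        unfolding j_def using i(3) by (rule LeastI, rule Least_le)
      have "\<not> ?P k" if "k < j" for k
        using that unfolding j_def by (rule not_less_Least)
      then have "w \<in> E j"
        using j by (auto simp: E_def B_def not_less order.order_iff_strict)
      moreover have "real j * \<delta> m \<le> real i * \<delta> m"
        using j \<delta>[of m] by (intro mult_right_mono) auto
      ultimately show ?thesis
        using i j by (intro exI[of _ j]) auto
    qed
    have "(\<integral>\<^sup>+w. I m w \<partial>M) \<le> (\<integral>\<^sup>+w. (\<Sum>j\<le>2 ^ m. \<integral>\<^sup>+s. ?T j s w \<partial>lborel) \<partial>M)"
    proof (rule nn_integral_mono)
      fix w assume w: "w \<in> space M"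
      have [measurable]: "(\<lambda>s. Y s w) \<in> borel_measurable borel"
        using measurable_Pair1[OF Y_joint w] by simp
      have "I m w \<le> (\<integral>\<^sup>+s. (\<Sum>j\<le>2 ^ m. ?T j s w) \<partial>lborel)"
        unfolding I_def
      proof (rule nn_integral_mono)
        fix s
        show "f (y + Y s w) * indicator {s. H m s w} s * indicator {0..h} s
            \<le> (\<Sum>j\<le>2 ^ m. ?T j s w)"
        proof (cases "H m s w \<and> s \<in> {0..h}")
          case True
          then obtain j where j: "j \<le> 2 ^ m" "real j * \<delta> m < s" "w \<in> E j"
            using E_least by blast
          have "f (y + Y s w) * indicator {s. H m s w} s * indicator {0..h} s =
              ?T j s w"
            using True j by simp
          also have "\<dots> \<le> (\<Sum>j\<le>2 ^ m. ?T j s w)"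
            using j by (intro member_le_sum) auto
          finally show ?thesis .
        qed auto
      qed
      also have "\<dots> = (\<Sum>j\<le>2 ^ m. \<integral>\<^sup>+s. ?T j s w \<partial>lborel)"
        by (rule nn_integral_sum) measurable
      finally show "I m w \<le> (\<Sum>j\<le>2 ^ m. \<integral>\<^sup>+s. ?T j s w \<partial>lborel)" .
    qed
    also have "\<dots> = (\<Sum>j\<le>2 ^ m. \<integral>\<^sup>+w. (\<integral>\<^sup>+s. ?T j s w \<partial>lborel) \<partial>M)"
      by (rule nn_integral_sum) measurable
    also have "\<dots> \<le> (\<Sum>j\<le>2 ^ m. emeasure M (E j \<inter> space M) * U)"
    proof (rule sum_mono)
      fix j :: nat
      let ?t = "real j * \<delta> m"
      have "(\<integral>\<^sup>+w. (\<integral>\<^sup>+s. ?T j s w \<partial>lborel) \<partial>M) =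
          (\<integral>\<^sup>+s. (\<integral>\<^sup>+w. ?T j s w \<partial>M) \<partial>lborel)"
        by (rule LM.Fubini'[where f="\<lambda>s w. ?T j s w"]) measurable
      also have "\<dots> = (\<integral>\<^sup>+s. (\<integral>\<^sup>+w. (\<integral>\<^sup>+w'. f (y + X ?t w + Y (s - ?t) w') \<partial>M) * indicator (E j) w * indicator {?t<..h} s \<partial>M) \<partial>lborel)"
      proof (rule nn_integral_cong)
        fix s :: real
        show "(\<integral>\<^sup>+w. ?T j s w \<partial>M) =
          (\<integral>\<^sup>+w. (\<integral>\<^sup>+w'. f (y + X ?t w + Y (s - ?t) w') \<partial>M) * indicator (E j) w * indicator {?t<..h} s \<partial>M)"
        proof (cases "s \<in> {?t<..h}")
          case True
          moreover have "0 \<le> ?t"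
            using \<delta>[of m] by simp
          ultimately have s: "max 0 s = s" "max 0 (s - ?t) = s - ?t" "?t \<le> s"
            by auto
          have "(\<integral>\<^sup>+w\<in>E j. f (y + X s w) \<partial>M) = (\<integral>\<^sup>+w\<in>E j. (\<integral>\<^sup>+w'. f (y + (X ?t w + X (s - ?t) w')) \<partial>M) \<partial>M)"
            unfolding E_def using s by (intro grid_markov[where f="\<lambda>x. f (y + x)"] \<delta>) auto
          then show ?thesis
            using True s by (simp add: Y_def add.assoc)
        qed simp
      qed
      also have "\<dots> = (\<integral>\<^sup>+w. (\<integral>\<^sup>+s. (\<integral>\<^sup>+w'. f (y + X ?t w + Y (s - ?t) w') \<partial>M) * indicator (E j) w * indicator {?t<..h} s \<partial>lborel) \<partial>M)"
        by (rule LM.Fubini'[symmetric, where f="\<lambda>s w. (\<integral>\<^sup>+w'. f (y + X ?t w + Y (s - ?t) w') \<partial>M) * indicator (E j) w * indicator {?t<..h} s"]) measurable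
      also have "\<dots> \<le> (\<integral>\<^sup>+w. U * indicator (E j \<inter> space M) w \<partial>M)"
      proof (rule nn_integral_mono)
        fix w assume w: "w \<in> space M"
        let ?x = "y + X ?t w"
        \<comment> \<open>After the restart a time below \<open>h\<close> remains; since the
          integrand is nonnegative the horizon is enlarged to all of \<open>[0, h]\<close>, where
          \<open>U\<close> applies.\<close>
        define g where "g s = (\<integral>\<^sup>+w'. f (?x + Y s w') \<partial>M) * indicator {0..h} s" for s
        have [measurable]: "g \<in> borel_measurable borel"
          unfolding g_def by measurable
        have "0 \<le> ?t"
          using \<delta>[of m] by simp
        have "(\<integral>\<^sup>+s. (\<integral>\<^sup>+w'. f (?x + Y (s - ?t) w') \<partial>M) * indicator (E j) w * indicator {?t<..h} s \<partial>lborel)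
            \<le> (\<integral>\<^sup>+s. g (- ?t + s) * indicator (E j) w \<partial>lborel)"
          using \<open>0 \<le> ?t\<close> by (intro nn_integral_mono) (auto simp: g_def indicator_def)
        also have "\<dots> = (\<integral>\<^sup>+s. g (- ?t + s) \<partial>lborel) * indicator (E j) w"
          by (rule nn_integral_multc) measurable
        also have "(\<integral>\<^sup>+s. g (- ?t + s) \<partial>lborel) = (\<integral>\<^sup>+s. g s \<partial>lborel)"
          by (rule nn_integral_lborel_shift) measurable
        also have "(\<integral>\<^sup>+s. g s \<partial>lborel) = (\<integral>\<^sup>+s. (\<integral>\<^sup>+w'. f (?x + Y s w') * indicator {0..h} s \<partial>M) \<partial>lborel)"
          unfolding g_def by (simp add: nn_integral_multc)
        also have "\<dots> = (\<integral>\<^sup>+w'. (\<integral>\<^sup>+s. f (?x + Y s w') * indicator {0..h} s \<partial>lborel) \<partial>M)"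
          by (rule LM.Fubini'[symmetric, where f="\<lambda>s w'. f (?x + Y s w') * indicator {0..h} s"]) measurable
        also have "\<dots> \<le> U"
          using U[of ?x] unfolding XY .
        finally show "(\<integral>\<^sup>+s. (\<integral>\<^sup>+w'. f (?x + Y (s - ?t) w') \<partial>M) * indicator (E j) w * indicator {?t<..h} s \<partial>lborel)
            \<le> U * indicator (E j \<inter> space M) w"
          using w by (auto simp: indicator_def)
      qed
      also have "\<dots> = emeasure M (E j \<inter> space M) * U"
        using E_meas by (subst nn_integral_cmult_indicator) (auto simp: mult.commute)
      finally show "(\<integral>\<^sup>+w. (\<integral>\<^sup>+s. ?T j s w \<partial>lborel) \<partial>M)
          \<le> emeasure M (E j \<inter> space M) * U" .
    qed
    also have "\<dots> = (\<Sum>j\<le>2 ^ m. emeasure M (E j \<inter> space M)) * U"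
      by (simp add: sum_distrib_right)
    also have "(\<Sum>j\<le>2 ^ m. emeasure M (E j \<inter> space M)) = emeasure M (\<Union>j\<le>2 ^ m. E j \<inter> space M)"
    proof (rule sum_emeasure)
      have "E i \<inter> E j = {}" if "i < j" for i j
        using that by (auto simp: E_def B_def)
      then show "disjoint_family_on (\<lambda>j. E j \<inter> space M) {..2 ^ m}"
        unfolding disjoint_family_on_def by (metis (no_types, lifting) Int_assoc Int_commute Int_empty_left linorder_neqE_nat)
    qed (use E_meas in auto)
    also have "emeasure M (\<Union>j\<le>2 ^ m. E j \<inter> space M) \<le> emeasure M (exit_event h r)"
    proof (intro emeasure_mono sets_exit_event subsetI)
      fix w assume "w \<in> (\<Union>j\<le>2 ^ m. E j \<inter> space M)"
      then obtain j where j: "j \<le> 2 ^ m" "w \<in> E j" "w \<in> space M"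
        by blast
      then have "X (real j * \<delta> m) w \<in> B j j"
        unfolding E_def by blast
      then have "r < norm (X (real j * (h / 2 ^ m)) w)"
        by (simp add: B_def \<delta>_def)
      then show "w \<in> exit_event h r"
        using j unfolding exit_event_def by blast
    qed (use h in simp)
    finally show "(\<integral>\<^sup>+w. I m w \<partial>M) \<le> emeasure M (exit_event h r) * U"
      by (simp add: mult_right_mono)
  qed
  finally show ?thesis .
qed

end

section \<open>Jumps into the centre\<close>

lemma continuous_bounded_on_cball:
  fixes \<phi> :: "real^'n \<Rightarrow> real"
  assumes "continuous_on UNIV \<phi>"
  shows "\<exists>C>0. \<forall>x\<in>cball 0 r. \<bar>\<phi> x\<bar> \<le> C"
proof -
  have "bounded (\<phi> ` cball 0 r)"
    by (intro compact_imp_bounded compact_continuous_image continuous_on_subset[OF assms]) auto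
  then show ?thesis
    unfolding bounded_pos by auto
qed

lemma integrable_on_ball:
  fixes \<phi> :: "real^'n \<Rightarrow> real"
  assumes [measurable]: "\<phi> \<in> borel_measurable borel" and C: "\<And>x. x \<in> ball 0 r \<Longrightarrow> \<bar>\<phi> x\<bar> \<le> C"
  shows "integrable lborel (\<lambda>z. \<phi> z * indicator (ball 0 r) z)"
proof (rule integrableI_bounded_set[where A="ball 0 r" and B=C])
  show "emeasure lborel (ball (0::real^'n) r) < \<infinity>"
    by (rule emeasure_lborel_ball_finite)
  have [measurable]: "ball (0::real^'n) r \<in> sets borel"
    by simp
  show "(\<lambda>z. \<phi> z * indicator (ball 0 r) z) \<in> borel_measurable lborel"
    by measurable
qed (use C in auto)

section \<open>Mollified test functions and the jump rate into the centre\<close>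

context symmetric_levy_process
begin

definition mollify :: "real \<Rightarrow> (real^'n \<Rightarrow> real) \<Rightarrow> real^'n \<Rightarrow> real" where
  "mollify \<sigma> F u = (LINT z|lborel. F z * gauss \<sigma> (u - z))"

lemma gauss_reflect:
  assumes "0 < \<sigma>"
  shows "integrable lborel (\<lambda>z::real^'n. gauss \<sigma> (u - z))" "(LINT z|lborel. gauss \<sigma> (u - z::real^'n)) = 1"
    "integrable lborel (\<lambda>z::real^'n. gauss \<sigma> (u - z) * indicator {z. \<delta> \<le> norm (u - z)} z)"
    "0 < \<delta> \<Longrightarrow> (LINT z|lborel. gauss \<sigma> (u - z) * indicator {z::real^'n. \<delta> \<le> norm (u - z)} z) \<le> real CARD('n) * \<sigma>\<^sup>2 / \<delta>\<^sup>2"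
proof -
  show i: "integrable lborel (\<lambda>z::real^'n. gauss \<sigma> (u - z))"
    using assms by (simp add: lborel_integrable_reflect)
  show "(LINT z|lborel. gauss \<sigma> (u - z::real^'n)) = 1"
    using assms by (simp add: lborel_integral_reflect)
  show "integrable lborel (\<lambda>z::real^'n. gauss \<sigma> (u - z) * indicator {z. \<delta> \<le> norm (u - z)} z)"
    by (rule integrable_real_mult_indicator[OF _ i]) measurable
  assume \<delta>: "0 < \<delta>"
  have "(LINT z|lborel. gauss \<sigma> (u - z) * indicator {z::real^'n. \<delta> \<le> norm (u - z)} z) =
      (LINT z|lborel. (\<lambda>z. gauss \<sigma> z * indicator {z. \<delta> \<le> norm z} z) (u - z))"
    by (simp add: indicator_def)
  also have "\<dots> = (LINT z:{z::real^'n. \<delta> \<le> norm z}|lborel. gauss \<sigma> z)"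
    unfolding set_lebesgue_integral_def by (subst lborel_integral_reflect) (auto simp: mult.commute)
  also have "\<dots> \<le> real CARD('n) * \<sigma>\<^sup>2 / \<delta>\<^sup>2"
    using gauss_tail[OF assms \<delta>, where 'a="real^'n"] by simp
  finally show "(LINT z|lborel. gauss \<sigma> (u - z) * indicator {z::real^'n. \<delta> \<le> norm (u - z)} z) \<le> real CARD('n) * \<sigma>\<^sup>2 / \<delta>\<^sup>2" .
qed

lemma gauss_le:
  assumes "0 < \<sigma>"
  shows "gauss \<sigma> (u::real^'n) \<le> (1 / (sqrt (2 * pi) * \<sigma>)) ^ CARD('n)"
  using assms by (simp add: gauss_eq mult_left_le)

lemma mollify_integrable:
  fixes F :: "real^'n \<Rightarrow> real"
  assumes "0 < \<sigma>" "integrable lborel F"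
  shows "integrable lborel (\<lambda>z. F z * gauss \<sigma> (u - z))"
proof (rule Bochner_Integration.integrable_bound[OF integrable_mult_left[OF assms(2), of "(1 / (sqrt (2 * pi) * \<sigma>)) ^ CARD('n)"]])
  show "AE z in lborel. norm (F z * gauss \<sigma> (u - z)) \<le> norm (F z * (1 / (sqrt (2 * pi) * \<sigma>)) ^ CARD('n))"
    using assms(1) gauss_le[OF assms(1)] by (intro AE_I2) (auto simp: abs_mult intro!: mult_left_mono)
qed (use borel_measurable_integrable[OF assms(2)] in measurable)

text \<open>Writing the mollifying Gaussian as a mixture of cosines makes the convolution a mixture
  over pairs \<open>(z, \<xi>)\<close>. The Gaussian weight in \<open>\<xi>\<close> has the moments
  that the expansion requires, whatever the regularity of \<open>F\<close>.\<close>

lemma mollify_generator_ge: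
  assumes \<sigma>: "0 < \<sigma>" and F: "integrable lborel F" "\<And>z. 0 \<le> F z"
  shows "\<exists>C\<ge>0. \<forall>h\<ge>0. \<forall>y. h * (LINT z|lborel. (1 - cos (a \<bullet> z)) * mollify \<sigma> F (y + z) * nu z) - h\<^sup>2 * C
    \<le> expectation (\<lambda>w. (1 - cos (a \<bullet> X h w)) * mollify \<sigma> F (y + X h w))"
proof -
  have [measurable]: "F \<in> borel_measurable borel"
    using borel_measurable_integrable[OF F(1)] by simp
  define \<kappa> where "\<kappa> = (1 / (sqrt (2 * pi) * \<sigma>)) ^ CARD('n)"
  have \<kappa>: "0 \<le> \<kappa>"
    using \<sigma> by (simp add: \<kappa>_def)
  define m where "m p = \<kappa> * F (fst p) * gauss 1 (snd p)" for p :: "(real^'n) \<times> (real^'n)"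
  define freq where "freq p = snd p /\<^sub>R \<sigma>" for p :: "(real^'n) \<times> (real^'n)"
  define phase where "phase p = - (snd p \<bullet> (fst p /\<^sub>R \<sigma>))" for p :: "(real^'n) \<times> (real^'n)"
  have prod_int: "integrable (lborel \<Otimes>\<^sub>M lborel) (\<lambda>p. F (fst p) * g (snd p))"
    if g: "integrable lborel g" for g :: "real^'n \<Rightarrow> real"
  proof -
    have [measurable]: "g \<in> borel_measurable borel"
      using borel_measurable_integrable[OF g] by simp
    show ?thesis
    proof (rule lborel_pair.Fubini_integrable)
      show "integrable lborel (\<lambda>x. LINT y|lborel. norm (F (fst (x, y)) * g (snd (x, y))))"
        using F(1) by (simp add: abs_mult)
      show "AE x in lborel. integrable lborel (\<lambda>y. F (fst (x, y)) * g (snd (x, y)))"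
        using g by (intro AE_I2) simp
    qed measurable
  qed
  have mm: "integrable (lborel \<Otimes>\<^sub>M lborel) (\<lambda>p. m p * (1 + (norm (freq p))\<^sup>2)\<^sup>2)"
  proof (rule Bochner_Integration.integrable_bound)
    let ?c = "\<kappa> * (1 + 1 / \<sigma>\<^sup>2)\<^sup>2"
    show "integrable (lborel \<Otimes>\<^sub>M lborel) (\<lambda>p::(real^'n) \<times> (real^'n). ?c * (F (fst p) * (gauss 1 (snd p) * (1 + (norm (snd p))\<^sup>2)\<^sup>2)))"
      by (intro integrable_mult_right prod_int[OF integrable_gauss_fourth])
    show "AE p in lborel \<Otimes>\<^sub>M lborel. norm (m p * (1 + (norm (freq p))\<^sup>2)\<^sup>2)
      \<le> norm (?c * (F (fst p) * (gauss 1 (snd p) * (1 + (norm (snd p))\<^sup>2)\<^sup>2)))"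
    proof (rule AE_I2)
      fix p :: "(real^'n) \<times> (real^'n)"
      have "1 + (norm (freq p))\<^sup>2 = 1 + (norm (snd p))\<^sup>2 / \<sigma>\<^sup>2"
        using \<sigma> by (simp add: freq_def power_mult_distrib divide_inverse power_inverse mult.commute)
      also have "\<dots> \<le> (1 + 1 / \<sigma>\<^sup>2) * (1 + (norm (snd p))\<^sup>2)"
        by (simp add: algebra_simps)
      finally have "(1 + (norm (freq p))\<^sup>2)\<^sup>2 \<le> ((1 + 1 / \<sigma>\<^sup>2) * (1 + (norm (snd p))\<^sup>2))\<^sup>2"
        by (rule power_mono) simp
      then have "m p * (1 + (norm (freq p))\<^sup>2)\<^sup>2 \<le> m p * ((1 + 1 / \<sigma>\<^sup>2)\<^sup>2 * (1 + (norm (snd p))\<^sup>2)\<^sup>2)"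
        unfolding power_mult_distrib using \<kappa> F(2) by (intro mult_left_mono) (simp_all add: m_def)
      then show "norm (m p * (1 + (norm (freq p))\<^sup>2)\<^sup>2)
          \<le> norm (?c * (F (fst p) * (gauss 1 (snd p) * (1 + (norm (snd p))\<^sup>2)\<^sup>2)))"
        using \<kappa> F(2) by (simp add: m_def abs_mult mult_ac)
    qed
  qed (simp only: m_def freq_def, measurable)
  have eq: "mollify \<sigma> F u = (LINT p|(lborel \<Otimes>\<^sub>M lborel). m p * cos (freq p \<bullet> u + phase p))" for u
  proof -
    have c: "cos (freq (z, \<xi>) \<bullet> u + phase (z, \<xi>)) = cos (\<xi> \<bullet> ((u - z) /\<^sub>R \<sigma>))" for z \<xi>
      by (simp add: freq_def phase_def inner_diff_right right_diff_distrib)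
    have g: "gauss \<sigma> (u - z) = \<kappa> * (LINT \<xi>|lborel. gauss 1 \<xi> * cos (\<xi> \<bullet> ((u - z) /\<^sub>R \<sigma>)))" for z
    proof -
      have n: "(norm ((u - z) /\<^sub>R \<sigma>))\<^sup>2 = (norm (u - z))\<^sup>2 / \<sigma>\<^sup>2"
        using \<sigma> by (simp add: power_mult_distrib divide_inverse power_inverse mult.commute)
      show ?thesis
        unfolding gauss_fourier gauss_eq[OF \<sigma>] \<kappa>_def n by simp
    qed
    have "integrable (lborel \<Otimes>\<^sub>M lborel) (\<lambda>(z, \<xi>). m (z, \<xi>) * cos (freq (z, \<xi>) \<bullet> u + phase (z, \<xi>)))"
    proof (rule Bochner_Integration.integrable_bound[OF mm])
      have "\<bar>m p\<bar> * \<bar>cos t\<bar> \<le> \<bar>m p\<bar> * (1 + (norm (freq p))\<^sup>2)\<^sup>2" for p t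
      proof (rule mult_left_mono)
        have "1 \<le> (1 + (norm (freq p))\<^sup>2)\<^sup>2"
          by (rule one_le_power) simp
        then show "\<bar>cos t\<bar> \<le> (1 + (norm (freq p))\<^sup>2)\<^sup>2"
          by (rule order_trans[OF abs_cos_le_one])
      qed simp
      then show "AE p in lborel \<Otimes>\<^sub>M lborel. norm (case p of (z, \<xi>) \<Rightarrow> m (z, \<xi>) * cos (freq (z, \<xi>) \<bullet> u + phase (z, \<xi>)))
        \<le> norm (m p * (1 + (norm (freq p))\<^sup>2)\<^sup>2)"
        by (intro AE_I2) (simp add: abs_mult case_prod_unfold)
    qed (simp only: m_def freq_def phase_def, measurable)
    from lborel_pair.integral_fst[OF this]
    have "(LINT p|(lborel \<Otimes>\<^sub>M lborel). m p * cos (freq p \<bullet> u + phase p)) =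
        (LINT z|lborel. LINT \<xi>|lborel. m (z, \<xi>) * cos (freq (z, \<xi>) \<bullet> u + phase (z, \<xi>)))"
      by (simp add: case_prod_unfold)
    also have "\<dots> = (LINT z|lborel. LINT \<xi>|lborel. (\<kappa> * F z) * (gauss 1 \<xi> * cos (\<xi> \<bullet> ((u - z) /\<^sub>R \<sigma>))))"
      unfolding c by (simp only: m_def fst_conv snd_conv mult.assoc)
    also have "\<dots> = (LINT z|lborel. F z * gauss \<sigma> (u - z))"
      unfolding integral_mult_right_zero g by (simp only: mult_ac)
    finally show ?thesis
      unfolding mollify_def ..
  qed
  show ?thesis
  proof (rule mixture_generator_ge[OF _ _ mm _ _ _ eq])
    show "sigma_finite_measure (lborel \<Otimes>\<^sub>M lborel :: ((real^'n) \<times> (real^'n)) measure)"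
      by (rule lborel_pair.sigma_finite_measure_axioms)
    show "0 \<le> m p" for p
      using \<kappa> F(2) by (simp add: m_def)
    show "0 \<le> mollify \<sigma> F u" for u
      unfolding mollify_def using F(2) by (intro integral_nonneg_AE AE_I2) simp
  qed (simp_all only: m_def freq_def phase_def, measurable)
qed

text \<open>Two requirements compete: the mollification must stay below \<open>\<phi>\<close> on a
  larger ball up to a small error, so that a bound for it passes to \<open>\<phi>\<close>, and it
  must keep most of its mass there. Doubling the radius makes room for the cut of \<open>F\<close>
  at radius \<open>\<rho>\<close>.\<close>

lemma mollify_approx:
  fixes \<phi> :: "real^'n \<Rightarrow> real"
  assumes cont: "continuous_on UNIV \<phi>" and pos: "\<And>x. 0 < \<phi> x" and \<rho>: "0 < \<rho>" and \<epsilon>: "0 < \<epsilon>"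
  defines "F \<equiv> \<lambda>z. \<phi> z * indicator (ball 0 \<rho>) z"
  shows "\<exists>\<sigma>>0. (\<forall>u. mollify \<sigma> F u \<le> \<phi> u * indicator (ball 0 (2 * \<rho>)) u + \<epsilon>) \<and>
    3 / 4 * (LINT z|lborel. F z) \<le> (LINT u|lborel. mollify \<sigma> F u * indicator (ball 0 (2 * \<rho>)) u)"
proof -
  have [measurable]: "\<phi> \<in> borel_measurable borel"
    using cont by (rule borel_measurable_continuous_onI)
  have [measurable]: "ball (0::real^'n) r \<in> sets borel" for r
    by simp
  have [measurable]: "F \<in> borel_measurable borel"
    unfolding F_def by measurable
  obtain C where C: "0 < C" "\<And>x. x \<in> cball 0 (2 * \<rho>) \<Longrightarrow> \<phi> x \<le> C"
    using continuous_bounded_on_cball[OF cont, of "2 * \<rho>"] by (auto simp: abs_le_iff)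
  have F: "0 \<le> F z" "F z \<le> C" for z
    using pos[of z] C(2)[of z] C(1) \<rho> by (auto simp: F_def indicator_def)
  have F_int: "integrable lborel F"
    unfolding F_def
  proof (rule integrable_on_ball)
    show "\<bar>\<phi> z\<bar> \<le> C" if "z \<in> ball 0 \<rho>" for z
      using F[of z] that by (simp add: F_def)
  qed measurable
  obtain \<delta>' where \<delta>': "0 < \<delta>'"
    "\<And>u v. u \<in> cball 0 (2 * \<rho>) \<Longrightarrow> v \<in> cball 0 (2 * \<rho>) \<Longrightarrow> dist u v < \<delta>' \<Longrightarrow> dist (\<phi> u) (\<phi> v) < \<epsilon> / 2"
    using compact_uniformly_continuous[OF continuous_on_subset[OF cont], of "cball 0 (2 * \<rho>)"] \<epsilon>
    unfolding uniformly_continuous_on_def by (metis compact_cball half_gt_zero subset_UNIV)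
  define \<delta> where "\<delta> = min \<delta>' \<rho>"
  have \<delta>: "0 < \<delta>" "\<delta> \<le> \<delta>'" "\<delta> \<le> \<rho>"
    using \<delta>'(1) \<rho> by (auto simp: \<delta>_def)
  \<comment> \<open>Admissible Gaussian mass beyond distance \<open>\<delta>\<close>: small enough
    that it costs at most \<open>\<epsilon> / 2\<close> against the bound \<open>C\<close>, and at
    most the quarter of the mass that may be lost. The width \<open>\<sigma>\<close> makes the
    Chebyshev bound equal to it.\<close>
  define \<tau> where "\<tau> = min (\<epsilon> / (2 * C)) (1 / 4)"
  have \<tau>: "0 < \<tau>" "\<tau> \<le> 1 / 4" "C * \<tau> \<le> \<epsilon> / 2"
    using C \<epsilon> by (auto simp: \<tau>_def min_def field_simps)
  define \<sigma> where "\<sigma> = sqrt (\<tau> * \<delta>\<^sup>2 / real CARD('n))"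
  have \<sigma>: "0 < \<sigma>" and \<sigma>2: "real CARD('n) * \<sigma>\<^sup>2 / \<delta>\<^sup>2 = \<tau>"
    using \<tau> \<delta> by (simp_all add: \<sigma>_def)
  note g = gauss_reflect[OF \<sigma>]
  have tail: "(LINT z|lborel. gauss \<sigma> (u - z) * indicator {z::real^'n. \<delta> \<le> norm (u - z)} z) \<le> \<tau>" for u
    using g(4)[OF \<delta>(1), of u] unfolding \<sigma>2 .
  have mollify_nonneg: "0 \<le> mollify \<sigma> F u" for u
    unfolding mollify_def using F by (intro integral_nonneg_AE AE_I2) simp
  have le: "mollify \<sigma> F u \<le> \<phi> u * indicator (ball 0 (2 * \<rho>)) u + \<epsilon>" for u
  proof -
    let ?a = "\<phi> u * indicator (ball 0 (2 * \<rho>)) u + \<epsilon> / 2"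
    have "mollify \<sigma> F u \<le> (LINT z|lborel. ?a * gauss \<sigma> (u - z) + C * (gauss \<sigma> (u - z) * indicator {z. \<delta> \<le> norm (u - z)} z))"
      unfolding mollify_def
    proof (rule integral_mono)
      show "integrable lborel (\<lambda>z. F z * gauss \<sigma> (u - z))"
        by (rule mollify_integrable[OF \<sigma> F_int])
      show "integrable lborel (\<lambda>z. ?a * gauss \<sigma> (u - z) + C * (gauss \<sigma> (u - z) * indicator {z. \<delta> \<le> norm (u - z)} z))"
        by (intro Bochner_Integration.integrable_add integrable_mult_right g)
      fix z
      have "F z \<le> ?a + C * indicator {z. \<delta> \<le> norm (u - z)} z"
      \<comment> \<open>Nearby points are handled by uniform continuity; otherwise
        \<open>F z\<close> vanishes or the tail term pays for it.\<close>
      proof (cases "z \<in> ball 0 \<rho> \<and> norm (u - z) < \<delta>")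
        case True
        have "norm u \<le> norm (u - z) + norm z"
          using norm_triangle_ineq[of "u - z" z] by simp
        then have u: "norm u < 2 * \<rho>"
          using True \<delta> by simp
        then have "dist (\<phi> z) (\<phi> u) < \<epsilon> / 2"
          using True \<delta> \<rho> by (intro \<delta>'(2)) (auto simp: dist_norm norm_minus_commute)
        then have "\<phi> z \<le> \<phi> u + \<epsilon> / 2"
          unfolding dist_real_def by linarith
        then show ?thesis
          using u True by (simp add: F_def)
      next
        case False
        have "0 \<le> ?a"
          using pos[of u] \<epsilon> by (simp add: indicator_def)
        then show ?thesis
          using False F(2)[of z] C(1) by (auto simp: F_def indicator_def not_less split: if_splits)
      qed
      from mult_right_mono[OF this gauss_nonneg[of \<sigma> "u - z"]]
      show "F z * gauss \<sigma> (u - z) \<le> ?a * gauss \<sigma> (u - z) + C * (gauss \<sigma> (u - z) * indicator {z. \<delta> \<le> norm (u - z)} z)"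
        by (simp add: algebra_simps)
    qed
    also have "\<dots> = ?a + C * (LINT z|lborel. gauss \<sigma> (u - z) * indicator {z. \<delta> \<le> norm (u - z)} z)"
      by (subst Bochner_Integration.integral_add[OF integrable_mult_right[OF g(1)] integrable_mult_right[OF g(3)]])
         (simp add: g(2))
    also have "\<dots> \<le> ?a + C * \<tau>"
      using C(1) by (intro add_left_mono mult_left_mono tail) simp
    also have "\<dots> \<le> \<phi> u * indicator (ball 0 (2 * \<rho>)) u + \<epsilon>"
      using \<tau>(3) by simp
    finally show ?thesis .
  qed
  \<comment> \<open>Lebesgue measure on the larger ball, finite so that mixture and integral may be
    exchanged.\<close>
  define N where "N = density lborel (indicator (ball (0::real^'n) (2 * \<rho>)))"
  have [measurable_cong]: "sets N = sets borel"
    by (simp add: N_def)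
  interpret N: finite_measure N
    by standard (use emeasure_lborel_ball_finite[of "0::real^'n" "2 * \<rho>"] in \<open>auto simp: N_def emeasure_density\<close>)
  have N_int: "(LINT u|N. k u) = (LINT u|lborel. k u * indicator (ball 0 (2 * \<rho>)) u)"
    if [measurable]: "k \<in> borel_measurable borel" for k :: "real^'n \<Rightarrow> real"
  proof -
    have "N = density lborel (\<lambda>u. ennreal (indicator (ball (0::real^'n) (2 * \<rho>)) u))"
      by (simp add: N_def ennreal_indicator)
    then show ?thesis
      by (simp only:) (subst integral_density, auto simp: mult.commute)
  qed
  have [measurable]: "mollify \<sigma> F \<in> borel_measurable borel"
    unfolding mollify_def[abs_def] by measurable
  have mass: "3 / 4 * (LINT z|lborel. F z) \<le> (LINT u|lborel. mollify \<sigma> F u * indicator (ball 0 (2 * \<rho>)) u)"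
  proof -
    let ?G = "\<lambda>z. LINT u|N. gauss \<sigma> (u - z)"
    have bd: "\<bar>gauss \<sigma> (u - z)\<bar> \<le> (1 / (sqrt (2 * pi) * \<sigma>)) ^ CARD('n)" for u z :: "real^'n"
      using gauss_le[OF \<sigma>] by simp
    have "3 / 4 * (LINT z|lborel. F z) = (LINT z|lborel. F z * (3 / 4))"
      by simp
    also have "\<dots> \<le> (LINT z|lborel. F z * ?G z)"
    proof (rule integral_mono)
      show "integrable lborel (\<lambda>z. F z * ?G z)"
      proof (rule Bochner_Integration.integrable_bound[OF F_int])
        have "0 \<le> ?G z" "?G z \<le> 1" for z
        proof -
          show "0 \<le> ?G z"
            by (intro integral_nonneg_AE AE_I2) simp
          have "?G z \<le> (LINT u|lborel. gauss \<sigma> (z - u))"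
          proof (subst N_int, measurable, rule integral_mono)
            have *: "gauss \<sigma> (u - z) = gauss \<sigma> (z - u)" for u
              using gauss_minus[of \<sigma> "z - u"] by simp
            show "integrable lborel (\<lambda>u. gauss \<sigma> (u - z) * indicator (ball 0 (2 * \<rho>)) u)"
              unfolding * by (rule integrable_real_mult_indicator[OF _ g(1)]) simp
            show "gauss \<sigma> (u - z) * indicator (ball 0 (2 * \<rho>)) u \<le> gauss \<sigma> (z - u)" for u
              unfolding * by (simp add: indicator_def)
          qed (rule g)
          then show "?G z \<le> 1"
            by (simp add: g(2))
        qed
        then show "AE z in lborel. norm (F z * ?G z) \<le> norm (F z)"
          by (intro AE_I2) (simp add: abs_mult mult_left_le)
      qed measurable
      show "integrable lborel (\<lambda>z. F z * (3 / 4))"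
        by (intro integrable_mult_left F_int)
      fix z
      show "F z * (3 / 4) \<le> F z * ?G z"
      proof (cases "z \<in> ball 0 \<rho>")
        case True
        have *: "gauss \<sigma> (u - z) = gauss \<sigma> (z - u)" for u
          using gauss_minus[of \<sigma> "z - u"] by simp
        have "1 - \<tau> \<le> (LINT u|lborel. gauss \<sigma> (z - u)) - (LINT u|lborel. gauss \<sigma> (z - u) * indicator {u. \<delta> \<le> norm (z - u)} u)"
          using tail[of z] by (simp add: g(2))
        also have "\<dots> = (LINT u|lborel. gauss \<sigma> (z - u) - gauss \<sigma> (z - u) * indicator {u. \<delta> \<le> norm (z - u)} u)"
          by (rule Bochner_Integration.integral_diff[symmetric, OF g(1) g(3)])
        also have "\<dots> \<le> (LINT u|lborel. gauss \<sigma> (u - z) * indicator (ball 0 (2 * \<rho>)) u)"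
          unfolding *
        proof (intro integral_mono Bochner_Integration.integrable_diff g integrable_real_mult_indicator[OF _ g(1)])
          fix u
          have "u \<in> ball 0 (2 * \<rho>)" if "norm (z - u) < \<delta>"
            using norm_triangle_ineq4[of z "z - u"] that True \<delta> by simp
          then show "gauss \<sigma> (z - u) - gauss \<sigma> (z - u) * indicator {u. \<delta> \<le> norm (z - u)} u
              \<le> gauss \<sigma> (z - u) * indicator (ball 0 (2 * \<rho>)) u"
            by (cases "norm (z - u) < \<delta>") auto
        qed simp
        also have "\<dots> = ?G z"
          by (rule N_int[symmetric]) measurable
        finally have "3 / 4 \<le> ?G z"
          using \<tau>(2) by linarith
        then show ?thesis
          by (rule mult_left_mono) (rule F)
      qed (simp add: F_def)
    qed
    also have "\<dots> = (LINT u|N. mollify \<sigma> F u)"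
      unfolding mollify_def
      by (rule N.integral_mixture[symmetric, OF lborel.sigma_finite_measure_axioms F_int _ bd]) measurable
    also have "\<dots> = (LINT u|lborel. mollify \<sigma> F u * indicator (ball 0 (2 * \<rho>)) u)"
      by (rule N_int) measurable
    finally show ?thesis .
  qed
  show ?thesis
    using \<sigma> le mass by blast
qed

text \<open>The vector \<open>a = x / |x|\<^sup>2\<close> below is scaled so that \<open>a \<bullet> z\<close> stays in \<open>[-11/8, -5/8]\<close>
  for all jumps \<open>z\<close> from \<open>ball x (|x|/8)\<close> into \<open>ball 0 (|x|/4)\<close>.\<close>

lemma small_time_ge:
  fixes \<phi> :: "real^'n \<Rightarrow> real" and x :: "real^'n"
  assumes cont: "continuous_on UNIV \<phi>" and pos: "\<And>x. 0 < \<phi> x" and x: "x \<noteq> 0"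
    and k: "0 \<le> k" "\<And>z. z \<noteq> 0 \<Longrightarrow> norm z \<le> 2 * norm x \<Longrightarrow> k \<le> \<nu> z"
  shows "\<exists>h0>0. \<forall>h y. 0 \<le> h \<longrightarrow> h \<le> h0 \<longrightarrow> y \<in> ball x (norm x / 8) \<longrightarrow>
    h * ((1 - cos (5 / 8)) / 4 * k * (LINT z|lborel. \<phi> z * indicator (ball 0 (norm x / 8)) z))
      \<le> expectation (\<lambda>w. \<phi> (y + X h w) * indicator (ball 0 (norm x / 4)) (y + X h w))"
proof -
  define \<rho> where "\<rho> = norm x / 8"
  have \<rho>: "0 < \<rho>" "norm x = 8 * \<rho>"
    using x by (simp_all add: \<rho>_def)
  have \<rho>4: "norm x / 4 = 2 * \<rho>"
    using \<rho> by simp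
  define F where "F z = \<phi> z * indicator (ball 0 \<rho>) z" for z
  define B where "B = ball (0::real^'n) (2 * \<rho>)"
  have [measurable]: "\<phi> \<in> borel_measurable borel"
    using cont by (rule borel_measurable_continuous_onI)
  have [measurable]: "ball (0::real^'n) r \<in> sets borel" for r
    by simp
  have B_sets [measurable]: "B \<in> sets borel"
    by (simp add: B_def)
  obtain C where C: "0 < C" "\<And>x. x \<in> cball 0 (2 * \<rho>) \<Longrightarrow> \<phi> x \<le> C"
    using continuous_bounded_on_cball[OF cont, of "2 * \<rho>"] by (auto simp: abs_le_iff)
  have \<phi>B: "0 \<le> \<phi> u * indicator B u" "\<phi> u * indicator B u \<le> C" for u
    using pos[of u] C(1) C(2)[of u] by (auto simp: B_def indicator_def)
  have F: "0 \<le> F z" "F z \<le> C" for z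
    using pos[of z] C(2)[of z] C(1) \<rho> by (auto simp: F_def indicator_def)
  have F_int: "integrable lborel F"
    unfolding F_def
  proof (rule integrable_on_ball)
    show "\<bar>\<phi> z\<bar> \<le> C" if "z \<in> ball 0 \<rho>" for z
      using F[of z] that by (simp add: F_def)
  qed measurable
  define I where "I = (LINT z|lborel. F z)"
  define cc where "cc = 1 - cos (5 / 8 :: real)"
  define L where "L = cc * k * I"
  have cc: "0 < cc"
    using cos_monotone_0_pi[of 0 "5 / 8"] pi_gt3 by (simp add: cc_def)
  have I: "0 \<le> I"
    unfolding I_def using F by (intro integral_nonneg_AE AE_I2)
  have L: "0 \<le> L"
    using cc k(1) I by (simp add: L_def)
  show ?thesis
  \<comment> \<open>The degenerate case is separated because the admissible error
    \<open>\<epsilon>\<close> is proportional to \<open>L\<close> and must be positive.\<close>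
  proof (cases "L = 0")
    case True
    have "0 \<le> expectation (\<lambda>w. \<phi> (y + X h w) * indicator B (y + X h w))" for h y
      using \<phi>B by (intro integral_nonneg_AE AE_I2)
    then show ?thesis
      using True unfolding L_def cc_def I_def F_def B_def \<rho>4 \<rho>_def[symmetric] by (intro exI[of _ 1]) auto
  next
    case False
    with L have L0: "0 < L"
      by simp
    define a where "a = (1 / (norm x)\<^sup>2) *\<^sub>R x"
    \<comment> \<open>The mollification error enters under the weight, whose expectation is at most
      \<open>h * psi a\<close>, so it costs at most \<open>h * (L / 8)\<close>. The added
      \<open>1\<close> covers \<open>psi a = 0\<close>.\<close>
    define \<epsilon> where "\<epsilon> = L / (8 * (psi a + 1))"
    have cancel: "L / (8 * c) * c = L / 8" if "0 < c" for c
      using that by simp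
    have pa: "0 < psi a + 1"
      using psi_nonneg[of a] by linarith
    have \<epsilon>: "0 < \<epsilon>" "\<epsilon> * psi a \<le> L / 8"
    proof -
      show "0 < \<epsilon>"
        using L0 pa by (simp add: \<epsilon>_def)
      then have "\<epsilon> * psi a \<le> \<epsilon> * (psi a + 1)"
        by (intro mult_left_mono) auto
      also have "\<dots> = L / 8"
        unfolding \<epsilon>_def by (rule cancel[OF pa])
      finally show "\<epsilon> * psi a \<le> L / 8" .
    qed
    obtain \<sigma> where \<sigma>: "0 < \<sigma>"
      and m_le: "\<And>u. mollify \<sigma> F u \<le> \<phi> u * indicator B u + \<epsilon>"
      and mass: "3 / 4 * I \<le> (LINT u|lborel. mollify \<sigma> F u * indicator B u)"
      using mollify_approx[OF cont pos \<rho>(1) \<epsilon>(1)] unfolding F_def I_def B_def by blast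
    have m_nonneg: "0 \<le> mollify \<sigma> F u" for u
      unfolding mollify_def using F by (intro integral_nonneg_AE AE_I2) simp
    have m_bd: "\<bar>mollify \<sigma> F u\<bar> \<le> C + \<epsilon>" for u
      using m_le[of u] m_nonneg[of u] \<phi>B(2)[of u] by linarith
    have [measurable]: "F \<in> borel_measurable borel"
      unfolding F_def by measurable
    have [measurable]: "mollify \<sigma> F \<in> borel_measurable borel"
      unfolding mollify_def[abs_def] by measurable
    obtain D where D: "0 \<le> D" "\<And>h y. 0 \<le> h \<Longrightarrow>
        h * (LINT z|lborel. (1 - cos (a \<bullet> z)) * mollify \<sigma> F (y + z) * nu z) - h\<^sup>2 * D
          \<le> expectation (\<lambda>w. (1 - cos (a \<bullet> X h w)) * mollify \<sigma> F (y + X h w))"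
      using mollify_generator_ge[OF \<sigma> F_int F(1), of a] by blast
    \<comment> \<open>For \<open>h\<close> up to \<open>h0\<close> the second order error
      \<open>h\<^sup>2 * D\<close> is at most \<open>h * (L / 8)\<close>.\<close>
    define h0 where "h0 = L / (8 * (D + 1))"
    have h0: "0 < h0" "h0 * D \<le> L / 8"
    proof -
      show "0 < h0"
        using L0 D by (simp add: h0_def)
      then have "h0 * D \<le> h0 * (D + 1)"
        by (intro mult_left_mono) auto
      also have "\<dots> = L / 8"
        unfolding h0_def using D(1) by (intro cancel) linarith
      finally show "h0 * D \<le> L / 8" .
    qed
    have nu_ge: "3 / 4 * L \<le> (LINT z|lborel. (1 - cos (a \<bullet> z)) * mollify \<sigma> F (y + z) * nu z)"
      if y: "y \<in> ball x \<rho>" for y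
    proof -
      let ?g = "\<lambda>u. mollify \<sigma> F u * indicator B u"
      have g_int: "integrable lborel ?g"
      proof (rule integrableI_bounded_set[where A=B and B="C + \<epsilon>"])
        show "emeasure lborel B < \<infinity>"
          unfolding B_def by (rule emeasure_lborel_ball_finite)
        show "AE u in lborel. u \<in> B \<longrightarrow> norm (mollify \<sigma> F u * indicator B u) \<le> C + \<epsilon>"
          using m_bd by (intro AE_I2) (simp add: indicator_def)
      qed auto
      have g_shift: "integrable lborel (\<lambda>z. ?g (y + z))" "(LINT z|lborel. ?g (y + z)) = (LINT u|lborel. ?g u)"
        using lborel_integrable_reflect[of "\<lambda>z. ?g (y - z)" 0] lborel_integrable_reflect[of ?g y] g_int
          lborel_integral_reflect[of "\<lambda>z. ?g (y - z)" 0] lborel_integral_reflect[of ?g y]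
        by simp_all
      have "3 / 4 * L \<le> cc * k * (LINT u|lborel. ?g u)"
        using mult_left_mono[OF mass, of "cc * k"] cc k(1) by (simp add: L_def mult_ac)
      also have "\<dots> = (LINT z|lborel. cc * k * ?g (y + z))"
        unfolding integral_mult_right_zero g_shift(2) ..
      also have "\<dots> \<le> (LINT z|lborel. (1 - cos (a \<bullet> z)) * mollify \<sigma> F (y + z) * nu z)"
      proof (rule integral_mono)
        show "integrable lborel (\<lambda>z. cc * k * ?g (y + z))"
          by (rule integrable_mult_right) (rule g_shift(1))
        show "integrable lborel (\<lambda>z. (1 - cos (a \<bullet> z)) * mollify \<sigma> F (y + z) * nu z)"
          by (rule integrable_weighted_nu[OF _ m_bd]) measurable
        fix z
        show "cc * k * ?g (y + z) \<le> (1 - cos (a \<bullet> z)) * mollify \<sigma> F (y + z) * nu z"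
        proof (cases "y + z \<in> B")
          case True
          have ny: "norm (y - x) < \<rho>"
            using y by (simp add: dist_norm norm_minus_commute)
          have nz: "norm (y + z) < 2 * \<rho>"
            using True by (simp add: B_def)
          have z_eq: "z = (y + z) - (y - x) - x"
            by simp
          have "norm z \<le> norm ((y + z) - (y - x)) + norm x"
            by (subst z_eq) (rule norm_triangle_ineq4)
          also have "norm ((y + z) - (y - x)) \<le> norm (y + z) + norm (y - x)"
            by (rule norm_triangle_ineq4)
          finally have nz2: "norm z \<le> 2 * norm x"
            using ny nz \<rho> by linarith
          have "\<bar>(y + z) \<bullet> x\<bar> \<le> 2 * \<rho> * norm x"
            using Cauchy_Schwarz_ineq2[of "y + z" x] nz by (meson less_imp_le mult_right_mono norm_ge_zero order_trans)
          moreover have "\<bar>(y - x) \<bullet> x\<bar> \<le> \<rho> * norm x"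
            using Cauchy_Schwarz_ineq2[of "y - x" x] ny by (meson less_imp_le mult_right_mono norm_ge_zero order_trans)
          moreover have "z \<bullet> x = (y + z) \<bullet> x - (y - x) \<bullet> x - (norm x)\<^sup>2"
            by (simp add: inner_add_left inner_diff_left power2_norm_eq_inner)
          \<comment> \<open>The three inner products are at most \<open>1/4\<close>, at most
            \<open>1/8\<close> and exactly \<open>1\<close> times \<open>(norm x)\<^sup>2\<close> in
            modulus, which gives the window \<open>1 - 3/8\<close> to \<open>1 + 3/8\<close>. It
            lies in \<open>[0, pi]\<close>, where the cosine decreases.\<close>
          ultimately have zx: "5 / 8 * (norm x)\<^sup>2 \<le> - (z \<bullet> x)" "- (z \<bullet> x) \<le> 11 / 8 * (norm x)\<^sup>2"
            using \<rho> by (simp_all add: power2_eq_square)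
          have az: "- (a \<bullet> z) = - (z \<bullet> x) / (norm x)\<^sup>2"
            by (simp add: a_def inner_commute)
          have nx: "0 < (norm x)\<^sup>2"
            using x by simp
          have "5 / 8 \<le> - (a \<bullet> z)" "- (a \<bullet> z) \<le> 11 / 8"
            unfolding az by (subst pos_le_divide_eq[OF nx], rule zx(1), subst pos_divide_le_eq[OF nx], rule zx(2))
          then have "cos (- (a \<bullet> z)) \<le> cos (5 / 8)"
            using pi_gt3 by (intro cos_monotone_0_pi_le) linarith+
          then have v: "cc \<le> 1 - cos (a \<bullet> z)"
            by (simp add: cc_def)
          have "z \<noteq> 0"
            using zx(1) x by auto
          then have "k \<le> nu z"
            using k(2) nz2 by (simp add: nu_eq)
          with v have "cc * k \<le> (1 - cos (a \<bullet> z)) * nu z"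
            using k(1) cc by (intro mult_mono) auto
          from mult_right_mono[OF this m_nonneg[of "y + z"]] show ?thesis
            using True by (simp add: mult_ac)
        qed (simp add: m_nonneg)
      qed
      finally show ?thesis .
    qed
    have "h * (L / 4) \<le> expectation (\<lambda>w. \<phi> (y + X h w) * indicator B (y + X h w))"
      if h: "0 \<le> h" "h \<le> h0" and y: "y \<in> ball x \<rho>" for h y
    proof -
      note [measurable] = measurable_X[OF h(1)]
      let ?v = "\<lambda>w. 1 - cos (a \<bullet> X h w)" and ?f = "\<lambda>w. \<phi> (y + X h w) * indicator B (y + X h w)"
      have v: "0 \<le> ?v w" "?v w \<le> 2" for w
        using cos_ge_minus_one[of "a \<bullet> X h w"] by (simp, linarith)
      have f_int: "integrable M ?f"
        using \<phi>B by (intro integrable_const_bound[where B=C] AE_I2) auto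
      have w_int: "integrable M ?v"
        using v by (intro integrable_const_bound[where B=2] AE_I2) auto
      have wm_int: "integrable M (\<lambda>w. ?v w * mollify \<sigma> F (y + X h w))"
      proof (intro integrable_const_bound[where B="2 * (C + \<epsilon>)"] AE_I2)
        show "norm (?v w * mollify \<sigma> F (y + X h w)) \<le> 2 * (C + \<epsilon>)" for w
          unfolding real_norm_def abs_mult using v[of w] m_bd[of "y + X h w"] by (intro mult_mono) auto
      qed measurable
      have "expectation ?v = 1 - exp (- h * psi a)"
        using expectation_cos[OF h(1), of a 0]
        by (subst Bochner_Integration.integral_diff) (auto intro!: integrable_const_bound[where B=1] simp: prob_space)
      then have Ew: "expectation ?v \<le> h * psi a"
        using exp_minus_bounds(1)[of "h * psi a"] h by simp
      \<comment> \<open>Three quarters of the rate minus two errors of one eighth leave one half;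
        the bound \<open>2\<close> on the weight halves this again, which is the \<open>1/4\<close>
        of the claim.\<close>
      have "h * (3 / 4 * L) - h * (L / 8) - h * (L / 8) \<le>
          h * (LINT z|lborel. (1 - cos (a \<bullet> z)) * mollify \<sigma> F (y + z) * nu z) - h\<^sup>2 * D - \<epsilon> * (h * psi a)"
      proof (intro diff_mono mult_left_mono nu_ge y h)
        have "h * D \<le> L / 8"
          using mult_right_mono[OF h(2) D(1)] h0(2) by linarith
        from mult_left_mono[OF this h(1)] show "h\<^sup>2 * D \<le> h * (L / 8)"
          by (simp add: power2_eq_square mult.assoc)
        show "\<epsilon> * (h * psi a) \<le> h * (L / 8)"
          using mult_left_mono[OF \<epsilon>(2) h(1)] by (simp add: mult_ac)
      qed
      also have "\<dots> \<le> expectation (\<lambda>w. ?v w * mollify \<sigma> F (y + X h w)) - \<epsilon> * expectation ?v"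
        using D(2)[OF h(1), of y] mult_left_mono[OF Ew, of \<epsilon>] \<epsilon>(1) by linarith
      also have "\<dots> = expectation (\<lambda>w. ?v w * mollify \<sigma> F (y + X h w) - \<epsilon> * ?v w)"
        by (subst Bochner_Integration.integral_diff[OF wm_int integrable_mult_right[OF w_int]])
           (simp only: integral_mult_right_zero)
      also have "\<dots> \<le> expectation (\<lambda>w. 2 * ?f w)"
      proof (rule integral_mono)
        fix w
        have "mollify \<sigma> F (y + X h w) - \<epsilon> \<le> ?f w"
          using m_le[of "y + X h w"] by linarith
        from mult_left_mono[OF this v(1)] have "?v w * (mollify \<sigma> F (y + X h w) - \<epsilon>) \<le> ?v w * ?f w" .
        also have "\<dots> \<le> 2 * ?f w"
          using v(2) \<phi>B(1) by (intro mult_right_mono)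
        finally show "?v w * mollify \<sigma> F (y + X h w) - \<epsilon> * ?v w \<le> 2 * ?f w"
          unfolding mult.commute[of \<epsilon>] right_diff_distrib[of "?v w", symmetric] .
      qed (intro Bochner_Integration.integrable_diff wm_int integrable_mult_right w_int f_int)+
      finally show ?thesis
        by (simp add: mult.commute)
    qed
    then show ?thesis
      using h0(1) unfolding L_def cc_def I_def F_def B_def \<rho>4 \<rho>_def[symmetric]
      by (intro exI[of _ h0]) (auto simp: mult_ac)
  qed
qed

section \<open>The effect of the potential during one short step\<close>

lemma kato_loc_small:
  assumes kato: "kato_loc M X W" and K: "compact K" and \<epsilon>: "0 < \<epsilon>"
  shows "\<exists>h0>0. \<forall>h. 0 < h \<longrightarrow> h < h0 \<longrightarrow>
    (\<forall>x. (\<integral>\<^sup>+w. (\<integral>\<^sup>+s\<in>{0..h}. ennreal \<bar>W (x + X s w) * indicator K (x + X s w)\<bar> \<partial>lborel) \<partial>M) \<le> ennreal \<epsilon>)"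
proof -
  have "((\<lambda>t. SUP x. \<integral>\<^sup>+w. (\<integral>\<^sup>+s\<in>{0..t}. ennreal \<bar>W (x + X s w) * indicator K (x + X s w)\<bar> \<partial>lborel) \<partial>M) \<longlongrightarrow> 0) (at_right 0)"
    using kato K unfolding kato_loc_def kato_def by blast
  then have "\<forall>\<^sub>F t in at_right 0. (SUP x. \<integral>\<^sup>+w. (\<integral>\<^sup>+s\<in>{0..t}. ennreal \<bar>W (x + X s w) * indicator K (x + X s w)\<bar> \<partial>lborel) \<partial>M) < ennreal \<epsilon>"
    using \<epsilon> by (intro order_tendstoD(2)) auto
  then obtain h0 where h0: "0 < h0" "\<And>t. 0 < t \<Longrightarrow> t < h0 \<Longrightarrow>
      (SUP x. \<integral>\<^sup>+w. (\<integral>\<^sup>+s\<in>{0..t}. ennreal \<bar>W (x + X s w) * indicator K (x + X s w)\<bar> \<partial>lborel) \<partial>M) < ennreal \<epsilon>"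
    unfolding eventually_at_right_field by blast
  show ?thesis
  proof (intro exI[of _ h0] conjI allI impI)
    fix h x assume "0 < h" "h < h0"
    show "(\<integral>\<^sup>+w. (\<integral>\<^sup>+s\<in>{0..h}. ennreal \<bar>W (x + X s w) * indicator K (x + X s w)\<bar> \<partial>lborel) \<partial>M) \<le> ennreal \<epsilon>"
      by (rule less_imp_le[OF SUP_lessD[OF h0(2)[OF \<open>0 < h\<close> \<open>h < h0\<close>] UNIV_I]])
  qed (rule h0)
qed

text \<open>The inequality \<open>1 - J \<le> exp (- J)\<close>, stated additively so that no
  subtraction in \<open>ennreal\<close> occurs; replacing the potential by its positive part only
  enlarges the integral.\<close>

lemma exp_minus_integral_ge:
  assumes [measurable]: "W \<in> borel_measurable borel"
  shows "1 \<le> ennreal (exp (- (LINT s:{0..h}|lborel. W s))) + (\<integral>\<^sup>+s\<in>{0..h}. ennreal (max 0 (W s)) \<partial>lborel)"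
proof (cases "set_integrable lborel {0..h} W")
  case True
  then have i: "integrable lborel (\<lambda>s. indicator {0..h} s *\<^sub>R W s)"
    by (simp add: set_integrable_def)
  then have j: "integrable lborel (\<lambda>s. max 0 (indicator {0..h} s *\<^sub>R W s))"
    by (intro integrable_max) auto
  define J where "J = (LINT s|lborel. max 0 (indicator {0..h} s *\<^sub>R W s))"
  have "(LINT s:{0..h}|lborel. W s) \<le> J"
    unfolding J_def set_lebesgue_integral_def by (intro integral_mono i j) simp
  then have "1 - J \<le> exp (- (LINT s:{0..h}|lborel. W s))"
    using exp_ge_add_one_self[of "- (LINT s:{0..h}|lborel. W s)"] by linarith
  then have "ennreal 1 \<le> ennreal (exp (- (LINT s:{0..h}|lborel. W s)) + J)"
    by (intro ennreal_leI) linarith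
  also have "\<dots> \<le> ennreal (exp (- (LINT s:{0..h}|lborel. W s))) + ennreal J"
    by (rule order_eq_refl, rule ennreal_plus) (auto simp: J_def intro!: integral_nonneg_AE)
  also have "ennreal J = (\<integral>\<^sup>+s. ennreal (max 0 (indicator {0..h} s *\<^sub>R W s)) \<partial>lborel)"
    unfolding J_def by (rule nn_integral_eq_integral[symmetric, OF j]) simp
  also have "\<dots> = (\<integral>\<^sup>+s\<in>{0..h}. ennreal (max 0 (W s)) \<partial>lborel)"
    by (intro nn_integral_cong) (simp add: indicator_def)
  finally show ?thesis
    by simp
next
  case False
  \<comment> \<open>A non-integrable Bochner integral is \<open>0\<close> by default, so the
    exponential equals one and the bound is trivial.\<close>
  then have "(LINT s:{0..h}|lborel. W s) = 0"
    by (simp add: set_lebesgue_integral_def set_integrable_def not_integrable_integral_eq)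
  then show ?thesis
    by simp
qed

text \<open>The functional without potential has rate \<open>2 * q\<close> by
  \<open>small_time_ge\<close>. The loss is bounded by the expected product of the terminal value
  and the accumulated positive potential; it is concentrated on the exit event, hence of order
  \<open>h\<close> with a factor that can be made small.\<close>

lemma one_step_jump_ge:
  fixes \<phi> V :: "real^'n \<Rightarrow> real" and x :: "real^'n"
  assumes cont: "continuous_on UNIV \<phi>" and pos: "\<And>x. 0 < \<phi> x" and x: "x \<noteq> 0"
    and k: "0 \<le> k" "\<And>z. z \<noteq> 0 \<Longrightarrow> norm z \<le> 2 * norm x \<Longrightarrow> k \<le> \<nu> z"
    and V [measurable]: "V \<in> borel_measurable borel" and kato: "kato_loc M X (\<lambda>x. max 0 (V x))"
    and R1: "\<And>u. R1 < norm u \<Longrightarrow> V u \<le> 1" "8 * R1 \<le> norm x"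
  shows "\<exists>h0>0. \<forall>h y. 0 < h \<longrightarrow> h \<le> h0 \<longrightarrow> y \<in> ball x (norm x / 8) \<longrightarrow>
    ennreal (h * ((1 - cos (5 / 8)) / 8 * k * (LINT z|lborel. \<phi> z * indicator (ball 0 (norm x / 8)) z)))
      \<le> (\<integral>\<^sup>+w. ennreal (exp (- (LINT s:{0..h}|lborel. V (y + X s w))) *
            (\<phi> (y + X h w) * indicator (ball 0 (norm x / 4)) (y + X h w))) \<partial>M)"
proof -
  define \<rho> where "\<rho> = norm x / 8"
  have \<rho>: "0 < \<rho>" "norm x = 8 * \<rho>"
    using x by (simp_all add: \<rho>_def)
  have \<rho>4: "norm x / 4 = 2 * \<rho>"
    using \<rho> by simp
  define B where "B = ball (0::real^'n) (2 * \<rho>)"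
  have [measurable]: "\<phi> \<in> borel_measurable borel"
    using cont by (rule borel_measurable_continuous_onI)
  have B_sets [measurable]: "B \<in> sets borel"
    by (simp add: B_def)
  obtain C where C: "0 < C" "\<And>x. x \<in> cball 0 (2 * \<rho>) \<Longrightarrow> \<phi> x \<le> C"
    using continuous_bounded_on_cball[OF cont, of "2 * \<rho>"] by (auto simp: abs_le_iff)
  have \<phi>B: "0 \<le> \<phi> u * indicator B u" "\<phi> u * indicator B u \<le> C * indicator B u" "\<phi> u * indicator B u \<le> C" for u
    using pos[of u] C(1) C(2)[of u] by (auto simp: B_def indicator_def)
  define I where "I = (LINT z|lborel. \<phi> z * indicator (ball 0 \<rho>) z)"
  define q where "q = (1 - cos (5 / 8 :: real)) / 8 * k * I"
  have I: "0 \<le> I"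
    unfolding I_def using pos by (intro integral_nonneg_AE AE_I2) (simp add: less_imp_le)
  have q: "0 \<le> q"
    unfolding q_def using k(1) I by (intro mult_nonneg_nonneg divide_nonneg_nonneg) auto
  have q2: "2 * q = (1 - cos (5 / 8)) / 4 * k * I"
    by (simp add: q_def)
  obtain h1 where h1: "0 < h1" "\<And>h y. 0 \<le> h \<Longrightarrow> h \<le> h1 \<Longrightarrow> y \<in> ball x \<rho> \<Longrightarrow>
      h * (2 * q) \<le> expectation (\<lambda>w. \<phi> (y + X h w) * indicator B (y + X h w))"
    using small_time_ge[OF cont pos x k] unfolding \<rho>4 \<rho>_def[symmetric] B_def[symmetric] I_def[symmetric] q2[symmetric]
    by blast
  show ?thesis
  proof (cases "q = 0")
    case True
    then show ?thesis
      unfolding \<rho>_def[symmetric] I_def[symmetric] q_def[symmetric] by (intro exI[of _ 1]) simp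
  next
    case False
    with q have q0: "0 < q"
      by simp
    define \<kappa> where "\<kappa> = exit_const * Psi (1 / \<rho>)"
    have \<kappa>: "0 \<le> \<kappa>"
      unfolding \<kappa>_def using \<rho> by (intro mult_nonneg_nonneg exit_const_nonneg Psi_nonneg) auto
    \<comment> \<open>Chosen so that two losses, each at most
      \<open>C * (h * \<kappa>) * \<epsilon>\<close>, together cost no more than
      \<open>h * q\<close>; the added \<open>1\<close> covers \<open>\<kappa> = 0\<close>.\<close>
    define \<epsilon> where "\<epsilon> = q / (2 * C * (\<kappa> + 1))"
    have \<epsilon>: "0 < \<epsilon>" "C * (\<kappa> * (2 * \<epsilon>)) \<le> q"
    proof -
      show "0 < \<epsilon>"
        using q0 C \<kappa> by (simp add: \<epsilon>_def)
      then have "C * (\<kappa> * (2 * \<epsilon>)) \<le> C * ((\<kappa> + 1) * (2 * \<epsilon>))"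
        using C by (intro mult_left_mono mult_right_mono) auto
      also have "\<dots> = q"
      proof -
        have "C * (c * (2 * (q / (2 * C * c)))) = q" if "0 < c" for c
          using C that by simp
        from this[of "\<kappa> + 1"] \<kappa> show ?thesis
          unfolding \<epsilon>_def by linarith
      qed
      finally show "C * (\<kappa> * (2 * \<epsilon>)) \<le> q" .
    qed
    let ?K = "cball (0::real^'n) R1"
    define f where "f u = ennreal \<bar>max 0 (V u) * indicator ?K u\<bar>" for u
    have [measurable]: "?K \<in> sets borel"
      by simp
    have [measurable]: "f \<in> borel_measurable borel"
      unfolding f_def by measurable
    obtain h2 where h2: "0 < h2" "\<And>h x. 0 < h \<Longrightarrow> h < h2 \<Longrightarrow>
        (\<integral>\<^sup>+w. (\<integral>\<^sup>+s\<in>{0..h}. f (x + X s w) \<partial>lborel) \<partial>M) \<le> ennreal \<epsilon>"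
      using kato_loc_small[OF kato compact_cball \<epsilon>(1)] unfolding f_def by blast
    \<comment> \<open>Halving \<open>h2\<close> secures the strict inequality of the Kato bound, and
      \<open>h \<le> \<epsilon>\<close> controls the potential outside \<open>cball 0 R1\<close>,
      where it is at most one and accumulates at most \<open>h\<close>.\<close>
    define h0 where "h0 = min (min h1 (h2 / 2)) \<epsilon>"
    have h0: "0 < h0"
      using h1 h2 \<epsilon> by (simp add: h0_def)
    have main: "ennreal (h * q) \<le> (\<integral>\<^sup>+w. ennreal (exp (- (LINT s:{0..h}|lborel. V (y + X s w))) *
            (\<phi> (y + X h w) * indicator B (y + X h w))) \<partial>M)"
      if h: "0 < h" "h \<le> h0" and y: "y \<in> ball x \<rho>" for h y
    proof -
      have hh: "h \<le> h1" "h < h2" "h \<le> \<epsilon>"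
        using h h2 by (auto simp: h0_def)
      define Y where "Y s w = X (max 0 s) w" for s w
      have Y_joint: "(\<lambda>(s, w). Y s w) \<in> borel_measurable (borel \<Otimes>\<^sub>M M)"
        unfolding Y_def by (rule measurable_X_joint)
      have [measurable]: "(\<lambda>p. Y (t p) (w p)) \<in> borel_measurable N"
        if "t \<in> borel_measurable N" "w \<in> measurable N M" for t w and N :: "'c measure"
        using measurable_compose[OF measurable_Pair[OF that] Y_joint] by simp
      note [measurable] = measurable_X[OF less_imp_le[OF h(1)]]
      have XY: "(LINT s:{0..h}|lborel. V (y + X s w)) = (LINT s:{0..h}|lborel. V (y + Y s w))" for w
        unfolding set_lebesgue_integral_def
        by (intro Bochner_Integration.integral_cong) (auto simp: Y_def indicator_def)
      define J where "J w = (\<integral>\<^sup>+s\<in>{0..h}. ennreal (max 0 (V (y + Y s w))) \<partial>lborel)" for w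
      have J_meas [measurable]: "J \<in> borel_measurable M"
        unfolding J_def by measurable
      define Z where "Z w = exp (- (LINT s:{0..h}|lborel. V (y + X s w)))" for w
      have Z_meas [measurable]: "Z \<in> borel_measurable M"
        unfolding Z_def XY unfolding set_lebesgue_integral_def by measurable
      let ?f = "\<lambda>w. \<phi> (y + X h w) * indicator B (y + X h w)"
      have ZJ: "1 \<le> ennreal (Z w) + J w" if "w \<in> space M" for w
      proof -
        have "(\<lambda>s. V (y + Y s w)) \<in> borel_measurable borel"
          using measurable_Pair1[OF Y_joint that] by simp
        from exp_minus_integral_ge[OF this, of h] show ?thesis
          unfolding Z_def XY J_def .
      qed
      have J_le: "(\<integral>\<^sup>+w. ennreal (?f w) * J w \<partial>M) \<le> ennreal (h * q)"
      proof -
        \<comment> \<open>Without an exit the endpoint is at distance at least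
          \<open>8 * \<rho> - \<rho> - \<rho>\<close> from the origin and so misses
          \<open>B\<close>.\<close>
        have ex: "y + X h w \<notin> B" if "w \<in> space M" "w \<notin> exit_event h \<rho>" for w
        proof -
          have "norm (X h w) \<le> \<rho>"
            using norm_X_le_of_notin_exit_event[OF that, of h] h by simp
          moreover have "norm x \<le> norm (y + X h w) + norm (x - y) + norm (X h w)"
            using norm_triangle_ineq4[of "y + X h w + (x - y)" "X h w"] norm_triangle_ineq[of "y + X h w" "x - y"]
            by (simp add: algebra_simps)
          moreover have "norm (x - y) < \<rho>"
            using y by (simp add: dist_norm)
          ultimately show ?thesis
            using \<rho> by (simp add: B_def)
        qed
        have "J w \<le> (\<integral>\<^sup>+s\<in>{0..h}. f (y + X s w) \<partial>lborel) + ennreal h" if "w \<in> space M" for w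
        proof -
          have [measurable]: "(\<lambda>s. Y s w) \<in> borel_measurable borel"
            using measurable_Pair1[OF Y_joint that] by simp
          have "J w \<le> (\<integral>\<^sup>+s. f (y + Y s w) * indicator {0..h} s + indicator {0..h} s \<partial>lborel)"
            unfolding J_def
          proof (rule nn_integral_mono)
            fix s
            have "ennreal (max 0 (V u)) \<le> f u + 1" for u
            proof (cases "norm u \<le> R1")
              case False
              then have "ennreal (max 0 (V u)) \<le> ennreal 1"
                using R1(1)[of u] by (intro ennreal_leI) simp
              then show ?thesis
                by (simp add: add_increasing)
            qed (simp add: f_def add_increasing2)
            then show "ennreal (max 0 (V (y + Y s w))) * indicator {0..h} s
                \<le> f (y + Y s w) * indicator {0..h} s + indicator {0..h} s"
              by (simp add: indicator_def)
          qed
          also have "\<dots> = (\<integral>\<^sup>+s\<in>{0..h}. f (y + Y s w) \<partial>lborel) + ennreal h"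
            using h by (subst nn_integral_add) auto
          also have "(\<integral>\<^sup>+s\<in>{0..h}. f (y + Y s w) \<partial>lborel) = (\<integral>\<^sup>+s\<in>{0..h}. f (y + X s w) \<partial>lborel)"
            by (intro nn_integral_cong) (auto simp: Y_def indicator_def)
          finally show ?thesis .
        qed
        note J_bd = this
        have "(\<integral>\<^sup>+w. ennreal (?f w) * J w \<partial>M) \<le>
            (\<integral>\<^sup>+w. ennreal C * ((\<integral>\<^sup>+s\<in>{0..h}. f (y + Y s w) \<partial>lborel) + ennreal h * indicator (exit_event h \<rho>) w) \<partial>M)"
        proof (rule nn_integral_mono)
          fix w assume w: "w \<in> space M"
          have "(\<integral>\<^sup>+s\<in>{0..h}. f (y + Y s w) \<partial>lborel) = (\<integral>\<^sup>+s\<in>{0..h}. f (y + X s w) \<partial>lborel)"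
            by (intro nn_integral_cong) (auto simp: Y_def indicator_def)
          then have Jb: "J w \<le> (\<integral>\<^sup>+s\<in>{0..h}. f (y + Y s w) \<partial>lborel) + ennreal h"
            using J_bd[OF w] by simp
          show "ennreal (?f w) * J w \<le> ennreal C * ((\<integral>\<^sup>+s\<in>{0..h}. f (y + Y s w) \<partial>lborel) + ennreal h * indicator (exit_event h \<rho>) w)"
          proof (cases "w \<in> exit_event h \<rho>")
            case True
            then show ?thesis
              using Jb \<phi>B(3)[of "y + X h w"] by (intro mult_mono ennreal_leI) auto
          next
            case False
            then show ?thesis
              using ex[OF w] by simp
          qed
        qed
        also have "\<dots> = ennreal C * ((\<integral>\<^sup>+w. (\<integral>\<^sup>+s\<in>{0..h}. f (y + Y s w) \<partial>lborel) \<partial>M) + ennreal h * emeasure M (exit_event h \<rho>))"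
        proof -
          have [measurable]: "exit_event h \<rho> \<in> sets M"
            using h by simp
          show ?thesis
            by (subst nn_integral_cmult, measurable, subst nn_integral_add, measurable) (simp add: nn_integral_cmult_indicator)
        qed
        also have "(\<integral>\<^sup>+w. (\<integral>\<^sup>+s\<in>{0..h}. f (y + Y s w) \<partial>lborel) \<partial>M) = (\<integral>\<^sup>+w. (\<integral>\<^sup>+s\<in>{0..h}. f (y + X s w) \<partial>lborel) \<partial>M)"
          by (intro nn_integral_cong) (auto simp: Y_def indicator_def)
        also have "\<dots> \<le> emeasure M (exit_event h \<rho>) * ennreal \<epsilon>"
        proof (rule occupation_le[OF h(1)])
          show "f (y + z) = 0" if "norm z \<le> \<rho>" for z
          proof -
            have "norm x \<le> norm (y + z) + norm (x - y) + norm z"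
              using norm_triangle_ineq4[of "y + z + (x - y)" z] norm_triangle_ineq[of "y + z" "x - y"]
              by (simp add: algebra_simps)
            then have "R1 < norm (y + z)"
              using y \<rho> that R1(2) by (simp add: dist_norm)
            then show ?thesis
              by (simp add: f_def)
          qed
          show "(\<integral>\<^sup>+w. (\<integral>\<^sup>+s\<in>{0..h}. f (x + X s w) \<partial>lborel) \<partial>M) \<le> ennreal \<epsilon>" for x
            by (rule h2(2)[OF h(1) hh(2)])
        qed measurable
        finally have "(\<integral>\<^sup>+w. ennreal (?f w) * J w \<partial>M) \<le>
            ennreal C * (emeasure M (exit_event h \<rho>) * ennreal \<epsilon> + ennreal h * emeasure M (exit_event h \<rho>))"
          by (simp add: add_right_mono mult_left_mono)
        also have "\<dots> \<le> ennreal C * (ennreal (h * \<kappa>) * ennreal \<epsilon> + ennreal \<epsilon> * ennreal (h * \<kappa>))"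
          using emeasure_exit_event[OF less_imp_le[OF h(1)] \<rho>(1)] hh(3)
          unfolding \<kappa>_def[symmetric] by (intro mult_left_mono add_mono mult_mono ennreal_leI) auto
        also have "\<dots> = ennreal (C * (h * \<kappa> * \<epsilon> + \<epsilon> * (h * \<kappa>)))"
          using C \<kappa> \<epsilon> h by (simp flip: ennreal_mult ennreal_plus)
        also have "\<dots> \<le> ennreal (h * q)"
          using mult_left_mono[OF \<epsilon>(2) less_imp_le[OF h(1)]] by (intro ennreal_leI) (simp add: algebra_simps)
        finally show ?thesis .
      qed
      have f_int: "integrable M ?f"
        using \<phi>B by (intro integrable_const_bound[where B=C] AE_I2) auto
      have "ennreal (h * q) + ennreal (h * q) = ennreal (h * (2 * q))"
        using h q by (simp flip: ennreal_plus)
      also have "\<dots> \<le> ennreal (expectation ?f)"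
        using h1(2)[OF _ hh(1) y] h by (intro ennreal_leI) simp
      also have "\<dots> = (\<integral>\<^sup>+w. ennreal (?f w) \<partial>M)"
        using f_int \<phi>B by (intro nn_integral_eq_integral[symmetric]) auto
      also have "\<dots> \<le> (\<integral>\<^sup>+w. ennreal (Z w * ?f w) + ennreal (?f w) * J w \<partial>M)"
      proof (rule nn_integral_mono)
        fix w assume "w \<in> space M"
        from mult_left_mono[OF ZJ[OF this], of "ennreal (?f w)"]
        show "ennreal (?f w) \<le> ennreal (Z w * ?f w) + ennreal (?f w) * J w"
          using \<phi>B(1)[of "y + X h w"] by (simp add: distrib_left ennreal_mult' Z_def mult.commute)
      qed
      also have "\<dots> = (\<integral>\<^sup>+w. ennreal (Z w * ?f w) \<partial>M) + (\<integral>\<^sup>+w. ennreal (?f w) * J w \<partial>M)"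
        by (rule nn_integral_add) measurable
      also have "\<dots> \<le> (\<integral>\<^sup>+w. ennreal (Z w * ?f w) \<partial>M) + ennreal (h * q)"
        by (intro add_left_mono J_le)
      finally show ?thesis
        unfolding Z_def by (simp add: ennreal_add_left_cancel_le add.commute)
    qed
    then show ?thesis
      using h0 unfolding q_def I_def B_def \<rho>4 \<rho>_def[symmetric] by blast
  qed
qed

end

section \<open>Iteration of the one-step inequality\<close>

text \<open>A violation would hold on a nonempty open set, which is not negligible. This returns
  from the almost everywhere identities of a solution to pointwise bounds.\<close>

lemma continuous_AE_le:
  fixes f g :: "'a::euclidean_space \<Rightarrow> real"
  assumes "continuous_on UNIV f" "continuous_on UNIV g" and ae: "AE x in lborel. f x \<le> g x"
  shows "f x \<le> g x"
proof (rule ccontr)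
  assume *: "\<not> f x \<le> g x"
  let ?S = "{x. g x < f x}"
  have "open ?S"
    using assms by (intro open_Collect_less)
  moreover have "?S \<in> null_sets lborel"
  proof -
    have "?S = {x \<in> space lborel. \<not> f x \<le> g x}"
      by auto
    moreover have "?S \<in> sets lborel"
      using \<open>open ?S\<close> by simp
    ultimately show ?thesis
      using ae AE_iff_null[of lborel "\<lambda>x. f x \<le> g x"] by simp
  qed
  then have "negligible ?S"
    by (simp add: negligible_iff_null_sets null_sets_completionI)
  moreover have "x \<in> ?S"
    using * by simp
  ultimately show False
    using open_not_negligible[of ?S] by blast
qed

text \<open>Doubling takes the profile from \<open>norm x\<close> to \<open>2 * norm x\<close>,
  monotonicity takes it down to \<open>norm z\<close>, and the two comparisons with
  \<open>\<nu>\<close> cost a factor \<open>C5\<close> each.\<close>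

lemma A1_comparison:
  assumes "A1 \<nu>"
  shows "\<exists>c>0. \<forall>(x :: real^'n) z. 1 \<le> norm x \<longrightarrow> z \<noteq> 0 \<longrightarrow> norm z \<le> 2 * norm x \<longrightarrow> c * \<nu> x \<le> \<nu> z"
proof -
  obtain g C5 C6 where g: "\<And>r. 0 < r \<Longrightarrow> 0 < g r" "antimono_on {0<..} g"
    and C: "1 \<le> C5" "0 < C6"
    and \<nu>: "\<And>x::real^'n. x \<noteq> 0 \<Longrightarrow> inverse C5 * g (norm x) \<le> \<nu> x \<and> \<nu> x \<le> C5 * g (norm x)"
    and d: "\<And>x::real^'n. 1 \<le> norm x \<Longrightarrow> g (norm x) \<le> C6 * g (2 * norm x)"
    using assms unfolding A1_def by blast
  show ?thesis
  proof (intro exI[of _ "1 / (C5 * C5 * C6)"] conjI allI impI)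
    show "0 < 1 / (C5 * C5 * C6)"
      using C by simp
    fix x z :: "real^'n" assume x: "1 \<le> norm x" and z: "z \<noteq> 0" "norm z \<le> 2 * norm x"
    have "x \<noteq> 0"
      using x by auto
    have "\<nu> x \<le> C5 * g (norm x)"
      using \<nu>[OF \<open>x \<noteq> 0\<close>] by simp
    also have "\<dots> \<le> C5 * (C6 * g (2 * norm x))"
      using C d[OF x] by (intro mult_left_mono) auto
    also have "g (2 * norm x) \<le> g (norm z)"
      using z by (intro monotone_onD[OF g(2), THEN order.trans[OF order_refl]]) auto
    also have "g (norm z) \<le> C5 * \<nu> z"
      using \<nu>[OF z(1)] C by (simp add: field_simps)
    finally have "\<nu> x \<le> C5 * (C6 * (C5 * \<nu> z))"
      using C by (simp add: mult_left_mono)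
    then show "1 / (C5 * C5 * C6) * \<nu> x \<le> \<nu> z"
      using C by (simp add: field_simps)
  qed
qed

context symmetric_levy_process
begin

text \<open>The law of \<open>X h\<close> is absolutely continuous, so Lebesgue null sets are missed
  from every starting point. The induction over time steps can thus carry almost everywhere
  bounds.\<close>

lemma AE_X_shift:
  assumes p: "transition_density M X p" and h: "0 < h"
    and [measurable]: "{z. Q z} \<in> sets borel" and ae: "AE z in lborel. Q z"
  shows "AE w in M. Q (y + X h w)"
proof -
  have "distributed M lborel (X h) (p h)"
    using p h by (simp add: transition_density_def)
  then have d: "distr M lborel (X h) = density lborel (p h)" "p h \<in> borel_measurable lborel" "X h \<in> measurable M lborel"
    by (auto simp: distributed_def)
  have "AE z in distr lborel borel ((+) y). Q z"
    using ae by (simp only: lborel_distr_plus)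
  then have "AE z in lborel. Q (y + z)"
    by (rule AE_distrD[rotated]) simp
  then have "AE z in density lborel (p h). Q (y + z)"
    using d(2) by (subst AE_density) auto
  then have "AE z in distr M lborel (X h). Q (y + z)"
    unfolding d(1) .
  then show ?thesis
    by (rule AE_distrD[OF d(3)])
qed

text \<open>The exponent is tested at \<open>a = x / |x|\<^sup>2\<close> of norm
  \<open>1 / |x|\<close>. On the ball of radius \<open>|x| / 4\<close> around \<open>x / 2\<close>
  the product \<open>a \<bullet> z\<close> lies in \<open>[1/4, 3/4]\<close> and the density is at
  least \<open>c * \<nu> x\<close>; the volume of that ball supplies the power of
  \<open>|x|\<close>.\<close>

lemma Psi_ge_nu:
  assumes "A1 \<nu>"
  shows "\<exists>c>0. \<forall>x. 1 \<le> norm x \<longrightarrow> c * norm x ^ CARD('n) * \<nu> x \<le> Psi (1 / norm x)"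
proof -
  obtain c where c: "0 < c" "\<And>x z. 1 \<le> norm x \<Longrightarrow> z \<noteq> 0 \<Longrightarrow> norm z \<le> 2 * norm x \<Longrightarrow> c * \<nu> x \<le> \<nu> z"
    using A1_comparison[OF assms] by blast
  define cc where "cc = 1 - cos (1 / 4 :: real)"
  have cc: "0 < cc"
    using cos_monotone_0_pi[of 0 "1 / 4"] pi_gt3 by (simp add: cc_def)
  define u where "u = unit_ball_vol (real CARD('n))"
  have u: "0 < u"
    by (simp add: u_def)
  show ?thesis
  proof (intro exI[of _ "cc * c * u / 4 ^ CARD('n)"] conjI allI impI)
    show "0 < cc * c * u / 4 ^ CARD('n)"
      using cc c(1) u by simp
    fix x :: "real^'n" assume x: "1 \<le> norm x"
    define r where "r = norm x"
    have r: "0 < r" and x0: "x \<noteq> 0"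
      using x by (simp add: r_def, auto)
    have rr: "0 < r\<^sup>2"
      using r by simp
    define B where "B = ball ((1 / 2) *\<^sub>R x) (r / 4)"
    define a where "a = (1 / r\<^sup>2) *\<^sub>R x"
    have \<nu>x: "0 \<le> \<nu> x"
      using nu_pos[OF x0] by simp
    have "measure lborel B = u * (r / 4) ^ CARD('n)"
      unfolding B_def u_def using content_ball[of "r / 4" "(1 / 2) *\<^sub>R x"] r by simp
    then have "cc * c * u / 4 ^ CARD('n) * r ^ CARD('n) * \<nu> x = (cc * (c * \<nu> x)) * measure lborel B"
      by (simp add: power_divide)
    also have "\<dots> = (LINT z|lborel. (cc * (c * \<nu> x)) * indicator B z)"
      by (simp add: B_def)
    also have "\<dots> \<le> (LINT z|lborel. (1 - cos (a \<bullet> z)) * nu z)"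
    proof (rule integral_mono[OF _ integrable_one_minus_cos_nu])
      show "integrable lborel (\<lambda>z. (cc * (c * \<nu> x)) * indicator B z)"
        unfolding B_def using emeasure_lborel_ball_finite[of "(1 / 2) *\<^sub>R x" "r / 4"] by (intro integrable_mult_right) auto
      fix z
      show "(cc * (c * \<nu> x)) * indicator B z \<le> (1 - cos (a \<bullet> z)) * nu z"
      proof (cases "z \<in> B")
        case True
        define v where "v = z - (1 / 2) *\<^sub>R x"
        have v: "norm v < r / 4"
          using True by (simp add: B_def v_def dist_norm norm_minus_commute)
        have z: "z = v + (1 / 2) *\<^sub>R x"
          by (simp add: v_def)
        have "norm z \<le> norm v + r / 2"
          unfolding z r_def using norm_triangle_ineq[of v "(1 / 2) *\<^sub>R x"] by simp
        then have "norm z \<le> 2 * norm x"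
          using v r unfolding r_def by linarith
        have "\<bar>v \<bullet> x\<bar> \<le> r / 4 * r"
          using Cauchy_Schwarz_ineq2[of v x] v unfolding r_def by (meson less_imp_le mult_right_mono norm_ge_zero order_trans)
        moreover have "z \<bullet> x = v \<bullet> x + r\<^sup>2 / 2"
          unfolding z r_def by (simp add: inner_add_left power2_norm_eq_inner)
        ultimately have zx: "1 / 4 * r\<^sup>2 \<le> z \<bullet> x" "z \<bullet> x \<le> 3 / 4 * r\<^sup>2"
          by (simp_all add: power2_eq_square)
        have az: "a \<bullet> z = (z \<bullet> x) / r\<^sup>2"
          by (simp add: a_def inner_commute)
        have "1 / 4 \<le> a \<bullet> z" "a \<bullet> z \<le> 3 / 4"
          unfolding az by (subst pos_le_divide_eq[OF rr], rule zx(1), subst pos_divide_le_eq[OF rr], rule zx(2))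
        then have "cos (a \<bullet> z) \<le> cos (1 / 4)"
          using pi_gt3 by (intro cos_monotone_0_pi_le) linarith+
        then have v: "cc \<le> 1 - cos (a \<bullet> z)"
          by (simp add: cc_def)
        have "z \<noteq> 0"
          using zx(1) rr by auto
        then have "c * \<nu> x \<le> nu z"
          using c(2)[OF x _ \<open>norm z \<le> 2 * norm x\<close>] by (simp add: nu_eq)
        then have "cc * (c * \<nu> x) \<le> (1 - cos (a \<bullet> z)) * nu z"
          using cc c(1) \<nu>x v by (intro mult_mono) auto
        then show ?thesis
          using True by simp
      qed simp
    qed
    also have "\<dots> \<le> psi a"
      unfolding psi_eq using A_nonneg[of a] by simp
    also have "norm a = 1 / r"
      using r by (simp add: a_def r_def[symmetric] power2_eq_square)
    then have "psi a \<le> Psi (1 / r)"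
      by (intro psi_le_Psi) simp
    finally show "cc * c * u / 4 ^ CARD('n) * norm x ^ CARD('n) * \<nu> x \<le> Psi (1 / norm x)"
      unfolding r_def .
  qed
qed

text \<open>Over one time step the solution gains the contribution of a direct jump to the centre and is
  otherwise propagated along paths staying near \<open>x\<close>. The function \<open>v\<close> controls their survival.\<close>

lemma solution_lower_bound:
  fixes \<phi> V :: "real^'n \<Rightarrow> real" and x :: "real^'n"
  assumes density: "transition_density M X p"
    and sol: "\<And>t. 0 \<le> t \<Longrightarrow> AE y in lborel. feynman_kac M X V t \<phi> y = \<phi> y"
    and cont: "continuous_on UNIV \<phi>" and pos: "\<And>x. 0 < \<phi> x" and x: "x \<noteq> 0"
    and k: "0 \<le> k" "\<And>z. z \<noteq> 0 \<Longrightarrow> norm z \<le> 2 * norm x \<Longrightarrow> k \<le> \<nu> z"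
    and V [measurable]: "V \<in> borel_measurable borel" and kato: "kato_loc M X (\<lambda>x. max 0 (V x))"
    and R1: "\<And>u. R1 < norm u \<Longrightarrow> V u \<le> 1" "8 * R1 \<le> norm x"
    and \<Lambda>: "0 \<le> \<Lambda>" "\<And>u. norm x / 2 \<le> norm u \<Longrightarrow> V u \<le> \<Lambda>"
    and t: "0 < t"
  shows "(1 - cos (5 / 8)) / 8 * k * (LINT z|lborel. \<phi> z * indicator (ball 0 (norm x / 8)) z) * t
    * exp (- \<Lambda> * t) * (1 - t * (2 * exit_const * Psi (8 / norm x))) \<le> \<phi> x"
proof -
  define \<rho> where "\<rho> = norm x / 8"
  have \<rho>: "0 < \<rho>" "norm x = 8 * \<rho>" "8 / norm x = 1 / \<rho>" "norm x / 4 = 2 * \<rho>"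
    using x by (simp_all add: \<rho>_def)
  define q where "q = (1 - cos (5 / 8)) / 8 * k * (LINT z|lborel. \<phi> z * indicator (ball 0 \<rho>) z)"
  have "0 \<le> (LINT z|lborel. \<phi> z * indicator (ball 0 \<rho>) z)"
    using pos by (intro integral_nonneg_AE AE_I2) (simp add: less_imp_le)
  then have q: "0 \<le> q"
    unfolding q_def using k(1) by (intro mult_nonneg_nonneg divide_nonneg_nonneg) auto
  define \<kappa> where "\<kappa> = exit_const * Psi (1 / \<rho>)"
  have \<kappa>: "0 \<le> \<kappa>"
    unfolding \<kappa>_def using \<rho> by (intro mult_nonneg_nonneg exit_const_nonneg Psi_nonneg) auto
  define \<theta> where "\<theta> = 1 - exp (- 1 / 2 :: real)"
  have \<theta>: "0 < \<theta>"
    by (simp add: \<theta>_def)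
  define G where "G y = exp (- (norm (y - x))\<^sup>2 / (2 * \<rho>\<^sup>2))" for y
  \<comment> \<open>Equal to \<open>1\<close> at \<open>x\<close> and at most \<open>0\<close>
    outside \<open>ball x \<rho>\<close>; a step of length \<open>h\<close> lowers its expectation
    by at most \<open>h * \<kappa>\<close>.\<close>
  define v where "v y = 1 - (1 - G y) / \<theta>" for y
  have G: "0 < G y" "G y \<le> 1" for y
    by (simp_all add: G_def)
  have v_le: "v y \<le> 1" for y
    using G[of y] \<theta> by (simp add: v_def)
  have v_bd: "\<bar>v y\<bar> \<le> 1 + 1 / \<theta>" for y
  proof -
    have "(1 - G y) / \<theta> \<le> 1 / \<theta>"
      using G[of y] \<theta> by (intro divide_right_mono) auto
    moreover have "0 \<le> (1 - G y) / \<theta>"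
      using G[of y] \<theta> by simp
    ultimately show ?thesis
      unfolding v_def by linarith
  qed
  have v_ball: "y \<in> ball x \<rho>" if "0 < v y" for y
  proof (rule ccontr)
    assume "y \<notin> ball x \<rho>"
    then have "\<rho> \<le> norm (y - x)"
      by (simp add: dist_norm norm_minus_commute)
    then have "\<rho>\<^sup>2 \<le> (norm (y - x))\<^sup>2"
      using \<rho> by (intro power_mono) auto
    then have "- (norm (y - x))\<^sup>2 / (2 * \<rho>\<^sup>2) \<le> - 1 / 2"
      using \<rho>(1) by (simp add: field_simps)
    then have "\<theta> \<le> 1 - G y"
      unfolding G_def \<theta>_def by simp
    then have "1 \<le> (1 - G y) / \<theta>"
      using \<theta> by simp
    with that show False
      by (simp add: v_def)
  qed
  have v_cont: "continuous_on UNIV v"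
    unfolding v_def G_def using \<theta> \<rho>(1) by (intro continuous_intros) auto
  have [measurable]: "\<phi> \<in> borel_measurable borel"
    using cont by (rule borel_measurable_continuous_onI)
  have [measurable]: "v \<in> borel_measurable borel"
    using v_cont by (rule borel_measurable_continuous_onI)
  define B where "B = ball (0::real^'n) (2 * \<rho>)"
  have [measurable]: "B \<in> sets borel"
    by (simp add: B_def)
  obtain h0 where h0: "0 < h0" and jump: "\<And>h y. 0 < h \<Longrightarrow> h \<le> h0 \<Longrightarrow> y \<in> ball x \<rho> \<Longrightarrow>
    ennreal (h * q) \<le> (\<integral>\<^sup>+w. ennreal (exp (- (LINT s:{0..h}|lborel. V (y + X s w))) *
            (\<phi> (y + X h w) * indicator B (y + X h w))) \<partial>M)"
    using one_step_jump_ge[OF cont pos x k V kato R1]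
    unfolding \<rho>(4) \<rho>_def[symmetric] B_def[symmetric] q_def[symmetric] by blast
  \<comment> \<open>The factor \<open>2 * \<kappa>\<close> counts two losses per unit of time, the
    decrease of \<open>v\<close> and the discarded exit event. Since \<open>q\<close> is a rate, the
    jump contributions of \<open>n\<close> steps add up to \<open>q * (real n * h)\<close>.\<close>
  have step: "AE y in lborel. q * (real n * h) * exp (- \<Lambda> * (real n * h)) * (v y - real n * h * (2 * \<kappa>)) \<le> \<phi> y"
    if h: "0 < h" "h \<le> h0" for h n
  proof (induction n)
    case 0
    show ?case
      using pos by (intro AE_I2) (simp add: less_imp_le)
  next
    case (Suc n)
    note [measurable] = measurable_X[OF less_imp_le[OF h(1)]]
    define a where "a = q * (real n * h) * exp (- \<Lambda> * (real n * h))"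
    have a: "0 \<le> a"
      using q h by (simp add: a_def)
    define b where "b = real n * h * (2 * \<kappa>)"
    have b: "0 \<le> b"
      using h \<kappa> by (simp add: b_def)
    have Q_sets: "{z. a * (v z - b) \<le> \<phi> z} \<in> sets borel"
      by measurable
    have "AE z in lborel. a * (v z - b) \<le> \<phi> z"
      using Suc unfolding a_def b_def .
    note IH = AE_X_shift[OF density h(1) Q_sets this]
    show ?case
      using sol[OF less_imp_le[OF h(1)]]
    proof eventually_elim
      case (elim y)
      define N where "N = exit_event h \<rho>"
      have N_sets [measurable]: "N \<in> sets M"
        unfolding N_def using h by simp
      define Z where "Z w = exp (- (LINT s:{0..h}|lborel. V (y + X s w)))" for w
      let ?\<phi> = "\<lambda>w. \<phi> (y + X h w)"
      have E: "expectation (\<lambda>w. Z w * ?\<phi> w) = \<phi> y"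
        using elim unfolding feynman_kac_def Z_def .
      \<comment> \<open>Otherwise the default value \<open>0\<close> of the integral would be
        \<open>\<phi> y\<close>, against positivity.\<close>
      have int: "integrable M (\<lambda>w. Z w * ?\<phi> w)"
      proof (rule ccontr)
        assume "\<not> integrable M (\<lambda>w. Z w * ?\<phi> w)"
        then have "\<phi> y = 0"
          using E by (simp add: not_integrable_integral_eq)
        then show False
          using pos[of y] by simp
      qed
      let ?D = "v y - real (Suc n) * h * (2 * \<kappa>)"
      let ?a' = "q * (real (Suc n) * h) * exp (- \<Lambda> * (real (Suc n) * h))"
      have a': "0 \<le> ?a'"
        using q h by simp
      show "?a' * ?D \<le> \<phi> y"
      proof (cases "0 < ?D")
        case False
        then have "?a' * ?D \<le> 0"
          using a' by (intro mult_nonneg_nonpos) auto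
        then show ?thesis
          using pos[of y] by linarith
      next
        case True
        have "0 \<le> real (Suc n) * h * (2 * \<kappa>)"
          using h \<kappa> by simp
        with True have "0 < v y"
          by linarith
        then have y: "y \<in> ball x \<rho>"
          by (rule v_ball)
        have yx: "norm (x - y) < \<rho>"
          using y by (simp add: dist_norm)
        have near: "6 * \<rho> \<le> norm (y + X s w)"
          if "w \<in> space M" "w \<notin> N" "0 \<le> s" "s \<le> h" for w s
        proof -
          have "norm (X s w) \<le> \<rho>"
            using norm_X_le_of_notin_exit_event[of w h \<rho> s] that by (simp add: N_def)
          moreover have "norm x \<le> norm (y + X s w) + norm (x - y) + norm (X s w)"
            using norm_triangle_ineq4[of "y + X s w + (x - y)" "X s w"] norm_triangle_ineq[of "y + X s w" "x - y"]
            by (simp add: algebra_simps)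
          ultimately show ?thesis
            using yx \<rho>(2) by linarith
        qed
        have Z_ge: "exp (- \<Lambda> * h) \<le> Z w" if w: "w \<in> space M" "w \<notin> N" for w
        proof -
          have "(LINT s:{0..h}|lborel. V (y + X s w)) \<le> \<Lambda> * h"
          proof (cases "set_integrable lborel {0..h} (\<lambda>s. V (y + X s w))")
            case True
            have "(LINT s:{0..h}|lborel. V (y + X s w)) \<le> (LINT s:{0..h}|lborel. \<Lambda>)"
            proof (rule set_integral_mono[OF True])
              show "set_integrable lborel {0..h} (\<lambda>s. \<Lambda>)"
                by (intro borel_integrable_atLeastAtMost' continuous_intros)
              show "V (y + X s w) \<le> \<Lambda>" if "s \<in> {0..h}" for s
                using near[OF w, of s] that \<rho> by (intro \<Lambda>(2)) simp
            qed
            also have "\<dots> = \<Lambda> * h"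
              using h by (simp add: set_lebesgue_integral_def)
            finally show ?thesis .
          next
            case False
            \<comment> \<open>The default value again; \<open>0 \<le> \<Lambda>\<close> makes it
              harmless.\<close>
            then have "(LINT s:{0..h}|lborel. V (y + X s w)) = 0"
              by (simp add: set_lebesgue_integral_def set_integrable_def not_integrable_integral_eq)
            then show ?thesis
              using \<Lambda>(1) h by simp
          qed
          then show ?thesis
            by (simp add: Z_def)
        qed
        \<comment> \<open>Paths that end in the centre and paths without an exit. The latter end at
          distance at least \<open>6 * \<rho>\<close>, so the two contributions are disjoint and may
          be added.\<close>
        define J where "J w = Z w * ?\<phi> w * indicator B (y + X h w)" for w
        define S where "S w = Z w * ?\<phi> w * indicator (space M - N) w" for w
        have nn: "0 \<le> Z w * ?\<phi> w" for w
          using pos[of "y + X h w"] by (simp add: Z_def)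
        have "{w\<in>space M. y + X h w \<in> B} \<in> sets M"
          by measurable
        from integrable_real_mult_indicator[OF this int] have J_int: "integrable M J"
          unfolding J_def by (rule Bochner_Integration.integrable_cong[OF refl, THEN iffD1, rotated]) (simp add: indicator_def)
        have "space M - N \<in> sets M"
          by measurable
        from integrable_real_mult_indicator[OF this int] have S_int: "integrable M S"
          unfolding S_def .
        have J_ge: "h * q \<le> expectation J"
        proof -
          have "ennreal (h * q) \<le> (\<integral>\<^sup>+w. ennreal (J w) \<partial>M)"
            using jump[OF h y] unfolding J_def Z_def by (simp add: mult.assoc)
          also have "\<dots> = ennreal (expectation J)"
            by (rule nn_integral_eq_integral[OF J_int]) (simp add: J_def nn)
          finally show ?thesis
            by (subst (asm) ennreal_le_iff) (auto intro!: integral_nonneg_AE simp: J_def nn)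
        qed
        have N_le: "prob N \<le> h * \<kappa>"
          using emeasure_exit_event[OF less_imp_le[OF h(1)] \<rho>(1)] h \<kappa>
          unfolding N_def[symmetric] \<kappa>_def[symmetric] emeasure_eq_measure by simp
        have S_ge: "exp (- \<Lambda> * h) * (a * ?D) \<le> expectation S"
        proof -
          let ?v = "\<lambda>w. v (y + X h w)"
          have v_int: "integrable M ?v"
            using v_bd by (intro integrable_const_bound[where B="1 + 1 / \<theta>"] AE_I2) auto
          have G_int: "integrable M (\<lambda>w. G (y + X h w))"
            using G unfolding G_def by (intro integrable_const_bound[where B=1] AE_I2) auto
          have "G y - h * (gauss_const * Psi (1 / \<rho>)) \<le> expectation (\<lambda>w. G (y + X h w))"
            using expectation_gaussian_ge[OF \<rho>(1) less_imp_le[OF h(1)], of "y - x"]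
            unfolding G_def by (simp add: algebra_simps)
          then have "(G y - h * (gauss_const * Psi (1 / \<rho>))) / \<theta> \<le> expectation (\<lambda>w. G (y + X h w)) / \<theta>"
            using \<theta> by (intro divide_right_mono) auto
          moreover have "expectation ?v = 1 - 1 / \<theta> + expectation (\<lambda>w. G (y + X h w)) / \<theta>"
            unfolding v_def diff_divide_distrib using G_int by (simp add: prob_space)
          moreover have "h * (gauss_const * Psi (1 / \<rho>)) / \<theta> = h * \<kappa>"
            by (simp add: \<kappa>_def exit_const_def \<theta>_def)
          ultimately have Ev: "v y - h * \<kappa> \<le> expectation ?v"
            unfolding v_def[of y] diff_divide_distrib by linarith
          have "a * ?D = a * (v y - h * \<kappa> - h * \<kappa> - b)"
            by (simp add: b_def algebra_simps)
          also have "\<dots> \<le> a * (expectation ?v - prob N - b)"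
            using Ev N_le by (intro mult_left_mono a) linarith
          also have "\<dots> = a * expectation (\<lambda>w. ?v w - indicator N w - b)"
            using v_int N_sets by (simp add: prob_space emeasure_eq_measure sets.Int_space_eq2)
          finally have "exp (- \<Lambda> * h) * (a * ?D) \<le> exp (- \<Lambda> * h) * (a * expectation (\<lambda>w. ?v w - indicator N w - b))"
            by (rule mult_left_mono) simp
          also have "\<dots> = expectation (\<lambda>w. exp (- \<Lambda> * h) * (a * (?v w - indicator N w - b)))"
            by simp
          also have "\<dots> \<le> expectation S"
          proof (rule integral_mono_AE)
            show "integrable M (\<lambda>w. exp (- \<Lambda> * h) * (a * (?v w - indicator N w - b)))"
              using v_int N_sets by (intro integrable_mult_right Bochner_Integration.integrable_diff) (auto simp: emeasure_eq_measure)
            show "integrable M S"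
              by (rule S_int)
            show "AE w in M. exp (- \<Lambda> * h) * (a * (?v w - indicator N w - b)) \<le> S w"
              using IH[of y] AE_space
            proof eventually_elim
              case (elim w)
              show ?case
              proof (cases "w \<in> N")
                case True
                \<comment> \<open>Because \<open>v\<close> is at most \<open>1\<close>, subtracting
                  the indicator makes the minorant nonpositive on exiting paths, whose propagation
                  is given up.\<close>
                have "a * (?v w - indicator N w - b) \<le> 0"
                  using True a b v_le[of "y + X h w"] by (intro mult_nonneg_nonpos) auto
                then have "exp (- \<Lambda> * h) * (a * (?v w - indicator N w - b)) \<le> 0"
                  by (rule mult_nonneg_nonpos[rotated]) simp
                then show ?thesis
                  using True by (simp add: S_def)
              next
                case False
                have "exp (- \<Lambda> * h) * (a * (?v w - b)) \<le> exp (- \<Lambda> * h) * ?\<phi> w"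
                  using elim(1) by (intro mult_left_mono) auto
                also have "\<dots> \<le> Z w * ?\<phi> w"
                  using Z_ge[OF elim(2) False] pos[of "y + X h w"] by (intro mult_right_mono) auto
                finally show ?thesis
                  using False elim(2) by (simp add: S_def)
              qed
            qed
          qed
          finally show ?thesis .
        qed
        have "expectation J + expectation S = expectation (\<lambda>w. J w + S w)"
          by (rule Bochner_Integration.integral_add[symmetric, OF J_int S_int])
        also have "\<dots> \<le> expectation (\<lambda>w. Z w * ?\<phi> w)"
        proof (intro integral_mono Bochner_Integration.integrable_add J_int S_int int)
          fix w assume w: "w \<in> space M"
          have "y + X h w \<notin> B" if "w \<notin> N"
            using near[OF w that, of h] h \<rho>(1) by (simp add: B_def)
          then show "J w + S w \<le> Z w * ?\<phi> w"
            using nn[of w] by (auto simp: J_def S_def indicator_def)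
        qed
        finally have JS: "h * q + exp (- \<Lambda> * h) * (a * ?D) \<le> \<phi> y"
          using J_ge S_ge E by linarith
        have e: "exp (- \<Lambda> * (real (Suc n) * h)) = exp (- \<Lambda> * h) * exp (- \<Lambda> * (real n * h))"
          by (simp add: algebra_simps flip: exp_add)
        have "exp (- \<Lambda> * (real (Suc n) * h)) \<le> 1"
          using \<Lambda>(1) h by simp
        moreover have "?D \<le> 1"
          using v_le[of y] \<open>0 \<le> real (Suc n) * h * (2 * \<kappa>)\<close> by linarith
        ultimately have "exp (- \<Lambda> * (real (Suc n) * h)) * ?D \<le> 1 * 1"
          using True by (intro mult_mono) auto
        \<comment> \<open>The newest jump contribution \<open>h * q\<close> is weakened by the
          survival factors of the whole time span, so that it takes the same form as the propagated
          ones.\<close>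
        then have "h * q * (exp (- \<Lambda> * (real (Suc n) * h)) * ?D) \<le> h * q * 1"
          using q h by (intro mult_left_mono) auto
        moreover have "?a' * ?D = h * q * (exp (- \<Lambda> * (real (Suc n) * h)) * ?D) + exp (- \<Lambda> * h) * (a * ?D)"
          unfolding a_def e by (simp add: algebra_simps)
        ultimately show ?thesis
          using JS by linarith
      qed
    qed
  qed
  obtain n where n0: "t / h0 < real n"
    using reals_Archimedean2 by blast
  moreover have "0 < t / h0"
    using t h0 by simp
  ultimately have "0 < real n"
    by linarith
  then have n: "0 < n" "t / h0 \<le> real n"
    using n0 by simp_all
  define h where "h = t / real n"
  have h: "0 < h" "h \<le> h0" "real n * h = t"
    using n t h0 by (simp_all add: h_def field_simps)
  have "q * t * exp (- \<Lambda> * t) * (v x - t * (2 * \<kappa>)) \<le> \<phi> x"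
  \<comment> \<open>Continuity allows evaluation at \<open>x\<close> itself, where \<open>v\<close>
    equals one.\<close>
  proof (rule continuous_AE_le[where g=\<phi> and x=x and f="\<lambda>y. q * t * exp (- \<Lambda> * t) * (v y - t * (2 * \<kappa>))"])
    show "continuous_on UNIV (\<lambda>y. q * t * exp (- \<Lambda> * t) * (v y - t * (2 * \<kappa>)))"
      by (intro continuous_intros v_cont)
    show "AE y in lborel. q * t * exp (- \<Lambda> * t) * (v y - t * (2 * \<kappa>)) \<le> \<phi> y"
      using step[OF h(1,2), of n] unfolding h(3) .
  qed (rule cont)
  then show ?thesis
    unfolding q_def \<kappa>_def \<rho>(3) \<rho>_def[symmetric] by (simp add: v_def G_def mult.assoc)
qed

text \<open>The time \<open>t\<close> stays free, subject only to being too short for killing by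
  \<open>V\<close> or for leaving the neighbourhood of \<open>x\<close>. The larger of the two rates
  will fix it later.\<close>

lemma solution_core_bound:
  fixes \<phi> V :: "real^'n \<Rightarrow> real"
  assumes density: "transition_density M X p" and A1: "A1 \<nu>" and A4: "A4 M X V r0"
    and sol: "\<And>t. 0 \<le> t \<Longrightarrow> AE y in lborel. feynman_kac M X V t \<phi> y = \<phi> y"
    and cont: "continuous_on UNIV \<phi>" and pos: "\<And>x. 0 < \<phi> x"
  shows "\<exists>c>0. \<exists>R. \<forall>x t. R \<le> norm x \<longrightarrow> 0 < t \<longrightarrow> (\<forall>u. norm x / 2 \<le> norm u \<longrightarrow> t * V u \<le> 1) \<longrightarrow>
    t * Psi (1 / norm x) \<le> 1 \<longrightarrow>
    c * t * \<nu> x * (LINT z|lborel. \<phi> z * indicator (ball 0 (norm x / 8)) z) \<le> \<phi> x"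
proof -
  obtain c where c: "0 < c" "\<And>x z. 1 \<le> norm x \<Longrightarrow> z \<noteq> 0 \<Longrightarrow> norm z \<le> 2 * norm x \<Longrightarrow> c * \<nu> x \<le> \<nu> z"
    using A1_comparison[OF A1] by blast
  have kp: "kato_potential M X V" and V0: "(V \<longlongrightarrow> 0) at_infinity"
    using A4 by (auto simp: A4_def)
  have V [measurable]: "V \<in> borel_measurable borel" and kato: "kato_loc M X (\<lambda>x. max 0 (V x))"
    using kp by (auto simp: kato_potential_def)
  have "\<forall>\<^sub>F u in at_infinity. V u < 1"
    using V0 by (rule order_tendstoD) simp
  then obtain R1 where R1: "\<And>u. R1 \<le> norm u \<Longrightarrow> V u < 1"
    unfolding eventually_at_infinity by blast
  \<comment> \<open>Shortening the time by this factor makes the exit loss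
    \<open>128 * exit_const / m\<close> at most one half; \<open>128\<close> is
    \<open>2 * 64\<close>, the \<open>64\<close> coming from
    \<open>Psi (8 / norm x)\<close>.\<close>
  define m where "m = 256 * exit_const + 1"
  have m: "1 \<le> m"
    using exit_const_nonneg by (simp add: m_def)
  define cc where "cc = 1 - cos (5 / 8 :: real)"
  have cc: "0 < cc"
    using cos_monotone_0_pi[of 0 "5 / 8"] pi_gt3 by (simp add: cc_def)
  define C where "C = cc / 8 * c * exp (- 1) / 2 / m"
  have C: "0 < C"
    using cc c(1) m by (simp add: C_def)
  have main: "C * t * \<nu> x * (LINT z|lborel. \<phi> z * indicator (ball 0 (norm x / 8)) z) \<le> \<phi> x"
    if x: "max 1 (8 * R1) \<le> norm x" and t: "0 < t" "\<And>u. norm x / 2 \<le> norm u \<Longrightarrow> t * V u \<le> 1" "t * Psi (1 / norm x) \<le> 1" for x t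
  proof -
    have x1: "1 \<le> norm x" "x \<noteq> 0"
      using x by auto
    define I where "I = (LINT z|lborel. \<phi> z * indicator (ball 0 (norm x / 8)) z)"
    have I: "0 \<le> I"
      unfolding I_def using pos by (intro integral_nonneg_AE AE_I2) (simp add: less_imp_le)
    have \<nu>x: "0 < \<nu> x"
      using nu_pos x1 by blast
    define t' where "t' = t / m"
    have t': "0 < t'" "t' \<le> t"
      using t m by (simp_all add: t'_def divide_le_eq)
    have "Psi (8 / norm x) \<le> 64 * Psi (1 / norm x)"
      using Psi_of_nat_scale[of "1 / norm x" 8] by simp
    then have "2 * exit_const * Psi (8 / norm x) \<le> 2 * exit_const * (64 * Psi (1 / norm x))"
      using exit_const_nonneg by (intro mult_left_mono) auto
    then have "t' * (2 * exit_const * Psi (8 / norm x)) \<le> t' * (2 * exit_const * (64 * Psi (1 / norm x)))"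
      by (rule mult_left_mono) (simp add: t' less_imp_le)
    also have "\<dots> = 128 * exit_const / m * (t * Psi (1 / norm x))"
      by (simp add: t'_def)
    also have "\<dots> \<le> 128 * exit_const / m * 1"
      using t(3) exit_const_nonneg m by (intro mult_left_mono) auto
    also have "\<dots> \<le> 1 / 2"
      using m by (simp add: m_def divide_le_eq)
    finally have half: "1 / 2 \<le> 1 - t' * (2 * exit_const * Psi (8 / norm x))"
      by simp
    have "- 1 \<le> - (1 / t) * t'"
      using t t' by (simp add: divide_le_eq)
    then have e: "exp (- 1) \<le> exp (- (1 / t) * t')"
      by (simp only: exp_le_cancel_iff)
    have "C * t * \<nu> x * I = cc / 8 * (c * \<nu> x) * I * t' * (exp (- 1) * (1 / 2))"
      by (simp add: C_def t'_def)
    also have "\<dots> \<le> cc / 8 * (c * \<nu> x) * I * t' * (exp (- (1 / t) * t') * (1 - t' * (2 * exit_const * Psi (8 / norm x))))"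
      using cc c(1) \<nu>x I t' e half by (intro mult_left_mono mult_mono mult_nonneg_nonneg) auto
    also have "\<dots> = cc / 8 * (c * \<nu> x) * I * t' * exp (- (1 / t) * t') * (1 - t' * (2 * exit_const * Psi (8 / norm x)))"
      by (simp only: mult.assoc)
    also have "\<dots> \<le> \<phi> x"
      unfolding I_def cc_def
    proof (rule solution_lower_bound[OF density sol cont pos x1(2) _ _ V kato, where ?R1.0=R1])
      show "0 \<le> c * \<nu> x"
        using c(1) \<nu>x by simp
      show "c * \<nu> x \<le> \<nu> z" if "z \<noteq> 0" "norm z \<le> 2 * norm x" for z
        using c(2)[OF x1(1) that] .
      show "V u \<le> 1" if "R1 < norm u" for u
        using R1[of u] that by simp
      show "V u \<le> 1 / t" if "norm x / 2 \<le> norm u" for u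
        using t(2)[OF that] t(1) by (simp add: field_simps)
    qed (use x t t' in auto)
    finally show ?thesis
      unfolding I_def .
  qed
  show ?thesis
    using C main by (intro exI[of _ C] conjI exI[of _ "max 1 (8 * R1)"]) blast+
qed

end

section \<open>Growth over annuli\<close>

text \<open>The increment uses \<open>f k\<close> in place of \<open>f (Suc k)\<close>. The
  exponential lower bounds for the two differ by at most the factor \<open>exp (\<eta> * K)\<close>,
  which stays below \<open>3\<close> for small \<open>\<eta>\<close>, so the delay is absorbed by
  lowering the growth rate.\<close>

lemma delayed_gronwall:
  fixes f \<delta> :: "nat \<Rightarrow> real"
  assumes c: "0 < c" and K: "0 < K" and \<delta>: "\<And>k. 0 \<le> \<delta> k" "\<And>k. \<delta> k \<le> K"
    and f0: "0 < f 0" and mono: "\<And>k. f k \<le> f (Suc k)"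
    and rec: "\<And>k. f (Suc k) + c * \<delta> (Suc k) * f k \<le> f (Suc (Suc k))"
  shows "\<exists>\<eta>>0. \<exists>\<alpha>>0. \<forall>k. \<alpha> * exp (\<eta> * (\<Sum>j<k. \<delta> j)) \<le> f k"
proof -
  \<comment> \<open>With \<open>\<eta> * K \<le> 1\<close> one has
    \<open>exp (\<eta> * d) \<le> 1 + 2 * \<eta> * d\<close>, and \<open>\<eta> \<le> c / 6\<close>
    puts this below \<open>1 + c * d / 3\<close>.\<close>
  define \<eta> where "\<eta> = min (1 / K) (c / 6)"
  \<comment> \<open>The factor pays for the first annulus, so that monotonicity alone settles
    \<open>k = 1\<close>.\<close>
  define \<alpha> where "\<alpha> = f 0 * exp (- \<eta> * K)"
  have \<eta>: "0 < \<eta>" "\<eta> * K \<le> 1" "\<eta> \<le> c / 6"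
    using c K by (simp_all add: \<eta>_def min_def field_simps)
  have \<alpha>: "0 < \<alpha>"
    using f0 by (simp add: \<alpha>_def)
  have one_third: "1 / 3 \<le> exp (- \<eta> * K)"
  proof -
    have "exp (\<eta> * K) \<le> 3"
      by (rule order_trans[OF _ exp_le]) (use \<eta>(2) in simp)
    then have "inverse 3 \<le> inverse (exp (\<eta> * K))"
      by (intro le_imp_inverse_le) auto
    then show ?thesis
      by (simp add: exp_minus inverse_eq_divide)
  qed
  have step: "exp (\<eta> * d) \<le> 1 + c * d * exp (- \<eta> * K)" if d: "0 \<le> d" "d \<le> K" for d
  proof -
    have x: "0 \<le> \<eta> * d"
      using d \<eta> by simp
    have "\<eta> * d \<le> \<eta> * K"
      using d \<eta> by (intro mult_left_mono) auto
    then have x': "\<eta> * d \<le> 1"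
      using \<eta>(2) by linarith
    have "exp (\<eta> * d) \<le> 1 + \<eta> * d + (\<eta> * d)\<^sup>2"
      by (rule exp_bound[OF x x'])
    also have "(\<eta> * d)\<^sup>2 \<le> \<eta> * d * 1"
      unfolding power2_eq_square by (rule mult_left_mono[OF x' x])
    also have "1 + \<eta> * d + \<eta> * d * 1 = 1 + 2 * \<eta> * d"
      by simp
    also have "2 * \<eta> * d \<le> c * d * (1 / 3)"
      using mult_right_mono[OF \<eta>(3) d(1)] by simp
    also have "c * d * (1 / 3) \<le> c * d * exp (- \<eta> * K)"
      using one_third c d by (intro mult_left_mono) auto
    finally show ?thesis
      by simp
  qed
  have "\<alpha> * exp (\<eta> * (\<Sum>j<k. \<delta> j)) \<le> f k" for k
  proof (induction k rule: less_induct)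
    case (less k)
    consider "k = 0" | "k = 1" | m where "k = Suc (Suc m)"
      by (metis One_nat_def not0_implies_Suc)
    then show ?case
    proof cases
      case 1
      then show ?thesis
        using f0 \<eta> K by (simp add: \<alpha>_def mult_le_cancel_left1)
    next
      case 2
      have "\<eta> * \<delta> 0 \<le> \<eta> * K"
        using \<delta> \<eta> by (intro mult_left_mono) auto
      then have "exp (- \<eta> * K) * exp (\<eta> * \<delta> 0) \<le> 1"
        by (simp flip: exp_add)
      then have "f 0 * (exp (- \<eta> * K) * exp (\<eta> * \<delta> 0)) \<le> f 0"
        using f0 by (simp add: mult_le_cancel_left1)
      then show ?thesis
        using 2 mono[of 0] by (simp add: \<alpha>_def mult.assoc)
    next
      case (3 m)
      define s where "s = (\<Sum>j<m. \<delta> j)"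
      define s' where "s' = s + \<delta> m"
      have IH: "\<alpha> * exp (\<eta> * s) \<le> f m" "\<alpha> * exp (\<eta> * s') \<le> f (Suc m)"
        using less[of m] less[of "Suc m"] 3 by (simp_all add: s_def s'_def)
      have "exp (\<eta> * s' - \<eta> * K) \<le> exp (\<eta> * s)"
        using mult_left_mono[OF \<delta>(2)[of m], of \<eta>] \<eta>(1) by (simp add: s'_def distrib_left)
      moreover have "exp (\<eta> * s' - \<eta> * K) = exp (\<eta> * s') * exp (- \<eta> * K)"
        by (simp flip: exp_add)
      ultimately have "\<alpha> * (exp (\<eta> * s') * exp (- \<eta> * K)) \<le> \<alpha> * exp (\<eta> * s)"
        using \<alpha> by (intro mult_left_mono) auto
      with IH(1) have le: "\<alpha> * (exp (\<eta> * s') * exp (- \<eta> * K)) \<le> f m"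
        by linarith
      have "\<alpha> * exp (\<eta> * (s' + \<delta> (Suc m))) = \<alpha> * exp (\<eta> * s') * exp (\<eta> * \<delta> (Suc m))"
        by (simp add: distrib_left exp_add)
      also have "\<dots> \<le> \<alpha> * exp (\<eta> * s') * (1 + c * \<delta> (Suc m) * exp (- \<eta> * K))"
        using \<alpha> by (intro mult_left_mono step \<delta>) auto
      also have "\<dots> = \<alpha> * exp (\<eta> * s') + c * \<delta> (Suc m) * (\<alpha> * (exp (\<eta> * s') * exp (- \<eta> * K)))"
        by (simp add: algebra_simps)
      also have "\<dots> \<le> f (Suc m) + c * \<delta> (Suc m) * f m"
        using IH(2) le c \<delta>(1) by (intro add_mono mult_left_mono) auto
      also have "\<dots> \<le> f (Suc (Suc m))"
        by (rule rec)
      finally show ?thesis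
        using 3 by (simp add: s_def s'_def add.assoc)
    qed
  qed
  then show ?thesis
    using \<eta>(1) \<alpha> by blast
qed

text \<open>Integrating the pointwise bound over an annulus bounds the growth of the mass of
  \<open>\<phi>\<close> on balls by that mass at an earlier radius. The resulting growth is put back
  into the pointwise bound. \<open>H\<close> is \<open>ennreal\<close> valued, as it may be infinite
  at moderate radii.\<close>

lemma self_improving_lower_bound:
  fixes \<phi> :: "real^'n \<Rightarrow> real" and H :: "real^'n \<Rightarrow> ennreal"
  assumes cont: "continuous_on UNIV \<phi>" and pos: "\<And>x. 0 < \<phi> x" and H [measurable]: "H \<in> borel_measurable borel"
    and c: "0 < c" and K0: "0 < K0" and H_le: "\<And>x. R0 \<le> norm x \<Longrightarrow> H x \<le> ennreal (K0 / norm x ^ CARD('n))"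
    and core: "\<And>x. R0 \<le> norm x \<Longrightarrow>
      ennreal c * H x * ennreal (LINT z|lborel. \<phi> z * indicator (ball 0 (norm x / 8)) z) \<le> ennreal (\<phi> x)"
  shows "\<exists>\<eta>>0. \<exists>C>0. \<exists>R\<ge>a0. \<forall>z. R < norm z \<longrightarrow>
    ennreal C * H z * ennreal (exp (\<eta> * enn2real (\<integral>\<^sup>+y\<in>{y. a0 \<le> norm y \<and> norm y \<le> norm z}. H y \<partial>lborel))) \<le> ennreal (\<phi> z)"
proof -
  define R where "R = max 1 (max R0 a0)"
  have R: "1 \<le> R" "R0 \<le> R" "a0 \<le> R"
    by (auto simp: R_def)
  have [measurable]: "\<phi> \<in> borel_measurable borel"
    using cont by (rule borel_measurable_continuous_onI)
  have [measurable]: "ball (0::real^'n) r \<in> sets borel" for r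
    by simp
  define F where "F r = (LINT z|lborel. \<phi> z * indicator (ball 0 r) z)" for r
  have F_int: "integrable lborel (\<lambda>z. \<phi> z * indicator (ball 0 r) z)" for r
  proof -
    obtain C where "\<forall>x\<in>cball 0 r. \<bar>\<phi> x\<bar> \<le> C"
      using continuous_bounded_on_cball[OF cont] by blast
    then show ?thesis
      by (intro integrable_on_ball[where C=C]) auto
  qed
  have F_nn: "ennreal (F r) = (\<integral>\<^sup>+z\<in>ball 0 r. ennreal (\<phi> z) \<partial>lborel)" for r
  proof -
    have "(\<integral>\<^sup>+z\<in>ball 0 r. ennreal (\<phi> z) \<partial>lborel) = (\<integral>\<^sup>+z. ennreal (\<phi> z * indicator (ball 0 r) z) \<partial>lborel)"
      by (intro nn_integral_cong) (simp add: indicator_def)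
    also have "\<dots> = ennreal (F r)"
      unfolding F_def by (rule nn_integral_eq_integral[OF F_int]) (use pos in \<open>auto simp: less_imp_le\<close>)
    finally show ?thesis ..
  qed
  have F_nonneg: "0 \<le> F r" for r
    unfolding F_def using pos by (intro integral_nonneg_AE AE_I2) (simp add: less_imp_le)
  have F_mono: "F r \<le> F s" if "r \<le> s" for r s
    unfolding F_def
  proof (rule integral_mono[OF F_int F_int])
    fix z :: "real^'n"
    show "\<phi> z * indicator (ball 0 r) z \<le> \<phi> z * indicator (ball 0 s) z"
      using that pos[of z] by (auto simp: indicator_def)
  qed
  have F_pos: "0 < F r" if r: "0 < r" for r
  proof (rule ccontr)
    assume "\<not> 0 < F r"
    then have "(\<integral>\<^sup>+z\<in>ball 0 r. ennreal (\<phi> z) \<partial>lborel) = 0"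
      using F_nn[of r] F_nonneg[of r] by simp
    then have "AE z in lborel. ennreal (\<phi> z) * indicator (ball 0 r) z = 0"
      by (subst (asm) nn_integral_0_iff_AE) auto
    then have "AE z in lborel. z \<notin> ball (0::real^'n) r"
    proof eventually_elim
      case (elim z)
      then show ?case
        using pos[of z] by (auto simp: indicator_def ennreal_eq_0_iff split: if_splits)
    qed
    then have "ball (0::real^'n) r \<in> null_sets lborel"
      by (subst AE_iff_null_sets) auto
    then have "negligible (ball (0::real^'n) r)"
      by (simp add: negligible_iff_null_sets null_sets_completionI)
    then show False
      using open_not_negligible[of "ball (0::real^'n) r"] r by auto
  qed
  \<comment> \<open>The ratio \<open>8\<close> matches the radius \<open>norm x / 8\<close>: for
    \<open>y\<close> in annulus \<open>k + 1\<close> the ball of radius \<open>norm y / 8\<close>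
    contains the one of radius \<open>r k\<close>.\<close>
  define r where "r k = 8 ^ k * R" for k :: nat
  have r: "R \<le> r k" "r (Suc k) = 8 * r k" for k
    using R by (simp_all add: r_def)
  have r_mono: "r j \<le> r k" if "j \<le> k" for j k
    using that R unfolding r_def by (intro mult_right_mono power_increasing) auto
  define A where "A k = {y::real^'n. r k \<le> norm y \<and> norm y < r (Suc k)}" for k
  have [measurable]: "A k \<in> sets borel" for k
    unfolding A_def by measurable
  define vol where "vol = unit_ball_vol (real CARD('n))"
  have vol: "0 < vol"
    by (simp add: vol_def)
  define K where "K = K0 * vol * 8 ^ CARD('n)"
  have K: "0 < K"
    using K0 vol by (simp add: K_def)
  \<comment> \<open>The power decay of \<open>H\<close> is compensated by the volume of the
    enclosing ball of radius \<open>8 * r k\<close>, so the bound is the same for all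
    annuli.\<close>
  have A_le: "(\<integral>\<^sup>+y\<in>A k. H y \<partial>lborel) \<le> ennreal K" for k
  proof -
    have rk: "0 < r k" "R0 \<le> r k"
      using r(1)[of k] R by auto
    have "(\<integral>\<^sup>+y\<in>A k. H y \<partial>lborel) \<le> (\<integral>\<^sup>+y. ennreal (K0 / r k ^ CARD('n)) * indicator (ball (0::real^'n) (r (Suc k))) y \<partial>lborel)"
    proof (rule nn_integral_mono)
      fix y :: "real^'n"
      show "H y * indicator (A k) y \<le> ennreal (K0 / r k ^ CARD('n)) * indicator (ball 0 (r (Suc k))) y"
      proof (cases "y \<in> A k")
        case True
        then have y: "r k \<le> norm y" "norm y < r (Suc k)"
          by (auto simp: A_def)
        then have "H y \<le> ennreal (K0 / norm y ^ CARD('n))"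
          using rk by (intro H_le) linarith
        also have "\<dots> \<le> ennreal (K0 / r k ^ CARD('n))"
          using y rk K0 by (intro ennreal_leI divide_left_mono power_mono mult_pos_pos zero_less_power) auto
        finally show ?thesis
          using y True by simp
      qed simp
    qed
    also have "\<dots> = ennreal (K0 / r k ^ CARD('n)) * ennreal (vol * r (Suc k) ^ CARD('n))"
      using emeasure_ball[of "r (Suc k)" "0::real^'n"] r(1)[of "Suc k"] R
      by (subst nn_integral_cmult_indicator) (auto simp: vol_def)
    also have "\<dots> = ennreal K"
      using rk K0 vol unfolding r(2) K_def by (subst ennreal_mult[symmetric]) (auto simp: power_mult_distrib)
    finally show ?thesis .
  qed
  define \<delta> where "\<delta> k = enn2real (\<integral>\<^sup>+y\<in>A k. H y \<partial>lborel)" for k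
  have \<delta>_nn: "(\<integral>\<^sup>+y\<in>A k. H y \<partial>lborel) = ennreal (\<delta> k)" for k
    unfolding \<delta>_def using A_le[of k] by (intro ennreal_enn2real[symmetric]) (auto intro: le_less_trans)
  have \<delta>: "0 \<le> \<delta> k" "\<delta> k \<le> K" for k
    using A_le[of k] K unfolding \<delta>_nn by (auto simp: \<delta>_def)
  have rec: "F (r (Suc k)) + c * \<delta> (Suc k) * F (r k) \<le> F (r (Suc (Suc k)))" for k
  proof -
    have "ennreal c * ennreal (F (r k)) * ennreal (\<delta> (Suc k)) =
        (\<integral>\<^sup>+y. ennreal c * ennreal (F (r k)) * (H y * indicator (A (Suc k)) y) \<partial>lborel)"
      unfolding \<delta>_nn[symmetric] by (rule nn_integral_cmult[symmetric]) measurable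
    also have "\<dots> \<le> (\<integral>\<^sup>+y\<in>A (Suc k). ennreal (\<phi> y) \<partial>lborel)"
    proof (rule nn_integral_mono)
      fix y
      show "ennreal c * ennreal (F (r k)) * (H y * indicator (A (Suc k)) y) \<le> ennreal (\<phi> y) * indicator (A (Suc k)) y"
      proof (cases "y \<in> A (Suc k)")
        case True
        then have y: "8 * r k \<le> norm y"
          unfolding A_def using r(2)[of k] by simp
        then have "R0 \<le> norm y"
          using r(1)[of k] R by linarith
        have "ennreal c * ennreal (F (r k)) * H y = ennreal c * H y * ennreal (F (r k))"
          by (simp only: mult_ac)
        also have "\<dots> \<le> ennreal c * H y * ennreal (F (norm y / 8))"
          using y by (intro mult_left_mono ennreal_leI F_mono) auto
        also have "\<dots> \<le> ennreal (\<phi> y)"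
          using core[OF \<open>R0 \<le> norm y\<close>] unfolding F_def .
        finally show ?thesis
          using True by simp
      qed simp
    qed
    finally have 1: "ennreal c * ennreal (F (r k)) * ennreal (\<delta> (Suc k)) \<le> (\<integral>\<^sup>+y\<in>A (Suc k). ennreal (\<phi> y) \<partial>lborel)" .
    have "ennreal (F (r (Suc k)) + c * \<delta> (Suc k) * F (r k)) =
        ennreal (F (r (Suc k))) + ennreal c * ennreal (F (r k)) * ennreal (\<delta> (Suc k))"
      using c \<delta>(1) F_nonneg by (simp add: ennreal_plus ennreal_mult mult_ac)
    also have "\<dots> \<le> (\<integral>\<^sup>+z\<in>ball 0 (r (Suc k)). ennreal (\<phi> z) \<partial>lborel) + (\<integral>\<^sup>+y\<in>A (Suc k). ennreal (\<phi> y) \<partial>lborel)"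
      unfolding F_nn by (intro add_left_mono 1[unfolded F_nn])
    also have "\<dots> = (\<integral>\<^sup>+z. ennreal (\<phi> z) * indicator (ball 0 (r (Suc k))) z + ennreal (\<phi> z) * indicator (A (Suc k)) z \<partial>lborel)"
      by (rule nn_integral_add[symmetric]) measurable
    also have "\<dots> \<le> ennreal (F (r (Suc (Suc k))))"
      unfolding F_nn
    proof (rule nn_integral_mono)
      fix z :: "real^'n"
      show "ennreal (\<phi> z) * indicator (ball 0 (r (Suc k))) z + ennreal (\<phi> z) * indicator (A (Suc k)) z
        \<le> ennreal (\<phi> z) * indicator (ball 0 (r (Suc (Suc k)))) z"
        using r_mono[of "Suc k" "Suc (Suc k)"] by (auto simp: indicator_def A_def)
    qed
    finally show ?thesis
      using F_nonneg by (simp add: ennreal_le_iff)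
  qed
  obtain \<eta> \<alpha> where \<eta>: "0 < \<eta>" and \<alpha>: "0 < \<alpha>"
    and grow: "\<And>k. \<alpha> * exp (\<eta> * (\<Sum>j<k. \<delta> j)) \<le> F (r k)"
  proof -
    have "\<exists>\<eta>>0. \<exists>\<alpha>>0. \<forall>k. \<alpha> * exp (\<eta> * (\<Sum>j<k. \<delta> j)) \<le> F (r k)"
    proof (rule delayed_gronwall[where f="\<lambda>k. F (r k)", OF c K \<delta>])
      show "0 < F (r 0)"
        using r(1)[of 0] R by (intro F_pos) linarith
      show "F (r k) \<le> F (r (Suc k))" for k
        by (intro F_mono r_mono) simp
    qed (rule rec)
    then show ?thesis
      using that by blast
  qed
  define H0 where "H0 = (\<integral>\<^sup>+y\<in>{y. a0 \<le> norm y \<and> norm y < R}. H y \<partial>lborel)"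
  \<comment> \<open>Two things are missing from the exponent that the recursion yields: the last two
    annuli below \<open>norm z\<close>, worth \<open>K\<close> each, and the region between
    \<open>a0\<close> and \<open>R\<close>, worth \<open>H0\<close>.\<close>
  define C where "C = c * \<alpha> * exp (- \<eta> * (2 * K + enn2real H0))"
  have C: "0 < C"
    using c \<alpha> by (simp add: C_def)
  have "ennreal C * H z * ennreal (exp (\<eta> * enn2real (\<integral>\<^sup>+y\<in>{y. a0 \<le> norm y \<and> norm y \<le> norm z}. H y \<partial>lborel))) \<le> ennreal (\<phi> z)"
    if z: "8 * R < norm z" for z
  proof -
    define T where "T = (\<integral>\<^sup>+y\<in>{y. a0 \<le> norm y \<and> norm y \<le> norm z}. H y \<partial>lborel)"
    obtain N where N: "norm z / R < 8 ^ N"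
      using real_arch_pow[of 8 "norm z / R"] by auto
    then have "norm z < r N"
      using R by (simp add: r_def field_simps)
    define n where "n = (LEAST n. norm z < r n)"
    have n: "norm z < r n"
      unfolding n_def using \<open>norm z < r N\<close> by (rule LeastI)
    have n_min: "r m \<le> norm z" if "m < n" for m
      using that not_less_Least[of m "\<lambda>n. norm z < r n"] unfolding n_def by simp
    have "n \<noteq> 0"
    proof
      assume "n = 0"
      then have "norm z < R"
        using n by (simp add: r_def)
      then show False
        using z R by linarith
    qed
    moreover have "n \<noteq> 1"
    proof
      assume "n = 1"
      then have "norm z < 8 * R"
        using n by (simp add: r_def)
      then show False
        using z by linarith
    qed
    ultimately obtain m where m: "n = Suc (Suc m)"
      by (metis One_nat_def not0_implies_Suc)
    have zm: "8 * r m \<le> norm z"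
      using n_min[of "Suc m"] m r(2)[of m] by simp
    have T_le: "enn2real T \<le> enn2real H0 + (\<Sum>j<n. \<delta> j)"
    proof (cases "H0 = \<infinity>")
      \<comment> \<open>The whole integral is then infinite too, and \<open>enn2real\<close> sends
        it to \<open>0\<close>.\<close>
      case True
      have "H0 \<le> T"
        unfolding H0_def T_def using z R by (intro nn_integral_mono) (auto simp: indicator_def)
      then have "T = \<infinity>"
        using True by (simp add: top_unique)
      then show ?thesis
        using \<delta>(1) by (simp add: sum_nonneg)
    next
      case False
      have "T \<le> (\<integral>\<^sup>+y. H y * indicator {y. a0 \<le> norm y \<and> norm y < R} y + (\<Sum>j<n. H y * indicator (A j) y) \<partial>lborel)"
        unfolding T_def
      proof (rule nn_integral_mono)
        fix y :: "real^'n"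
        show "H y * indicator {y. a0 \<le> norm y \<and> norm y \<le> norm z} y
          \<le> H y * indicator {y. a0 \<le> norm y \<and> norm y < R} y + (\<Sum>j<n. H y * indicator (A j) y)"
        proof (cases "a0 \<le> norm y \<and> norm y \<le> norm z \<and> R \<le> norm y")
          case True
          define l where "l = (LEAST l. norm y < r l)"
          have yn: "norm y < r n"
            using True n by linarith
          have l: "norm y < r l" "l \<le> n"
            unfolding l_def using yn by (rule LeastI, intro Least_le)
          have "l \<noteq> 0"
          proof
            assume "l = 0"
            then have "norm y < R"
              using l by (simp add: r_def)
            then show False
              using True by linarith
          qed
          then obtain j where j: "l = Suc j"
            by (metis not0_implies_Suc)
          have "r j \<le> norm y"
            using not_less_Least[of j "\<lambda>l. norm y < r l"] j unfolding l_def by simp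
          then have "y \<in> A j" "j < n"
            using l j by (auto simp: A_def)
          then have "H y * indicator {y. a0 \<le> norm y \<and> norm y \<le> norm z} y \<le> H y * indicator (A j) y"
            by (simp add: indicator_def)
          also have "\<dots> \<le> (\<Sum>j<n. H y * indicator (A j) y)"
            using \<open>j < n\<close> by (intro member_le_sum) auto
          also have "\<dots> \<le> H y * indicator {y. a0 \<le> norm y \<and> norm y < R} y + (\<Sum>j<n. H y * indicator (A j) y)"
            by simp
          finally show ?thesis .
        qed (auto simp: indicator_def)
      qed
      also have "\<dots> = H0 + (\<integral>\<^sup>+y. (\<Sum>j<n. H y * indicator (A j) y) \<partial>lborel)"
        unfolding H0_def by (rule nn_integral_add) measurable
      also have "(\<integral>\<^sup>+y. (\<Sum>j<n. H y * indicator (A j) y) \<partial>lborel) = (\<Sum>j<n. ennreal (\<delta> j))"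
        unfolding \<delta>_nn[symmetric] by (rule nn_integral_sum) measurable
      also have "(\<Sum>j<n. ennreal (\<delta> j)) = ennreal (\<Sum>j<n. \<delta> j)"
        using \<delta>(1) by simp
      also have "H0 = ennreal (enn2real H0)"
        using False by (intro ennreal_enn2real[symmetric]) (simp add: less_top)
      also have "ennreal (enn2real H0) + ennreal (\<Sum>j<n. \<delta> j) = ennreal (enn2real H0 + (\<Sum>j<n. \<delta> j))"
        using \<delta>(1) by (intro ennreal_plus[symmetric] sum_nonneg) auto
      finally show ?thesis
        using \<delta>(1) by (intro enn2real_leI add_nonneg_nonneg sum_nonneg) auto
    qed
    have "(\<Sum>j<n. \<delta> j) \<le> (\<Sum>j<m. \<delta> j) + 2 * K"
      using \<delta>(2)[of m] \<delta>(2)[of "Suc m"] by (simp add: m)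
    with T_le have "enn2real T - (2 * K + enn2real H0) \<le> (\<Sum>j<m. \<delta> j)"
      by linarith
    then have "\<eta> * (enn2real T - (2 * K + enn2real H0)) \<le> \<eta> * (\<Sum>j<m. \<delta> j)"
      using \<eta> by (intro mult_left_mono) auto
    then have "exp (- \<eta> * (2 * K + enn2real H0)) * exp (\<eta> * enn2real T) \<le> exp (\<eta> * (\<Sum>j<m. \<delta> j))"
      by (simp add: algebra_simps flip: exp_add)
    then have "\<alpha> * (exp (- \<eta> * (2 * K + enn2real H0)) * exp (\<eta> * enn2real T)) \<le> \<alpha> * exp (\<eta> * (\<Sum>j<m. \<delta> j))"
      using \<alpha> by (intro mult_left_mono) auto
    also have "\<dots> \<le> F (r m)"
      by (rule grow)
    also have "\<dots> \<le> F (norm z / 8)"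
      using zm by (intro F_mono) simp
    finally have le: "\<alpha> * (exp (- \<eta> * (2 * K + enn2real H0)) * exp (\<eta> * enn2real T)) \<le> F (norm z / 8)" .
    have "ennreal C * ennreal (exp (\<eta> * enn2real T)) =
        ennreal c * ennreal (\<alpha> * (exp (- \<eta> * (2 * K + enn2real H0)) * exp (\<eta> * enn2real T)))"
      using c \<alpha> by (simp add: C_def mult_ac flip: ennreal_mult)
    also have "\<dots> \<le> ennreal c * ennreal (F (norm z / 8))"
      by (intro mult_left_mono ennreal_leI le) simp
    finally have "ennreal C * ennreal (exp (\<eta> * enn2real T)) * H z \<le> ennreal c * ennreal (F (norm z / 8)) * H z"
      by (rule mult_right_mono) simp
    also have "\<dots> = ennreal c * H z * ennreal (F (norm z / 8))"
      by (simp only: mult_ac)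
    also have "\<dots> \<le> ennreal (\<phi> z)"
      using core[of z] z R unfolding F_def by simp
    finally show ?thesis
      unfolding T_def by (simp only: mult_ac)
  qed
  moreover have "a0 \<le> 8 * R"
    using R by linarith
  ultimately show ?thesis
    using \<eta> C by blast
qed

text \<open>The supremum is a decreasing function of the norm, so its superlevel sets are intervals
  of radii.\<close>

lemma measurable_V_star: "V_star V \<in> borel_measurable borel"
proof (rule borel_measurableI_greater)
  fix y
  define W where "W r = (SUP u\<in>{u. r / 2 \<le> norm u}. ennreal (V u))" for r :: real
  have W: "W s \<le> W r" if "r \<le> s" for r s
    unfolding W_def using that by (intro SUP_subset_mono) auto
  have "is_interval {r. y < W r}"
    unfolding is_interval_1 using W by (auto intro: less_le_trans)
  then have "{r. y < W r} \<in> sets borel"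
    by (rule real_interval_borel_measurable)
  then have "norm -` {r. y < W r} \<inter> space borel \<in> sets borel"
    by (rule measurable_sets[OF borel_measurable_norm])
  then show "{x \<in> space borel. y < V_star V x} \<in> sets borel"
    by (simp add: W_def V_star_def vimage_def)
qed

context symmetric_levy_process
begin

lemma measurable_density: "\<nu> \<in> borel_measurable borel"
proof -
  have "\<nu> = (\<lambda>z. if z = 0 then \<nu> 0 else nu z)"
    by (auto simp: nu_eq)
  also have "\<dots> \<in> borel_measurable borel"
    by measurable
  finally show ?thesis .
qed

lemma measurable_Psi_norm: "(\<lambda>x::real^'n. Psi (1 / norm x)) \<in> borel_measurable borel"
proof -
  have "mono (\<lambda>r. Psi (max 0 r))"
    by (intro monoI Psi_mono) auto
  then have [measurable]: "(\<lambda>r. Psi (max 0 r)) \<in> borel_measurable borel"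
    by (rule borel_measurable_mono)
  have "(\<lambda>x::real^'n. Psi (max 0 (1 / norm x))) \<in> borel_measurable borel"
    by measurable
  then show ?thesis
    by simp
qed

text \<open>The dominant rate fixes the free time: \<open>1 / L x\<close> when the killing rate
  dominates, a multiple of \<open>1 / Psi (1 / norm x)\<close> otherwise. In both regimes the ratio
  obtained is eventually at most \<open>\<nu> x / Psi (1 / norm x)\<close>, which
  \<open>Psi_ge_nu\<close> bounds as required on annuli.\<close>

lemma solution_lower_bounds:
  fixes \<phi> V :: "real^'n \<Rightarrow> real"
  assumes density: "transition_density M X p" and A1: "A1 \<nu>" and A4: "A4 M X V r0"
    and sol: "\<forall>t\<ge>0. AE y in lborel. feynman_kac M X V t \<phi> y = \<phi> y"
    and cont: "continuous_on UNIV \<phi>" and pos: "\<And>x. 0 < \<phi> x"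
  shows "((\<lambda>x. ennreal (Psi (1 / norm x)) / V_star V x) \<longlongrightarrow> 0) at_infinity \<Longrightarrow>
      \<exists>\<eta>>0. \<exists>C>0. \<exists>R\<ge>2 * r0. \<forall>z. R < norm z \<longrightarrow>
        ennreal C * (ennreal (\<nu> z) / V_star V z) * ennreal (exp (\<eta> * enn2real
          (\<integral>\<^sup>+y\<in>{y. 2 * r0 \<le> norm y \<and> norm y \<le> norm z}. ennreal (\<nu> y) / V_star V y \<partial>lborel))) \<le> ennreal (\<phi> z)"
    (is "?L1 \<Longrightarrow> ?R1")
    and "Liminf at_infinity (\<lambda>x. ennreal (Psi (1 / norm x)) / V_star V x) > 0 \<Longrightarrow>
      \<exists>\<eta>>0. \<exists>C>0. \<exists>R\<ge>2 * r0. \<forall>z. R < norm z \<longrightarrow>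
        ennreal C * ennreal (\<nu> z / Psi (1 / norm z)) * ennreal (exp (\<eta> * enn2real
          (\<integral>\<^sup>+y\<in>{y. 2 * r0 \<le> norm y \<and> norm y \<le> norm z}. ennreal (\<nu> y / Psi (1 / norm y)) \<partial>lborel))) \<le> ennreal (\<phi> z)"
    (is "?L2 \<Longrightarrow> ?R2")
proof -
  let ?F = "\<lambda>x. LINT z|lborel. \<phi> z * indicator (ball 0 (norm x / 8)) z"
  obtain c R1 where c: "0 < c" and core: "\<And>x t. R1 \<le> norm x \<Longrightarrow> 0 < t \<Longrightarrow>
      (\<And>u. norm x / 2 \<le> norm u \<Longrightarrow> t * V u \<le> 1) \<Longrightarrow> t * Psi (1 / norm x) \<le> 1 \<Longrightarrow> c * t * \<nu> x * ?F x \<le> \<phi> x"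
    using solution_core_bound[OF density A1 A4 sol[rule_format] cont pos] by blast
  obtain c2 where c2: "0 < c2" "\<And>x. 1 \<le> norm x \<Longrightarrow> c2 * norm x ^ CARD('n) * \<nu> x \<le> Psi (1 / norm x)"
    using Psi_ge_nu[OF A1] by blast
  have F_nonneg: "0 \<le> ?F x" for x :: "real^'n"
    using pos by (intro integral_nonneg_AE AE_I2) (simp add: less_imp_le)
  have e_mult: "ennreal (d * a * b) = ennreal d * ennreal a * ennreal b" if "0 \<le> d" "0 \<le> a" "0 \<le> b" for d a b
    using that by (simp add: ennreal_mult)
  have \<nu>_pos: "0 < \<nu> x" if "1 \<le> norm x" for x
  proof (rule nu_pos)
    show "x \<noteq> 0"
      using that by auto
  qed
  have Psi_pos: "0 < Psi (1 / norm x)" and \<nu>_le: "\<nu> x / Psi (1 / norm x) \<le> (1 / c2) / norm x ^ CARD('n)"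
    if x: "1 \<le> norm x" for x
  proof -
    have "0 < norm x"
      using x by linarith
    then have n: "0 < norm x ^ CARD('n)"
      by simp
    then have "0 < c2 * norm x ^ CARD('n) * \<nu> x"
      using c2(1) \<nu>_pos[OF x] by simp
    then show P: "0 < Psi (1 / norm x)"
      using c2(2)[OF x] by linarith
    have "\<nu> x * (c2 * norm x ^ CARD('n)) \<le> 1 * Psi (1 / norm x)"
      using c2(2)[OF x] by (simp add: mult_ac)
    then have "\<nu> x / Psi (1 / norm x) \<le> 1 / (c2 * norm x ^ CARD('n))"
      using P n c2(1) by (simp add: frac_le_eq divide_simps)
    then show "\<nu> x / Psi (1 / norm x) \<le> (1 / c2) / norm x ^ CARD('n)"
      by simp
  qed
  have "\<forall>\<^sub>F u in at_infinity. V u < 1"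
    using A4 by (auto simp: A4_def intro: order_tendstoD)
  then obtain R2 where R2: "\<And>u. R2 \<le> norm u \<Longrightarrow> V u < 1"
    unfolding eventually_at_infinity by blast
  \<comment> \<open>Faithful as soon as \<open>V\<close> is below one beyond half the norm of
    \<open>x\<close>.\<close>
  define L where "L x = enn2real (V_star V x)" for x
  have L: "V_star V x = ennreal (L x)" if "2 * R2 \<le> norm x" for x
  proof -
    have "V_star V x \<le> ennreal 1"
      unfolding V_star_def
    proof (intro SUP_least ennreal_leI)
      fix u :: "real^'n"
      assume "u \<in> {u. norm x / 2 \<le> norm u}"
      then have "R2 \<le> norm u"
        using that by simp
      then show "V u \<le> 1"
        using R2[of u] by simp
    qed
    then show ?thesis
      unfolding L_def by (intro ennreal_enn2real[symmetric]) (auto intro: le_less_trans)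
  qed
  have L_nonneg: "0 \<le> L x" for x
    by (simp add: L_def)
  have V_le: "V u \<le> L x" if "2 * R2 \<le> norm x" "norm x / 2 \<le> norm u" for x u
  proof -
    have "ennreal (V u) \<le> ennreal (L x)"
      unfolding L[OF that(1), symmetric] V_star_def using that by (intro SUP_upper) simp
    then show ?thesis
      using L_nonneg[of x] by (cases "0 \<le> V u") (auto simp: ennreal_le_iff)
  qed
  show ?R1 if ?L1
  proof -
    have "\<forall>\<^sub>F x in at_infinity. ennreal (Psi (1 / norm x)) / V_star V x < 1"
      using that by (rule order_tendstoD) simp
    then obtain R3 where R3: "\<And>x. R3 \<le> norm x \<Longrightarrow> ennreal (Psi (1 / norm x)) / V_star V x < 1"
      unfolding eventually_at_infinity by blast
    define R0 where "R0 = max (max 1 R1) (max (2 * R2) R3)"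
    have H: "0 < L x" "Psi (1 / norm x) \<le> L x" "ennreal (\<nu> x) / V_star V x = ennreal (\<nu> x / L x)" if x: "R0 \<le> norm x" for x
    proof -
      have xs: "1 \<le> norm x" "2 * R2 \<le> norm x" "R3 \<le> norm x"
        using x by (auto simp: R0_def)
      note P = Psi_pos[OF xs(1)]
      have lt: "ennreal (Psi (1 / norm x)) / ennreal (L x) < 1"
        using R3[OF xs(3)] unfolding L[OF xs(2)] .
      \<comment> \<open>Since \<open>Psi\<close> is positive, a vanishing \<open>L x\<close> would
        make the quotient infinite, not below one.\<close>
      show L0: "0 < L x"
      proof (rule ccontr)
        assume "\<not> 0 < L x"
        then have "L x = 0"
          using L_nonneg[of x] by linarith
        then show False
          using lt P by (simp add: ennreal_eq_0_iff)
      qed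
      have "ennreal (Psi (1 / norm x) / L x) < 1"
        using lt P L0 by (simp add: divide_ennreal)
      then have "Psi (1 / norm x) / L x < 1"
        by (simp add: ennreal_less_one_iff)
      then show "Psi (1 / norm x) \<le> L x"
        using L0 by (simp add: divide_simps)
      show "ennreal (\<nu> x) / V_star V x = ennreal (\<nu> x / L x)"
        unfolding L[OF xs(2)] using \<nu>_pos[OF xs(1)] L0 by (intro divide_ennreal) auto
    qed
    show ?thesis
    proof (rule self_improving_lower_bound[OF cont pos _ c, where ?K0.0="1 / c2" and ?R0.0=R0])
      show "(\<lambda>x. ennreal (\<nu> x) / V_star V x) \<in> borel_measurable borel"
        using measurable_density measurable_V_star[of V] by measurable
      show "0 < 1 / c2"
        using c2 by simp
      fix x :: "real^'n" assume x: "R0 \<le> norm x"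
      then have xs: "1 \<le> norm x" "2 * R2 \<le> norm x" "R1 \<le> norm x"
        by (auto simp: R0_def)
      have "\<nu> x / L x \<le> \<nu> x / Psi (1 / norm x)"
        using H(2)[OF x] Psi_pos[OF xs(1)] \<nu>_pos[OF xs(1)] H(1)[OF x] by (intro divide_left_mono mult_pos_pos) auto
      then show "ennreal (\<nu> x) / V_star V x \<le> ennreal ((1 / c2) / norm x ^ CARD('n))"
        unfolding H(3)[OF x] using \<nu>_le[OF xs(1)] by (intro ennreal_leI) linarith
      have "c * (1 / L x) * \<nu> x * ?F x \<le> \<phi> x"
      proof (rule core[OF xs(3)])
        show "1 / L x * V u \<le> 1" if "norm x / 2 \<le> norm u" for u
          using V_le[OF xs(2) that] H(1)[OF x] by simp
        show "1 / L x * Psi (1 / norm x) \<le> 1"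
          using H(1,2)[OF x] by simp
      qed (use H(1)[OF x] in simp)
      then have "ennreal (c * (\<nu> x / L x) * ?F x) \<le> ennreal (\<phi> x)"
        by (intro ennreal_leI) simp
      then show "ennreal c * (ennreal (\<nu> x) / V_star V x) * ennreal (?F x) \<le> ennreal (\<phi> x)"
        unfolding H(3)[OF x] using c \<nu>_pos[OF xs(1)] H(1)[OF x]
        by (subst (asm) e_mult[OF _ _ F_nonneg]) simp_all
    qed
  qed
  show ?R2 if ?L2
  proof -
    obtain y where y: "0 < y" "y < Liminf at_infinity (\<lambda>x. ennreal (Psi (1 / norm x)) / V_star V x)"
      using dense[OF \<open>?L2\<close>] by blast
    define e where "e = enn2real y"
    have "y < \<top>"
      using y(2) by (auto intro: less_le_trans)
    then have ye: "y = ennreal e" "0 < e"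
      using y(1) by (auto simp: e_def enn2real_positive_iff)
    have "\<forall>\<^sub>F x in at_infinity. y < ennreal (Psi (1 / norm x)) / V_star V x"
      using y(2) by (rule less_LiminfD)
    then obtain R3 where R3: "\<And>x. R3 \<le> norm x \<Longrightarrow> ennreal e < ennreal (Psi (1 / norm x)) / V_star V x"
      unfolding eventually_at_infinity ye(1) by blast
    define R0 where "R0 = max (max 1 R1) (max (2 * R2) R3)"
    \<comment> \<open>The part \<open>1 / e\<close> gives \<open>t * V u \<le> 1\<close> for the
      time \<open>t\<close> chosen below, and the part \<open>1\<close> gives
      \<open>t * Psi (1 / norm x) \<le> 1\<close>.\<close>
    define m where "m = max 1 (1 / e)"
    have m: "1 \<le> m" "1 \<le> m * e"
      using ye(2) by (simp_all add: m_def max_def field_simps)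
    have L_le: "L x \<le> m * Psi (1 / norm x)" if x: "R0 \<le> norm x" for x
    proof (cases "L x = 0")
      \<comment> \<open>The quotient by \<open>V_star V x\<close> is infinite here and carries no
        information.\<close>
      case True
      have "1 \<le> norm x"
        using x by (auto simp: R0_def)
      from Psi_pos[OF this] show ?thesis
        using True m by simp
    next
      case False
      then have L0: "0 < L x"
        using L_nonneg[of x] by linarith
      have xs: "1 \<le> norm x" "2 * R2 \<le> norm x" "R3 \<le> norm x"
        using x by (auto simp: R0_def)
      have "ennreal e < ennreal (Psi (1 / norm x) / L x)"
        using R3[OF xs(3)] Psi_pos[OF xs(1)] L0 unfolding L[OF xs(2)] by (simp add: divide_ennreal)
      then have "e < Psi (1 / norm x) / L x"
        using ye(2) by (simp add: ennreal_less_iff)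
      then have "e * L x \<le> Psi (1 / norm x)"
        using L0 by (simp add: pos_less_divide_eq)
      then have "m * (e * L x) \<le> m * Psi (1 / norm x)"
        using m by (intro mult_left_mono) auto
      moreover have "1 * L x \<le> m * e * L x"
        using m L0 by (intro mult_right_mono) auto
      ultimately show ?thesis
        by (simp add: mult.assoc)
    qed
    show ?thesis
    proof (rule self_improving_lower_bound[OF cont pos, where ?K0.0="1 / c2" and ?R0.0=R0 and c="c / m"])
      show "(\<lambda>x. ennreal (\<nu> x / Psi (1 / norm x))) \<in> borel_measurable borel"
        using measurable_density measurable_Psi_norm by measurable
      show "0 < 1 / c2" "0 < c / m"
        using c2 c m by simp_all
      fix x :: "real^'n" assume x: "R0 \<le> norm x"
      then have xs: "1 \<le> norm x" "2 * R2 \<le> norm x" "R1 \<le> norm x"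
        by (auto simp: R0_def)
      note P = Psi_pos[OF xs(1)]
      show "ennreal (\<nu> x / Psi (1 / norm x)) \<le> ennreal ((1 / c2) / norm x ^ CARD('n))"
        by (intro ennreal_leI \<nu>_le xs)
      define t where "t = 1 / (m * Psi (1 / norm x))"
      have mP: "0 < m * Psi (1 / norm x)"
        using m P by simp
      have t: "0 < t"
        using mP by (simp add: t_def)
      have "c * t * \<nu> x * ?F x \<le> \<phi> x"
      proof (rule core[OF xs(3) t])
        fix u :: "real^'n"
        assume "norm x / 2 \<le> norm u"
        then have "V u \<le> m * Psi (1 / norm x)"
          using V_le[OF xs(2)] L_le[OF x] by force
        then show "t * V u \<le> 1"
          unfolding t_def using mP by (simp add: divide_le_eq)
      next
        have "1 * Psi (1 / norm x) \<le> m * Psi (1 / norm x)"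
          using m P by (intro mult_right_mono) auto
        then show "t * Psi (1 / norm x) \<le> 1"
          unfolding t_def using mP m(1) by (simp add: divide_le_eq)
      qed
      then have "ennreal (c / m * (\<nu> x / Psi (1 / norm x)) * ?F x) \<le> ennreal (\<phi> x)"
        by (intro ennreal_leI) (simp add: t_def)
      then show "ennreal (c / m) * ennreal (\<nu> x / Psi (1 / norm x)) * ennreal (?F x) \<le> ennreal (\<phi> x)"
        using c m \<nu>_pos[OF xs(1)] P by (subst (asm) e_mult[OF _ _ F_nonneg]) simp_all
    qed
  qed
qed

end

theorem theorem4p3:
  fixes M :: "'w measure"
    and X :: "real \<Rightarrow> 'w \<Rightarrow> real ^ 'n"
    and A :: "real ^ 'n ^ 'n"
    and \<nu> V \<phi> :: "real ^ 'n \<Rightarrow> real"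
    and p :: "real \<Rightarrow> real ^ 'n \<Rightarrow> ennreal"
    and r0 :: real
  defines "\<Psi> \<equiv> exponent_sup A \<nu>"
  assumes process: "symmetric_levy_process M X A \<nu>"
    and density: "transition_density M X p"
    and A1: "A1 \<nu>"
    and A2: "A2 p"
    and A3: "A3 M X A \<nu> p"
    and A4: "A4 M X V r0"
    and solution: "zero_energy_solution M X V \<phi>"
    and continuous_version: "continuous_on UNIV \<phi>"
    and positive: "\<forall>x. 0 < \<phi> x"
  shows
    "(((\<lambda>x. ennreal (\<Psi> (1 / norm x)) / V_star V x) \<longlongrightarrow> 0) at_infinity \<longrightarrow>
      (\<integral>\<^sup>+x\<in>{x. 2 * r0 < norm x}. ennreal (\<nu> x) / V_star V x \<partial>lborel) < \<infinity> \<longrightarrow>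
      (\<exists>C>0. \<exists>R\<ge>2 * r0. \<forall>x. R < norm x \<longrightarrow>
         ennreal (\<phi> x) \<ge> ennreal C * (ennreal (\<nu> x) / V_star V x)))
   \<and>
     (((\<lambda>x. ennreal (\<Psi> (1 / norm x)) / V_star V x) \<longlongrightarrow> 0) at_infinity \<longrightarrow>
      (\<integral>\<^sup>+x\<in>{x. 2 * r0 < norm x}. ennreal (\<nu> x) / V_star V x \<partial>lborel) = \<infinity> \<longrightarrow>
      (\<exists>\<eta>>0. \<exists>C>0. \<exists>R\<ge>2 * r0. \<forall>z. R < norm z \<longrightarrow>
         ennreal (\<phi> z) \<ge> ennreal C * (ennreal (\<nu> z) / V_star V z) *
           ennreal (exp (\<eta> * enn2real
             (\<integral>\<^sup>+y\<in>{y. 2 * r0 \<le> norm y \<and> norm y \<le> norm z}. ennreal (\<nu> y) / V_star V y \<partial>lborel)))))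
   \<and>
     (Liminf at_infinity (\<lambda>x. ennreal (\<Psi> (1 / norm x)) / V_star V x) > 0 \<longrightarrow>
      (\<integral>\<^sup>+x\<in>{x. 2 * r0 < norm x}. ennreal (\<nu> x / \<Psi> (1 / norm x)) \<partial>lborel) < \<infinity> \<longrightarrow>
      (\<exists>C>0. \<exists>R\<ge>2 * r0. \<forall>x. R < norm x \<longrightarrow>
         \<phi> x \<ge> C * (\<nu> x / \<Psi> (1 / norm x))))
   \<and>
     (Liminf at_infinity (\<lambda>x. ennreal (\<Psi> (1 / norm x)) / V_star V x) > 0 \<longrightarrow>
      (\<integral>\<^sup>+x\<in>{x. 2 * r0 < norm x}. ennreal (\<nu> x / \<Psi> (1 / norm x)) \<partial>lborel) = \<infinity> \<longrightarrow>
      (\<exists>\<eta>>0. \<exists>C>0. \<exists>R\<ge>2 * r0. \<forall>z. R < norm z \<longrightarrow>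
         \<phi> z \<ge> C * (\<nu> z / \<Psi> (1 / norm z)) *
           exp (\<eta> * (LINT y:{y. 2 * r0 \<le> norm y \<and> norm y \<le> norm z}|lborel.
                        \<nu> y / \<Psi> (1 / norm y)))))"
proof -
  interpret symmetric_levy_process M X A \<nu>
    by (rule process)
  have sol: "\<forall>t\<ge>0. AE y in lborel. feynman_kac M X V t \<phi> y = \<phi> y"
    using solution by (simp add: zero_energy_solution_def)
  have pos: "\<And>x. 0 < \<phi> x"
    using positive by blast
  have r0: "0 < r0"
    using A4 by (simp add: A4_def)
  note bounds = solution_lower_bounds[OF density A1 A4 sol continuous_version pos, folded \<Psi>_def]
  \<comment> \<open>The exponent is nonnegative, so dropping the exponential factor weakens the
    bound to the form of the first and third claim.\<close>
  have drop_exp: "a \<le> a * ennreal (exp (\<eta> * enn2real b))" if "0 < \<eta>" for a b \<eta>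
  proof -
    have "a * ennreal 1 \<le> a * ennreal (exp (\<eta> * enn2real b))"
      using that by (intro mult_left_mono ennreal_leI) auto
    then show ?thesis
      by simp
  qed
  have ratio_nonneg: "0 \<le> \<nu> y / \<Psi> (1 / norm y)" if "y \<noteq> 0" for y
    unfolding \<Psi>_def using nu_pos[OF that] by (intro divide_nonneg_nonneg Psi_nonneg) auto
  \<comment> \<open>Both sides follow the same convention: should the integral be infinite, the
    Bochner integral and \<open>enn2real\<close> are both \<open>0\<close>.\<close>
  have LINT_eq: "(LINT y:{y. 2 * r0 \<le> norm y \<and> norm y \<le> norm z}|lborel. \<nu> y / \<Psi> (1 / norm y)) =
      enn2real (\<integral>\<^sup>+y\<in>{y. 2 * r0 \<le> norm y \<and> norm y \<le> norm z}. ennreal (\<nu> y / \<Psi> (1 / norm y)) \<partial>lborel)" for z :: "real^'n"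
  proof -
    let ?S = "{y::real^'n. 2 * r0 \<le> norm y \<and> norm y \<le> norm z}"
    have S: "0 \<le> indicator ?S y * (\<nu> y / \<Psi> (1 / norm y))" for y
      using ratio_nonneg[of y] r0 by (cases "y = 0") (auto simp: indicator_def)
    have "(LINT y:?S|lborel. \<nu> y / \<Psi> (1 / norm y)) =
        enn2real (\<integral>\<^sup>+y. ennreal (indicator ?S y * (\<nu> y / \<Psi> (1 / norm y))) \<partial>lborel)"
      unfolding set_lebesgue_integral_def real_scaleR_def
    proof (rule integral_eq_nn_integral)
      show "(\<lambda>y. indicator ?S y * (\<nu> y / \<Psi> (1 / norm y))) \<in> borel_measurable lborel"
        using measurable_density measurable_Psi_norm unfolding \<Psi>_def by measurable
    qed (use S in auto)
    also have "(\<integral>\<^sup>+y. ennreal (indicator ?S y * (\<nu> y / \<Psi> (1 / norm y))) \<partial>lborel) =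
        (\<integral>\<^sup>+y\<in>?S. ennreal (\<nu> y / \<Psi> (1 / norm y)) \<partial>lborel)"
      by (intro nn_integral_cong) (simp add: indicator_def)
    finally show ?thesis .
  qed
  have real_le: "C * (\<nu> z / \<Psi> (1 / norm z)) * e \<le> \<phi> z"
    if "ennreal C * ennreal (\<nu> z / \<Psi> (1 / norm z)) * ennreal e \<le> ennreal (\<phi> z)" "0 < C" "0 \<le> e" "2 * r0 < norm z" for C e z
  proof -
    have "z \<noteq> 0"
      using that(4) r0 by auto
    from ratio_nonneg[OF this] that have "ennreal (C * (\<nu> z / \<Psi> (1 / norm z)) * e) \<le> ennreal (\<phi> z)"
      by (simp only: ennreal_mult mult_nonneg_nonneg less_imp_le)
    then show ?thesis
      using pos[of z] by (simp only: ennreal_le_iff less_imp_le)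
  qed
  show ?thesis
  proof (intro conjI impI)
    assume "((\<lambda>x. ennreal (\<Psi> (1 / norm x)) / V_star V x) \<longlongrightarrow> 0) at_infinity"
    from bounds(1)[OF this]
    show "\<exists>C>0. \<exists>R\<ge>2 * r0. \<forall>x. R < norm x \<longrightarrow> ennreal (\<phi> x) \<ge> ennreal C * (ennreal (\<nu> x) / V_star V x)"
      using drop_exp by (blast intro: order_trans)
  next
    assume "((\<lambda>x. ennreal (\<Psi> (1 / norm x)) / V_star V x) \<longlongrightarrow> 0) at_infinity"
    from bounds(1)[OF this]
    show "\<exists>\<eta>>0. \<exists>C>0. \<exists>R\<ge>2 * r0. \<forall>z. R < norm z \<longrightarrow>
         ennreal (\<phi> z) \<ge> ennreal C * (ennreal (\<nu> z) / V_star V z) *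
           ennreal (exp (\<eta> * enn2real
             (\<integral>\<^sup>+y\<in>{y. 2 * r0 \<le> norm y \<and> norm y \<le> norm z}. ennreal (\<nu> y) / V_star V y \<partial>lborel)))" .
  next
    assume "Liminf at_infinity (\<lambda>x. ennreal (\<Psi> (1 / norm x)) / V_star V x) > 0"
    from bounds(2)[OF this]
    obtain \<eta> C R where b: "0 < \<eta>" "0 < C" "2 * r0 \<le> R" "\<And>z. R < norm z \<Longrightarrow>
        ennreal C * ennreal (\<nu> z / \<Psi> (1 / norm z)) * ennreal (exp (\<eta> * enn2real
          (\<integral>\<^sup>+y\<in>{y. 2 * r0 \<le> norm y \<and> norm y \<le> norm z}. ennreal (\<nu> y / \<Psi> (1 / norm y)) \<partial>lborel))) \<le> ennreal (\<phi> z)"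
      by blast
    have "C * (\<nu> x / \<Psi> (1 / norm x)) \<le> \<phi> x" if "R < norm x" for x
      using real_le[of C x 1] order_trans[OF drop_exp[OF b(1)] b(4)[OF that]] b(2,3) that by simp
    then show "\<exists>C>0. \<exists>R\<ge>2 * r0. \<forall>x. R < norm x \<longrightarrow> \<phi> x \<ge> C * (\<nu> x / \<Psi> (1 / norm x))"
      using b(2,3) by blast
  next
    assume "Liminf at_infinity (\<lambda>x. ennreal (\<Psi> (1 / norm x)) / V_star V x) > 0"
    from bounds(2)[OF this]
    obtain \<eta> C R where b: "0 < \<eta>" "0 < C" "2 * r0 \<le> R" "\<And>z. R < norm z \<Longrightarrow>
        ennreal C * ennreal (\<nu> z / \<Psi> (1 / norm z)) * ennreal (exp (\<eta> * enn2real
          (\<integral>\<^sup>+y\<in>{y. 2 * r0 \<le> norm y \<and> norm y \<le> norm z}. ennreal (\<nu> y / \<Psi> (1 / norm y)) \<partial>lborel))) \<le> ennreal (\<phi> z)"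
      by blast
    have "C * (\<nu> z / \<Psi> (1 / norm z)) * exp (\<eta> * (LINT y:{y. 2 * r0 \<le> norm y \<and> norm y \<le> norm z}|lborel. \<nu> y / \<Psi> (1 / norm y))) \<le> \<phi> z"
      if "R < norm z" for z
      unfolding LINT_eq using b(3) that by (intro real_le b) auto
    then show "\<exists>\<eta>>0. \<exists>C>0. \<exists>R\<ge>2 * r0. \<forall>z. R < norm z \<longrightarrow>
         \<phi> z \<ge> C * (\<nu> z / \<Psi> (1 / norm z)) *
           exp (\<eta> * (LINT y:{y. 2 * r0 \<le> norm y \<and> norm y \<le> norm z}|lborel. \<nu> y / \<Psi> (1 / norm y)))"
      using b(1-3) by blast
  qed
qed

end
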